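(* Let $b,c,m\in\mathbb{R}$ with $D\ge0$, and let $1<p<\infty$ be such that $0\ne s_1<\frac{m+1}p<s_2+2$. Then for $z\in\mathbb{C}_+$ $$e^{zL}f(y)=\int_0^\infty p_L(z,y,\rho)f(\rho)\,d\rho,\qquad f\in L^p_m,$$ where $$p_L(z,y,\rho)=\frac1{2z}y^{\frac{1-c}2}\rho^{\frac{1+c}2}\exp\Big\{-\frac{y^2+\rho^2}{4z}\Big\}I_{\sqrt D}\Big(\frac{y\rho}{2z}\Big).$$ For every $\varepsilon>0$ (with $\varepsilon<\pi/2$) there exist $C_\varepsilon>0$ and $\kappa_\varepsilon>0$ such that for all $z\in\Sigma_{\frac\pi2-\varepsilon}$ and $y,\rho>0$ $$|p_L(z,y,\rho)|\le C_\varepsilon|z|^{-\frac12}\Big(\frac y{|z|^{1/2}}\wedge1\Big)^{-s_1}\Big(\frac\rho{|z|^{1/2}}\wedge1\Big)^{-s_1+c}\exp\Big(-\frac{|y-\rho|^2}{\kappa_\varepsilon|z|}\Big)$$ and $$y^{-1}|p_L(z,y,\rho)|+|D_yp_L(z,y,\rho)|\le C_\varepsilon|z|^{-1}\Big(\frac y{|z|^{1/2}}\wedge1\Big)^{-s_1-1}\Big(\frac\rho{|z|^{1/2}}\wedge1\Big)^{-s_1+c}\exp\Big(-\frac{|y-\rho|^2}{\kappa_\varepsilon|z|}\Big).$$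
   Context: $L^p_m=L^p((0,\infty);y^m\,dy)$; $\mathbb{C}_+=\{\mathrm{Re}\,z>0\}$; $\Sigma_\phi=\{z\in\mathbb{C}\setminus\{0\}:|\arg z|<\phi\}$; $a\wedge b=\min\{a,b\}$; $I_\nu$ is the modified Bessel function of the first kind. $L=D_{yy}+\frac cyD_y-\frac b{y^2}$ on $(0,\infty)$, $D=b+\left(\frac{c-1}2\right)^2$, $s_1=\frac{c-1}2-\sqrt D$, $s_2=\frac{c-1}2+\sqrt D$. $D(L_{m,p,max})=\{u\in L^p_m\cap W^{2,p}_{loc}(0,\infty):Lu\in L^p_m\}$. For $s_1<\frac{m+1}p<s_2+2$, $L_{m,p}$ is $L$ with domain: if $D>0$, the set of $u\in D(L_{m,p,max})$ such that $y^{-2\theta}u\in L^p_m$ for every $\theta\in(0,1]$ with $s_1+2\theta<\frac{m+1}p$; if $D=0$, the set of $u\in D(L_{m,p,max})$ for which $\lim_{y\to0}y^{s_1}u(y)$ exists in $\mathbb{C}$. It generates a bounded analytic semigroup of angle $\pi/2$ on $L^p_m$, denoted $(e^{zL})_{z\in\mathbb{C}_+}$. *)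

theory Defs
  imports "HOL-Analysis.Analysis"
begin

subsection \<open>The spaces of $p$-integrable functions for the measure $y^m\,dy$ on the half-line\<close>

text \<open>Elements of the spaces are represented by functions; only their values on
  \<open>{0<..}\<close> matter, and equality is \<open>AE y in half_line\<close>.\<close>

abbreviation half_line :: "real measure" where
  "half_line \<equiv> lebesgue_on {0<..}"

definition weight_measure :: "real \<Rightarrow> real measure" where
  "weight_measure m = density half_line (\<lambda>y. ennreal (y powr m))"

definition Lp_space :: "real \<Rightarrow> real \<Rightarrow> (real \<Rightarrow> complex) set" where
  "Lp_space m p = {f. f \<in> borel_measurable (weight_measure m) \<and>
     integrable (weight_measure m) (\<lambda>y. norm (f y) powr p)}"

definition Lp_norm :: "real \<Rightarrow> real \<Rightarrow> (real \<Rightarrow> complex) \<Rightarrow> real" where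
  "Lp_norm m p f = (integral\<^sup>L (weight_measure m) (\<lambda>y. norm (f y) powr p)) powr (1 / p)"

definition Lp_loc :: "real \<Rightarrow> (real \<Rightarrow> complex) set" where
  "Lp_loc p = {f. f \<in> borel_measurable half_line \<and>
     (\<forall>K. compact K \<and> K \<subseteq> {0<..} \<longrightarrow> integrable (lebesgue_on K) (\<lambda>y. norm (f y) powr p))}"


subsection \<open>Weak derivatives and local Sobolev spaces on the half-line\<close>

definition test_function :: "(real \<Rightarrow> real) \<Rightarrow> bool" where
  "test_function \<phi> \<longleftrightarrow> (\<forall>n x. (deriv ^^ n) \<phi> field_differentiable (at x)) \<and>
     (\<exists>K. compact K \<and> K \<subseteq> {0<..} \<and> (\<forall>x. x \<notin> K \<longrightarrow> \<phi> x = 0))"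

definition is_weak_deriv :: "(real \<Rightarrow> complex) \<Rightarrow> (real \<Rightarrow> complex) \<Rightarrow> bool" where
  "is_weak_deriv u v \<longleftrightarrow> u \<in> Lp_loc 1 \<and> v \<in> Lp_loc 1 \<and>
     (\<forall>\<phi>. test_function \<phi> \<longrightarrow>
        integral\<^sup>L half_line (\<lambda>y. u y * of_real (deriv \<phi> y)) =
        - integral\<^sup>L half_line (\<lambda>y. v y * of_real (\<phi> y)))"

text \<open>A weak derivative is unique almost everywhere, so the choice below is immaterial.\<close>

definition weak_deriv :: "(real \<Rightarrow> complex) \<Rightarrow> (real \<Rightarrow> complex)" where
  "weak_deriv u = (SOME v. is_weak_deriv u v)"

definition W2p_loc :: "real \<Rightarrow> (real \<Rightarrow> complex) set" where
  "W2p_loc p = {u. u \<in> Lp_loc p \<and>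
     (\<exists>v w. is_weak_deriv u v \<and> is_weak_deriv v w \<and> v \<in> Lp_loc p \<and> w \<in> Lp_loc p)}"


subsection \<open>The operator $L = D_{yy} + (c/y) D_y - b/y^2$\<close>

definition discr :: "real \<Rightarrow> real \<Rightarrow> real" where
  "discr b c = b + ((c - 1) / 2)\<^sup>2"

definition s1 :: "real \<Rightarrow> real \<Rightarrow> real" where
  "s1 b c = (c - 1) / 2 - sqrt (discr b c)"

definition s2 :: "real \<Rightarrow> real \<Rightarrow> real" where
  "s2 b c = (c - 1) / 2 + sqrt (discr b c)"

definition L_op :: "real \<Rightarrow> real \<Rightarrow> (real \<Rightarrow> complex) \<Rightarrow> (real \<Rightarrow> complex)" where
  "L_op b c u = (\<lambda>y. weak_deriv (weak_deriv u) y + of_real (c / y) * weak_deriv u y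
                      - of_real (b / y\<^sup>2) * u y)"

definition L_max_dom :: "real \<Rightarrow> real \<Rightarrow> real \<Rightarrow> real \<Rightarrow> (real \<Rightarrow> complex) set" where
  "L_max_dom b c m p = {u. u \<in> Lp_space m p \<inter> W2p_loc p \<and> L_op b c u \<in> Lp_space m p}"

text \<open>For \<open>discr b c = 0\<close> the limit at \<open>0\<close> is a condition on the continuous representative
  of \<open>u\<close>, which exists because \<open>u\<close> is locally Sobolev; hence the auxiliary \<open>v\<close>.
  The domain is only meant for \<open>0 \<le> discr b c\<close>.\<close>

definition L_dom :: "real \<Rightarrow> real \<Rightarrow> real \<Rightarrow> real \<Rightarrow> (real \<Rightarrow> complex) set" where
  "L_dom b c m p =
     (if discr b c > 0
      then {u \<in> L_max_dom b c m p.
              \<forall>\<theta>. 0 < \<theta> \<and> \<theta> \<le> 1 \<and> s1 b c + 2 * \<theta> < (m + 1) / p \<longrightarrow>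
                (\<lambda>y. of_real (y powr (- 2 * \<theta>)) * u y) \<in> Lp_space m p}
      else {u \<in> L_max_dom b c m p.
              \<exists>v l. continuous_on {0<..} v \<and> (AE y in half_line. v y = u y) \<and>
                ((\<lambda>y. of_real (y powr s1 b c) * v y) \<longlongrightarrow> l) (at_right 0)})"


subsection \<open>Bounded analytic semigroups\<close>

definition sector :: "real \<Rightarrow> complex set" where
  "sector \<phi> = {z. z \<noteq> 0 \<and> \<bar>Arg z\<bar> < \<phi>}"

text \<open>\<open>T z\<close> acts on representatives. Its compatibility with almost everywhere equality follows
  from linearity and boundedness. Holomorphy is stated in the strong sense, which is equivalent
  to holomorphy in operator norm.\<close>

definition bounded_analytic_semigroup ::
    "real \<Rightarrow> real \<Rightarrow> real \<Rightarrow> (complex \<Rightarrow> (real \<Rightarrow> complex) \<Rightarrow> (real \<Rightarrow> complex)) \<Rightarrow> bool" where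
  "bounded_analytic_semigroup m p \<phi> T \<longleftrightarrow>
     (\<forall>z\<in>sector \<phi>. \<forall>f\<in>Lp_space m p. T z f \<in> Lp_space m p) \<and>
     (\<forall>z\<in>sector \<phi>. \<forall>f\<in>Lp_space m p. \<forall>g\<in>Lp_space m p. \<forall>\<alpha> \<beta>.
        AE y in half_line. T z (\<lambda>x. \<alpha> * f x + \<beta> * g x) y = \<alpha> * T z f y + \<beta> * T z g y) \<and>
     (\<forall>z\<in>sector \<phi>. \<forall>w\<in>sector \<phi>. \<forall>f\<in>Lp_space m p.
        AE y in half_line. T (z + w) f y = T z (T w f) y) \<and>
     (\<forall>z\<in>sector \<phi>. \<forall>f\<in>Lp_space m p. \<exists>g\<in>Lp_space m p.
        ((\<lambda>h. Lp_norm m p (\<lambda>y. (T (z + h) f y - T z f y) / h - g y)) \<longlongrightarrow> 0) (at 0)) \<and>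
     (\<forall>\<phi>'. 0 < \<phi>' \<and> \<phi>' < \<phi> \<longrightarrow>
        (\<forall>f\<in>Lp_space m p.
           ((\<lambda>z. Lp_norm m p (\<lambda>y. T z f y - f y)) \<longlongrightarrow> 0) (at 0 within sector \<phi>')) \<and>
        (\<exists>M. \<forall>z\<in>sector \<phi>'. \<forall>f\<in>Lp_space m p. Lp_norm m p (T z f) \<le> M * Lp_norm m p f))"

text \<open>The operator \<open>A\<close> with domain \<open>X\<close> is the generator of \<open>T\<close>: the two graphs, of \<open>A\<close> and of
  the right derivative of \<open>T\<close> at \<open>0\<close>, coincide.\<close>

definition generates_bounded_analytic_semigroup ::
    "real \<Rightarrow> real \<Rightarrow> real \<Rightarrow> (real \<Rightarrow> complex) set \<Rightarrow> ((real \<Rightarrow> complex) \<Rightarrow> (real \<Rightarrow> complex)) \<Rightarrow>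
     (complex \<Rightarrow> (real \<Rightarrow> complex) \<Rightarrow> (real \<Rightarrow> complex)) \<Rightarrow> bool" where
  "generates_bounded_analytic_semigroup m p \<phi> X A T \<longleftrightarrow>
     bounded_analytic_semigroup m p \<phi> T \<and>
     (\<forall>f\<in>Lp_space m p. \<forall>g\<in>Lp_space m p.
        ((\<lambda>t::real. Lp_norm m p (\<lambda>y. (T (of_real t) f y - f y) / of_real t - g y)) \<longlongrightarrow> 0)
           (at_right 0)
        \<longleftrightarrow> f \<in> X \<and> (AE y in half_line. A f y = g y))"


subsection \<open>The kernel\<close>

text \<open>Modified Bessel function of the first kind, with the principal branch of the power.
  The reciprocal Gamma function makes the series valid for all orders. Since
  \<open>0 powr 0 = 0\<close>, the value at \<open>z = 0\<close> is not the intended one for \<open>\<nu> = 0\<close>; it is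
  never used.\<close>

definition bessel_I :: "real \<Rightarrow> complex \<Rightarrow> complex" where
  "bessel_I \<nu> z = (z / 2) powr of_real \<nu> *
     (\<Sum>k. (z / 2) ^ (2 * k) / fact k * rGamma (of_real \<nu> + of_nat k + 1))"

definition p_L :: "real \<Rightarrow> real \<Rightarrow> complex \<Rightarrow> real \<Rightarrow> real \<Rightarrow> complex" where
  "p_L b c z y \<rho> =
     1 / (2 * z) * of_real (y powr ((1 - c) / 2)) * of_real (\<rho> powr ((1 + c) / 2)) *
     exp (- (of_real (y\<^sup>2 + \<rho>\<^sup>2) / (4 * z))) *
     bessel_I (sqrt (discr b c)) (of_real (y * \<rho>) / (2 * z))"

end

theory Submission
  imports Defs
begin

text \<open>Write $\nu = \sqrt D$. For $\mathrm{Re}\, v > 0$ the Gaussians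
  $g_v(y) = v^{-\nu-1} y^{-s_1} e^{-y^2/4v}$ belong to the domain of $L$ and satisfy
  $\partial_v g_v = L g_v$, so that $e^{zL} g_v = g_{v+z}$; by Weber's integral the kernel acts on
  them in the same way. In the variable $e^{-y^2}$ the Gaussians with $v = 1/4n$ span all polynomials
  up to a weight, hence are dense in $L^p_m$ when $s_1 < \frac{m+1}p$, while $\frac{m+1}p < s_2 + 2$
  puts $p_L(z,y,\cdot)$ into the dual space; so the identity extends to all of $L^p_m$.

  The bounds rest on Poisson's integral for $I_\nu$, which yields the growth $e^{\mathrm{Re}\, w}$ in
  sectors together with one more power of decay for $I_\nu - I_{\nu+1}$. That cancellation is what
  controls $D_y p_L$.\<close>

subsection \<open>Gaussian integrals\<close>

text \<open>The semigroup T is known only through its generator, so it has to be identified on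
  explicit orbits: a differentiable curve in the domain that solves the evolution equation must
  agree with T. Since z is complex, the curve is the segment from \<tau> to \<tau> + z, which is why
  the Gaussians carry a complex time v. T acts on representatives, so identities between vectors
  become statements almost everywhere; they are detected by integrals over bounded intervals. In the
  bounds everything is scaled by the square root of |z|. In the sector Re z \<ge> |z| sin
  \<epsilon>, so the Gaussian factor together with the growth of the Bessel function is at most
  exp(- sin \<epsilon> (y - \<rho>)^2 / (4 |z|)). Half of this exponent is spent on polynomial
  factors, the other half leaves \<kappa> = 8 / sin \<epsilon>. Differentiation in y produces \<rho>
  I_{\<nu>+1} - y I_\<nu> over 2 z, in which either term alone is too large by a factor of order y /
  |z|^{1/2}.\<close>

lemma integrable_lebesgue_on_iff:
  fixes f :: "real \<Rightarrow> 'a::{banach, second_countable_topology,euclidean_space}"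
  assumes "S \<in> sets lebesgue"
  shows "integrable (lebesgue_on S) f \<longleftrightarrow> f absolutely_integrable_on S"
  using assms by (simp add: set_integrable_def integrable_restrict_space)

text \<open>Beta and Gamma integrals enter as gauge integrals. For a nonnegative integrand gauge
  integrability is absolute, so the value carries over to the Lebesgue integral.\<close>

lemma has_integral_nonneg_lebesgue_on:
  fixes f :: "real \<Rightarrow> real"
  assumes "(f has_integral I) S" "\<And>x. x \<in> S \<Longrightarrow> 0 \<le> f x" "S \<in> sets lebesgue"
  shows "integrable (lebesgue_on S) f" "integral\<^sup>L (lebesgue_on S) f = I"
proof -
  have "f absolutely_integrable_on S"
    using assms by (intro nonnegative_absolutely_integrable_1) auto
  thus *: "integrable (lebesgue_on S) f"
    using assms by (simp add: integrable_lebesgue_on_iff)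
  show "integral\<^sup>L (lebesgue_on S) f = I"
    using lebesgue_integral_eq_integral[OF * assms(3)] assms(1) by (simp add: integral_unique)
qed

text \<open>Substitution t = q x^2 in Euler's integral for Gamma. The exponent 2 \<mu> - 1 is what
  t^{\<mu>-1} dt leaves behind: 2 (\<mu> - 1) from the power and 1 from dt.\<close>

lemma gaussian_moment_real:
  fixes q \<mu> :: real
  assumes "q > 0" "\<mu> > 0"
  shows "integrable half_line (\<lambda>x. x powr (2 * \<mu> - 1) * exp (- (q * x\<^sup>2)))"
    and "integral\<^sup>L half_line (\<lambda>x. x powr (2 * \<mu> - 1) * exp (- (q * x\<^sup>2))) = Gamma \<mu> / 2 * q powr (- \<mu>)"
proof -
  define f where "f = (\<lambda>t. t powr (\<mu> - 1) / exp t)"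
  have im: "(\<lambda>x. q * x\<^sup>2) ` {0<..} = {0<..}"
  proof safe
    fix t :: real assume "t > 0"
    thus "t \<in> (\<lambda>x. q * x\<^sup>2) ` {0<..}"
      using assms by (intro image_eqI[of _ _ "sqrt (t / q)"]) auto
  qed (use assms in auto)
  have "(f has_integral Gamma \<mu>) {0..}"
    unfolding f_def using Gamma_integral_real[OF assms(2)] .
  \<comment> \<open>The null set {0} is dropped so that the domain is the image of the open
    half-line under x \<mapsto> q x^2.\<close>
  hence f: "(f has_integral Gamma \<mu>) {0<..}"
    by (subst has_integral_spike_set_eq[where T="{0..}"]) (auto intro: negligible_subset[of "{0}"])
  hence "f absolutely_integrable_on {0<..}"
    by (intro nonnegative_absolutely_integrable_1) (auto simp: f_def)
  hence F: "f absolutely_integrable_on (\<lambda>x. q * x\<^sup>2) ` {0<..} \<and> integral ((\<lambda>x. q * x\<^sup>2) ` {0<..}) f = Gamma \<mu>"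
    using f im by (auto simp: integral_unique)
  have inj: "inj_on (\<lambda>x. q * x\<^sup>2) {0<..}"
    using assms by (auto simp: inj_on_def)
  have der: "((\<lambda>x. q * x\<^sup>2) has_real_derivative 2 * q * x) (at x within {0<..})" for x
    by (auto intro!: derivative_eq_intros)
  have G: "(\<lambda>x. \<bar>2 * q * x\<bar> * f (q * x\<^sup>2)) absolutely_integrable_on {0<..} \<and>
      integral {0<..} (\<lambda>x. \<bar>2 * q * x\<bar> * f (q * x\<^sup>2)) = Gamma \<mu>"
    by (subst has_absolute_integral_change_of_variables_1'[OF _ der inj]) (use F in auto)
  have eq: "\<bar>2 * q * x\<bar> * f (q * x\<^sup>2) = 2 * q powr \<mu> * (x powr (2 * \<mu> - 1) * exp (- (q * x\<^sup>2)))" if "x > 0" for x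
  proof -
    have "\<bar>2 * q * x\<bar> * f (q * x\<^sup>2) = 2 * q * x * ((q * x\<^sup>2) powr (\<mu> - 1) * exp (- (q * x\<^sup>2)))"
      using that assms by (simp add: f_def exp_minus field_simps)
    also have "(q * x\<^sup>2) powr (\<mu> - 1) = q powr (\<mu> - 1) * x powr (2 * (\<mu> - 1))"
      using that assms by (simp add: powr_mult powr_powr flip: powr_numeral)
    also have "2 * q * x * (q powr (\<mu> - 1) * x powr (2 * (\<mu> - 1)) * exp (- (q * x\<^sup>2))) =
       2 * (q powr 1 * q powr (\<mu> - 1)) * ((x powr 1 * x powr (2 * (\<mu> - 1))) * exp (- (q * x\<^sup>2)))"
      using that assms by (simp only: powr_one_gt_zero_iff mult_ac) simp
    also have "\<dots> = 2 * q powr \<mu> * (x powr (2 * \<mu> - 1) * exp (- (q * x\<^sup>2)))"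
      unfolding powr_add[symmetric] by (simp add: algebra_simps)
    finally show ?thesis .
  qed
  have "integrable half_line (\<lambda>x. \<bar>2 * q * x\<bar> * f (q * x\<^sup>2))"
    using G by (simp add: integrable_lebesgue_on_iff)
  moreover have "integral\<^sup>L half_line (\<lambda>x. \<bar>2 * q * x\<bar> * f (q * x\<^sup>2)) = Gamma \<mu>"
    using lebesgue_integral_eq_integral[OF calculation] G by auto
  moreover have "integrable half_line (\<lambda>x. \<bar>2 * q * x\<bar> * f (q * x\<^sup>2)) \<longleftrightarrow>
      integrable half_line (\<lambda>x. 2 * q powr \<mu> * (x powr (2 * \<mu> - 1) * exp (- (q * x\<^sup>2))))"
    by (rule Bochner_Integration.integrable_cong) (rule refl, rule eq, simp)
  moreover have "integral\<^sup>L half_line (\<lambda>x. \<bar>2 * q * x\<bar> * f (q * x\<^sup>2)) =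
      integral\<^sup>L half_line (\<lambda>x. 2 * q powr \<mu> * (x powr (2 * \<mu> - 1) * exp (- (q * x\<^sup>2))))"
    by (rule Bochner_Integration.integral_cong) (rule refl, rule eq, simp)
  ultimately have H: "integrable half_line (\<lambda>x. 2 * q powr \<mu> * (x powr (2 * \<mu> - 1) * exp (- (q * x\<^sup>2))))"
     "integral\<^sup>L half_line (\<lambda>x. 2 * q powr \<mu> * (x powr (2 * \<mu> - 1) * exp (- (q * x\<^sup>2)))) = Gamma \<mu>"
    by simp_all
  show "integrable half_line (\<lambda>x. x powr (2 * \<mu> - 1) * exp (- (q * x\<^sup>2)))"
    using H(1) assms by simp
  show "integral\<^sup>L half_line (\<lambda>x. x powr (2 * \<mu> - 1) * exp (- (q * x\<^sup>2))) = Gamma \<mu> / 2 * q powr (- \<mu>)"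
    using H(2) assms by (simp add: powr_minus field_simps)
qed

text \<open>The binomial series of (1 - x)^{-\<mu>}, multiplied by \<open>Gamma \<mu>\<close>; its
  signs cancel against those of (-x)^k. The second claim is the same series at the real point
  \<open>norm x\<close>, the form in which it will justify termwise integration.\<close>

lemma Gamma_pochhammer_sums:
  fixes \<mu> :: real and x :: complex
  assumes "\<mu> > 0" "norm x < 1"
  shows "(\<lambda>k. of_real (Gamma (\<mu> + real k) / fact k) * x ^ k) sums (of_real (Gamma \<mu>) * (1 - x) powr (- of_real \<mu>))"
    and "summable (\<lambda>k. Gamma (\<mu> + real k) / fact k * norm x ^ k)"
proof -
  have nz: "\<mu> \<notin> \<int>\<^sub>\<le>\<^sub>0" using assms by (auto elim!: nonpos_Ints_cases)
  have gc: "(-\<mu>) gchoose k = (-1)^k * Gamma (\<mu> + real k) / Gamma \<mu> / fact k" for k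
    using pochhammer_Gamma[OF nz, of k] by (simp add: gbinomial_pochhammer)
  have gcc: "(of_real (-\<mu>) :: complex) gchoose k = (-1)^k * of_real (Gamma (\<mu> + real k) / Gamma \<mu> / fact k)" for k
    unfolding gbinomial_pochhammer pochhammer_of_real[symmetric] of_real_minus[symmetric] using pochhammer_Gamma[OF nz, of k]
    by (simp add: pochhammer_of_real)
  have G: "Gamma \<mu> > 0" using assms by (simp add: Gamma_real_pos)
  have "(\<lambda>n. ((of_real (-\<mu>) :: complex) gchoose n) * (-x) ^ n) sums (1 + (-x)) powr (of_real (-\<mu>))"
    using assms by (intro gen_binomial_complex) auto
  hence "(\<lambda>n. of_real (Gamma \<mu>) * (((of_real (-\<mu>) :: complex) gchoose n) * (-x) ^ n)) sums (of_real (Gamma \<mu>) * (1 + (-x)) powr (of_real (-\<mu>)))"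
    by (rule sums_mult)
  also have "(\<lambda>n. of_real (Gamma \<mu>) * (((of_real (-\<mu>) :: complex) gchoose n) * (-x) ^ n)) = 
      (\<lambda>k. of_real (Gamma (\<mu> + real k) / fact k) * x ^ k)"
    unfolding gcc power_minus[of x] using G by (auto simp: field_simps simp flip: power_mult_distrib)
  finally show "(\<lambda>k. of_real (Gamma (\<mu> + real k) / fact k) * x ^ k) sums (of_real (Gamma \<mu>) * (1 - x) powr (- of_real \<mu>))"
    by simp
  have "(\<lambda>n. ((-\<mu>) gchoose n) * (- norm x) ^ n) sums (1 + (- norm x)) powr (-\<mu>)"
    using assms by (intro gen_binomial_real) auto
  hence "summable (\<lambda>n. Gamma \<mu> * (((-\<mu>) gchoose n) * (- norm x) ^ n))"
    by (intro summable_mult) (auto simp: sums_iff)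
  also have "(\<lambda>n. Gamma \<mu> * (((-\<mu>) gchoose n) * (- norm x) ^ n)) = (\<lambda>k. Gamma (\<mu> + real k) / fact k * norm x ^ k)"
    unfolding gc power_minus[of "norm x"] using G by (auto simp: field_simps simp flip: power_mult_distrib)
  finally show "summable (\<lambda>k. Gamma (\<mu> + real k) / fact k * norm x ^ k)" .
qed

lemma norm_exp_minus_mult_real: "norm (exp (- (q * of_real r))) = exp (- (Re q * r))" for q :: complex
  by simp

lemma integrable_half_line_continuous_bound:
  fixes f :: "real \<Rightarrow> 'a::euclidean_space"
  assumes "continuous_on {0<..} f" "integrable half_line g" "\<And>x. x > 0 \<Longrightarrow> norm (f x) \<le> g x"
  shows "integrable half_line f"
  using assms by (intro measurable_bounded_by_integrable_imp_lebesgue_integrable[OF _ assms(2)]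
     continuous_imp_measurable_on_sets_lebesgue) auto

lemma gaussian_moment_complex_integrable:
  fixes q :: complex
  assumes "Re q > 0" "\<mu> > 0"
  shows "integrable half_line (\<lambda>x. of_real (x powr (2 * \<mu> - 1)) * exp (- (q * of_real (x\<^sup>2))))"
  by (rule integrable_half_line_continuous_bound[OF _ gaussian_moment_real(1)[OF assms]])
     (auto intro!: continuous_intros simp: norm_mult)

text \<open>The exponential is expanded around a real parameter \<open>q0\<close> so large that
  \<open>cmod (q - q0) < q0\<close>, and integrated term by term.\<close>

lemma gaussian_moment_complex:
  fixes q :: complex
  assumes "Re q > 0" "\<mu> > 0"
  shows "integral\<^sup>L half_line (\<lambda>x. of_real (x powr (2 * \<mu> - 1)) * exp (- (q * of_real (x\<^sup>2)))) =
     of_real (Gamma \<mu> / 2) * q powr (- of_real \<mu>)"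
proof -
  \<comment> \<open>|q0 - q|^2 = q0^2 - 2 q0 Re q + |q|^2 is below q0^2 as soon as 2 q0 Re q exceeds
    |q|^2; this choice makes it 2 |q|^2.\<close>
  define q0 where "q0 = (norm q)\<^sup>2 / Re q"
  have nq: "norm q > 0" using assms by auto
  have q0: "q0 > 0" using assms nq by (simp add: q0_def)
  have "(norm (of_real q0 - q))\<^sup>2 = q0\<^sup>2 - 2 * q0 * Re q + (norm q)\<^sup>2"
    unfolding cmod_power2 by (simp add: power2_eq_square algebra_simps)
  also have "\<dots> = q0\<^sup>2 - (norm q)\<^sup>2" using assms by (simp add: q0_def field_simps)
  also have "\<dots> < q0\<^sup>2" using nq by simp
  finally have d: "norm (of_real q0 - q) < q0" using q0 by (simp add: power_less_imp_less_base)
  define x where "x = (of_real q0 - q) / of_real q0"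
  have x: "norm x < 1" using d q0 by (simp add: x_def norm_divide)
  define F where "F = (\<lambda>k t. of_real (t powr (2 * (\<mu> + real k) - 1) * exp (- (q0 * t\<^sup>2))) * ((of_real q0 - q)^k / fact k))"
  have Fint: "integrable half_line (F k)" for k
    unfolding F_def using gaussian_moment_real(1)[OF q0, of "\<mu> + real k"] assms
    by (intro integrable_mult_left integrable_of_real) auto
  have Fval: "integral\<^sup>L half_line (F k) = of_real (q0 powr (-\<mu>) / 2) * (of_real (Gamma (\<mu> + real k) / fact k) * x ^ k)" for k
  proof -
    have "integral\<^sup>L half_line (F k) = of_real (Gamma (\<mu> + real k) / 2 * q0 powr (- (\<mu> + real k))) * ((of_real q0 - q)^k / fact k)"
    proof -
      have "\<mu> + real k > 0" using assms by simp
      from gaussian_moment_real(2)[OF q0 this] show ?thesis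
        unfolding F_def integral_mult_left_zero integral_complex_of_real by (rule arg_cong)
    qed
    also have "q0 powr (- (\<mu> + real k)) = q0 powr (-\<mu>) * inverse (q0 ^ k)"
      using q0 by (simp add: powr_diff powr_realpow field_simps)
    finally show ?thesis by (simp add: x_def power_divide field_simps)
  qed
  have Fnorm: "norm (F k t) = (t powr (2 * (\<mu> + real k) - 1) * exp (- (q0 * t\<^sup>2))) * (norm (of_real q0 - q)^k / fact k)" for k t
    unfolding F_def by (simp add: norm_mult norm_divide norm_power)
  have Fnormval: "(LINT t|half_line. norm (F k t)) = (q0 powr (-\<mu>) / 2) * (Gamma (\<mu> + real k) / fact k * norm x ^ k)" for k
  proof -
    have "(LINT t|half_line. norm (F k t)) = (Gamma (\<mu> + real k) / 2 * q0 powr (- (\<mu> + real k))) * (norm (of_real q0 - q)^k / fact k)"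
    proof -
      have "\<mu> + real k > 0" using assms by simp
      from gaussian_moment_real(2)[OF q0 this] show ?thesis
        unfolding Fnorm integral_mult_left_zero by (rule arg_cong)
    qed
    also have "q0 powr (- (\<mu> + real k)) = q0 powr (-\<mu>) * inverse (q0 ^ k)"
      using q0 by (simp add: powr_diff powr_realpow field_simps)
    finally show ?thesis using q0 by (simp add: x_def norm_divide power_divide field_simps)
  qed
  have Feq: "F k t = of_real (t powr (2*\<mu>-1) * exp (- (q0 * t\<^sup>2))) * (((of_real q0 - q) * of_real (t\<^sup>2))^k /\<^sub>R fact k)"
    if "t > 0" for k t
  proof -
    have "t powr (2 * (\<mu> + real k) - 1) = t powr (2*\<mu>-1) * t powr real (2 * k)"
      unfolding powr_add[symmetric] by (rule arg_cong[where f="\<lambda>e. t powr e"]) simp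
    also have "t powr real (2 * k) = (t\<^sup>2)^k"
      unfolding powr_realpow[OF that] by (simp only: power_mult)
    finally show ?thesis by (simp add: F_def power_mult_distrib scaleR_conv_of_real divide_inverse mult_ac)
  qed
  have Fsums: "(\<lambda>k. F k t) sums (of_real (t powr (2 * \<mu> - 1)) * exp (- (q * of_real (t\<^sup>2))))" if "t > 0" for t
  proof -
    have "(\<lambda>k. of_real (t powr (2*\<mu>-1) * exp (- (q0 * t\<^sup>2))) * (((of_real q0 - q) * of_real (t\<^sup>2))^k /\<^sub>R fact k)) sums
       (of_real (t powr (2*\<mu>-1) * exp (- (q0 * t\<^sup>2))) * exp ((of_real q0 - q) * of_real (t\<^sup>2)))"
      by (intro sums_mult exp_converges)
    moreover have "of_real (t powr (2*\<mu>-1) * exp (- (q0 * t\<^sup>2))) * exp ((of_real q0 - q) * of_real (t\<^sup>2)) =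
      of_real (t powr (2 * \<mu> - 1)) * exp (- (q * of_real (t\<^sup>2)))"
      by (simp add: exp_of_real[symmetric] mult.assoc mult_exp_exp algebra_simps)
    ultimately show ?thesis unfolding Feq[OF that] by (simp only:)
  qed
  have Fsummable: "summable (\<lambda>k. norm (F k t))" if "t > 0" for t
  proof -
    show ?thesis
      unfolding Feq[OF that] by (subst norm_mult) (rule summable_mult[OF summable_norm_exp])
  qed
  have S: "(\<lambda>k. integral\<^sup>L half_line (F k)) sums (LINT t|half_line. (\<Sum>k. F k t))"
  proof (rule sums_integral[OF Fint])
    show "summable (\<lambda>k. LINT t|half_line. norm (F k t))"
      unfolding Fnormval by (rule summable_mult, rule Gamma_pochhammer_sums(2)[OF assms(2) x])
  qed (auto simp: Fsummable intro!: AE_I2)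
  have "(LINT t|half_line. (\<Sum>k. F k t)) = integral\<^sup>L half_line (\<lambda>x. of_real (x powr (2 * \<mu> - 1)) * exp (- (q * of_real (x\<^sup>2))))"
    by (intro Bochner_Integration.integral_cong) (use Fsums in \<open>auto simp: sums_iff\<close>)
  moreover have "(\<lambda>k. integral\<^sup>L half_line (F k)) sums (of_real (q0 powr (-\<mu>) / 2) * (of_real (Gamma \<mu>) * (1 - x) powr (- of_real \<mu>)))"
    unfolding Fval by (rule sums_mult, rule Gamma_pochhammer_sums(1)[OF assms(2) x])
  ultimately have "integral\<^sup>L half_line (\<lambda>x. of_real (x powr (2 * \<mu> - 1)) * exp (- (q * of_real (x\<^sup>2)))) =
     of_real (q0 powr (-\<mu>) / 2) * (of_real (Gamma \<mu>) * (1 - x) powr (- of_real \<mu>))"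
    using sums_unique2[OF S] by simp
  also have "\<dots> = of_real (Gamma \<mu> / 2) * (of_real q0 powr (- of_real \<mu>) * (1 - x) powr (- of_real \<mu>))"
    using q0 powr_of_real[of q0 "-\<mu>"] by simp
  \<comment> \<open>The principal power is multiplicative here because one of the two factors is a
    positive real.\<close>
  also have "of_real q0 powr (- of_real \<mu>) * (1 - x) powr (- of_real \<mu>) = (of_real q0 * (1 - x)) powr (- complex_of_real \<mu>)"
    using q0 powr_times_real_left[of "of_real q0" "1 - x" "- complex_of_real \<mu>"] by auto
  also have "of_real q0 * (1 - x) = q" using q0 by (simp add: x_def field_simps)
  finally show ?thesis .
qed

subsection \<open>The modified Bessel function\<close>

text \<open>The entire factor of the Bessel function, 0F1(; \<nu> + 1; s) / Gamma(\<nu> + 1).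
  Splitting it off confines the branch to (z / 2)^\<nu> and makes differentiation a shift of the
  order.\<close>

definition bessel_e :: "real \<Rightarrow> complex \<Rightarrow> complex" where
  "bessel_e \<nu> s = (\<Sum>k. of_real (rGamma (\<nu> + real k + 1) / fact k) * s ^ k)"

lemma bessel_I_eq: "bessel_I \<nu> z = (z / 2) powr of_real \<nu> * bessel_e \<nu> ((z / 2)\<^sup>2)"
proof -
  have "rGamma (of_real \<nu> + of_nat k + 1) = (of_real (rGamma (\<nu> + real k + 1)) :: complex)" for k
    unfolding rGamma_complex_of_real[symmetric] by simp
  thus ?thesis unfolding bessel_I_def bessel_e_def power_mult by (simp add: mult_ac)
qed

lemma rGamma_pos: "x > 0 \<Longrightarrow> rGamma (x::real) > 0"
  using Gamma_real_pos[of x] by (simp add: rGamma_inverse_Gamma)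

text \<open>Passing from k to k + 1 divides by \<nu> + k + 1 \<ge> 1. Hence the exponential series
  dominates the Bessel series.\<close>

lemma rGamma_add_nat_le:
  assumes "\<nu> \<ge> (0::real)"
  shows "rGamma (\<nu> + real k + 1) \<le> rGamma (\<nu> + 1)"
proof (induction k)
  case (Suc k)
  have "rGamma (\<nu> + real (Suc k) + 1) \<le> (\<nu> + real k + 1) * rGamma (\<nu> + real k + 1 + 1)"
    using assms rGamma_pos[of "\<nu> + real k + 1 + 1"] by (auto simp: algebra_simps)
  also have "\<dots> = rGamma (\<nu> + real k + 1)" by (rule rGamma_plus1)
  finally show ?case using Suc by simp
qed simp

lemma bessel_e_summable_norm:
  assumes "\<nu> \<ge> 0"
  shows "summable (\<lambda>k. rGamma (\<nu> + real k + 1) / fact k * norm (s::complex) ^ k)"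
proof (rule summable_comparison_test')
  show "summable (\<lambda>k. rGamma (\<nu> + 1) * (norm s ^ k /\<^sub>R fact k))"
    by (intro summable_mult summable_exp_generic)
  show "norm (rGamma (\<nu> + real k + 1) / fact k * norm s ^ k) \<le> rGamma (\<nu> + 1) * (norm s ^ k /\<^sub>R fact k)" for k
    using mult_right_mono[OF rGamma_add_nat_le[OF assms, of k], of "norm s ^ k / fact k"]
      rGamma_pos[of "\<nu> + real k + 1"] assms
    by (simp add: abs_mult divide_inverse mult_ac)
qed

lemma bessel_e_summable:
  assumes "\<nu> \<ge> 0"
  shows "summable (\<lambda>k. of_real (rGamma (\<nu> + real k + 1) / fact k) * (s::complex) ^ k)"
proof (rule summable_norm_cancel)
  have "rGamma (\<nu> + real k + 1) \<ge> 0" for k using assms by (intro less_imp_le rGamma_pos) auto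
  thus "summable (\<lambda>k. norm (of_real (rGamma (\<nu> + real k + 1) / fact k) * (s::complex) ^ k))"
    using bessel_e_summable_norm[OF assms, of s] by (simp add: norm_mult norm_divide norm_power)
qed

lemma bessel_e_sums:
  assumes "\<nu> \<ge> 0"
  shows "(\<lambda>k. of_real (rGamma (\<nu> + real k + 1) / fact k) * s ^ k) sums bessel_e \<nu> s"
  unfolding bessel_e_def by (rule summable_sums[OF bessel_e_summable[OF assms]])

text \<open>The factor k + 1 from differentiating s^{k+1} cancels in the factorial, and the shifted
  index turns \<nu> + (k + 1) + 1 into (\<nu> + 1) + k + 1.\<close>

lemma bessel_e_deriv:
  assumes "\<nu> \<ge> 0"
  shows "(bessel_e \<nu> has_field_derivative bessel_e (\<nu> + 1) s) (at s)"
proof -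
  have d: "diffs (\<lambda>k. of_real (rGamma (\<nu> + real k + 1) / fact k) :: complex) = (\<lambda>k. of_real (rGamma (\<nu> + 1 + real k + 1) / fact k))"
  proof
    fix k
    have "\<nu> + real (Suc k) + 1 = \<nu> + 1 + real k + 1" by simp
    thus "diffs (\<lambda>k. of_real (rGamma (\<nu> + real k + 1) / fact k) :: complex) k = of_real (rGamma (\<nu> + 1 + real k + 1) / fact k)"
      unfolding diffs_def by (simp only: fact_Suc of_real_divide of_real_mult of_real_of_nat_eq of_real_fact)
        (simp del: of_nat_Suc)
  qed
  show ?thesis
    unfolding bessel_e_def[abs_def] fun_cong[OF d, symmetric]
    by (rule termdiffs_strong'[of "norm s + 1"]) (use assms bessel_e_summable in auto)
qed

section \<open>Poisson's integral for the Bessel function\<close>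

lemma cosh_sums_even: "(\<lambda>k. z ^ (2 * k) / fact (2 * k)) sums cosh (z::complex)"
proof -
  have "(\<lambda>n. if even n then z ^ n /\<^sub>R fact n else 0) sums cosh z"
    by (rule cosh_converges)
  hence "(\<lambda>k. if even (2*k) then z ^ (2*k) /\<^sub>R fact (2*k) else 0) sums cosh z"
    by (subst sums_mono_reindex[of "\<lambda>k. 2 * k" "\<lambda>n. if even n then z ^ n /\<^sub>R fact n else 0"])
       (auto simp: strict_mono_def elim!: evenE)
  thus ?thesis by (simp add: scaleR_conv_of_real field_simps)
qed

lemma sinh_sums_odd: "(\<lambda>k. z ^ (2 * k + 1) / fact (2 * k + 1)) sums sinh (z::complex)"
proof -
  have "(\<lambda>n. if even n then 0 else z ^ n /\<^sub>R fact n) sums sinh z"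
    by (rule sinh_converges)
  hence "(\<lambda>k. if even (2*k+1) then 0 else z ^ (2*k+1) /\<^sub>R fact (2*k+1)) sums sinh z"
    by (subst sums_mono_reindex[of "\<lambda>k. 2 * k + 1" "\<lambda>n. if even n then 0 else z ^ n /\<^sub>R fact n"])
       (auto simp: strict_mono_def elim!: oddE)
  thus ?thesis by (simp add: scaleR_conv_of_real field_simps)
qed

text \<open>These values link the moments of the Beta density to the Bessel series: the (2k)!
  cancels the one in the series of cosh, and 4^k k! supplies the rest of the coefficient.\<close>

lemma Gamma_nat_half: "Gamma (real k + 1/2) = fact (2 * k) / (4 ^ k * fact k) * sqrt pi"
proof (induction k)
  case (Suc k)
  have "real k + 1/2 > 0" by simp
  hence "Gamma (real k + 1/2 + 1) = (real k + 1/2) * Gamma (real k + 1/2)"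
    by (intro Gamma_plus1) (auto elim!: nonpos_Ints_cases)
  hence "Gamma (real (Suc k) + 1/2) = (real k + 1/2) * (fact (2 * k) / (4 ^ k * fact k) * sqrt pi)"
    using Suc by (simp add: add_ac)
  also have "\<dots> = (2 * real k + 2) * (2 * real k + 1) * fact (2 * k) / (4 ^ Suc k * ((real k + 1) * fact k)) * sqrt pi"
    by (simp add: divide_simps) (simp add: algebra_simps)
  also have "(2 * real k + 2) * (2 * real k + 1) * fact (2 * k) = fact (2 * Suc k)"
    by (simp add: algebra_simps)
  also have "(real k + 1) * fact k = fact (Suc k)"
    by (simp add: algebra_simps)
  finally show ?case .
qed (simp add: Gamma_one_half_real)

text \<open>The image of Poisson's density (1 - t^2)^{\<alpha>-1} on [-1, 1] under x = t^2.\<close>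

abbreviation beta_weight :: "real \<Rightarrow> real \<Rightarrow> real" where
  "beta_weight \<alpha> x \<equiv> x powr (-1/2) * (1 - x) powr (\<alpha> - 1)"

lemma beta_moment:
  assumes "\<alpha> > 0"
  shows "integrable (lebesgue_on {0..1}) (\<lambda>x. beta_weight \<alpha> x * x ^ k)"
    and "integral\<^sup>L (lebesgue_on {0..1}) (\<lambda>x. beta_weight \<alpha> x * x ^ k) =
      Gamma (real k + 1/2) * Gamma \<alpha> * rGamma (real k + 1/2 + \<alpha>)"
proof -
  have "((\<lambda>t. t powr (real k + 1/2 - 1) * (1 - t) powr (\<alpha> - 1)) has_integral Beta (real k + 1/2) \<alpha>) {0..1}"
    using assms by (intro has_integral_Beta_real) auto
  moreover have "t powr (real k + 1/2 - 1) * (1 - t) powr (\<alpha> - 1) = beta_weight \<alpha> t * t ^ k" if "t \<in> {0..1}" for t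
  \<comment> \<open>At t = 0 both sides vanish, even for k = 0, because \<open>0 powr r = 0\<close>;
    elsewhere the power may be split.\<close>
  proof (cases "t = 0")
    case False
    hence "t powr (real k + (- 1/2)) = t powr real k * t powr (- 1/2)" by (intro powr_add)
    with False that show ?thesis by (simp add: powr_realpow mult_ac)
  qed auto
  ultimately have "((\<lambda>t. beta_weight \<alpha> t * t ^ k) has_integral Beta (real k + 1/2) \<alpha>) {0..1}"
    using has_integral_cong by (metis (no_types, lifting))
  from has_integral_nonneg_lebesgue_on[OF this]
  show "integrable (lebesgue_on {0..1}) (\<lambda>x. beta_weight \<alpha> x * x ^ k)"
    "integral\<^sup>L (lebesgue_on {0..1}) (\<lambda>x. beta_weight \<alpha> x * x ^ k) =
      Gamma (real k + 1/2) * Gamma \<alpha> * rGamma (real k + 1/2 + \<alpha>)"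
    by (auto simp: Beta_altdef)
qed

text \<open>Poisson's integral for \<open>I\<^sub>\<nu>\<close> in the variable \<open>x = t\<^sup>2\<close>.\<close>

lemma bessel_e_poisson_cosh:
  assumes "\<nu> \<ge> 0"
  shows "bessel_e \<nu> ((w / 2)\<^sup>2) * of_real (sqrt pi * Gamma (\<nu> + 1/2)) =
    integral\<^sup>L (lebesgue_on {0..1}) (\<lambda>x. of_real (beta_weight (\<nu> + 1/2) x) * cosh (w * of_real (sqrt x)))"
proof -
  let ?M = "lebesgue_on {0..1::real}"
  have \<alpha>: "\<nu> + 1/2 > 0" using assms by simp
  define F where "F = (\<lambda>k x. of_real (beta_weight (\<nu> + 1/2) x * x ^ k) * (w ^ (2 * k) / fact (2 * k)))"
  have Fint: "integrable ?M (F k)" for k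
    unfolding F_def using beta_moment(1)[OF \<alpha>, of k]
    by (intro integrable_mult_left integrable_of_real)
  \<comment> \<open>Divided by (2k)!, the k-th moment is the k-th Bessel coefficient over 4^k, up to
    a constant independent of k. The 4^k produces the argument (w / 2)^2.\<close>
  have mom: "integral\<^sup>L ?M (\<lambda>x. beta_weight (\<nu> + 1/2) x * x ^ k) / fact (2 * k) =
      (sqrt pi * Gamma (\<nu> + 1/2)) * (rGamma (\<nu> + real k + 1) / fact k / 4 ^ k)" for k
  proof -
    have "real k + 1/2 + (\<nu> + 1/2) = \<nu> + real k + 1" by simp
    hence e: "rGamma (real k + 1/2 + (\<nu> + 1/2)) = rGamma (\<nu> + real k + 1)" by (rule arg_cong)
    show ?thesis unfolding beta_moment(2)[OF \<alpha>] Gamma_nat_half e by (simp add: divide_simps)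
  qed
  have Fval: "integral\<^sup>L ?M (F k) = of_real (sqrt pi * Gamma (\<nu> + 1/2)) * (of_real (rGamma (\<nu> + real k + 1) / fact k) * ((w / 2)\<^sup>2) ^ k)" for k
  proof -
    have "integral\<^sup>L ?M (F k) = of_real (integral\<^sup>L ?M (\<lambda>x. beta_weight (\<nu> + 1/2) x * x ^ k)) * (w ^ (2 * k) / fact (2 * k))"
      unfolding F_def integral_mult_left_zero integral_complex_of_real ..
    also have "\<dots> = of_real (integral\<^sup>L ?M (\<lambda>x. beta_weight (\<nu> + 1/2) x * x ^ k) / fact (2 * k)) * w ^ (2 * k)"
      by simp
    finally show ?thesis unfolding mom by (simp add: power_divide power_mult)
  qed
  have wt: "beta_weight (\<nu> + 1/2) x \<ge> 0" for x by simp
  have Fnorm: "norm (F k x) = (beta_weight (\<nu> + 1/2) x * x ^ k) * (norm w ^ (2 * k) / fact (2 * k))" if "x \<in> {0..1}" for k x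
    using that unfolding F_def norm_mult norm_of_real norm_divide norm_power norm_fact by (simp add: abs_mult)
  have Fnormval: "(LINT x|?M. norm (F k x)) = (sqrt pi * Gamma (\<nu> + 1/2)) * (rGamma (\<nu> + real k + 1) / fact k * norm ((w / 2)\<^sup>2) ^ k)" for k
  proof -
    have "(LINT x|?M. norm (F k x)) = (LINT x|?M. (beta_weight (\<nu> + 1/2) x * x ^ k) * (norm w ^ (2 * k) / fact (2 * k)))"
      by (rule Bochner_Integration.integral_cong) (auto simp only: Fnorm space_restrict_space)
    also have "\<dots> = integral\<^sup>L ?M (\<lambda>x. beta_weight (\<nu> + 1/2) x * x ^ k) / fact (2 * k) * norm w ^ (2 * k)"
      unfolding integral_mult_left_zero by simp
    finally show ?thesis unfolding mom by (simp add: power_divide power_mult norm_power norm_divide)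
  qed
  have FS: "(\<lambda>k. F k x) sums (of_real (beta_weight (\<nu> + 1/2) x) * cosh (w * of_real (sqrt x)))"
     "summable (\<lambda>k. norm (F k x))" if "x \<in> {0..1}" for x
  proof -
    have eq: "F k x = of_real (beta_weight (\<nu> + 1/2) x) * ((w * of_real (sqrt x)) ^ (2 * k) / fact (2 * k))" for k
    proof -
      have "(complex_of_real (sqrt x)) ^ (2 * k) = of_real (x ^ k)"
        using that unfolding of_real_power[symmetric] power_mult by simp
      thus ?thesis by (simp add: F_def power_mult_distrib)
    qed
    show "(\<lambda>k. F k x) sums (of_real (beta_weight (\<nu> + 1/2) x) * cosh (w * of_real (sqrt x)))"
      unfolding eq by (intro sums_mult cosh_sums_even)
    \<comment> \<open>The series of the norms is again a cosh series, at the real point |w sqrt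
      x|.\<close>
    have "(\<lambda>k. (of_real (norm (w * of_real (sqrt x))) ^ (2 * k) / fact (2 * k))) sums cosh (complex_of_real (norm (w * of_real (sqrt x))))"
      by (rule cosh_sums_even)
    hence "summable (\<lambda>k. complex_of_real (norm (w * of_real (sqrt x)) ^ (2 * k) / fact (2 * k)))"
      by (auto simp: sums_iff)
    hence "summable (\<lambda>k. norm (w * of_real (sqrt x)) ^ (2 * k) / fact (2 * k))"
      by (subst (asm) summable_complex_of_real)
    thus "summable (\<lambda>k. norm (F k x))"
      unfolding eq norm_mult norm_divide norm_power norm_fact by (rule summable_mult)
  qed
  have "(\<lambda>k. integral\<^sup>L ?M (F k)) sums (LINT x|?M. (\<Sum>k. F k x))"
  proof (rule sums_integral[OF Fint])
    show "summable (\<lambda>k. LINT x|?M. norm (F k x))"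
      unfolding Fnormval by (rule summable_mult, rule bessel_e_summable_norm[OF assms])
  qed (use FS in \<open>auto intro!: AE_I2\<close>)
  moreover have "(\<lambda>k. integral\<^sup>L ?M (F k)) sums (of_real (sqrt pi * Gamma (\<nu> + 1/2)) * bessel_e \<nu> ((w/2)\<^sup>2))"
    unfolding Fval by (rule sums_mult, rule bessel_e_sums[OF assms])
  ultimately have "(LINT x|?M. (\<Sum>k. F k x)) = of_real (sqrt pi * Gamma (\<nu> + 1/2)) * bessel_e \<nu> ((w/2)\<^sup>2)"
    by (rule sums_unique2)
  moreover have "(LINT x|?M. (\<Sum>k. F k x)) = (LINT x|?M. of_real (beta_weight (\<nu> + 1/2) x) * cosh (w * of_real (sqrt x)))"
    by (intro Bochner_Integration.integral_cong) (use FS(1) in \<open>auto simp: sums_iff\<close>)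
  ultimately show ?thesis by (simp add: mult.commute)
qed

text \<open>This is the w-derivative of the cosh formula, obtained from the series instead of by
  differentiating under the integral. Poisson's integral for the order \<nu> + 1 itself would carry
  the weight with \<nu> + 3/2; here both orders have the same weight, so that they can be subtracted
  under the integral.\<close>

lemma bessel_e_poisson_sinh:
  assumes "\<nu> \<ge> 0"
  shows "w / 2 * bessel_e (\<nu> + 1) ((w / 2)\<^sup>2) * of_real (sqrt pi * Gamma (\<nu> + 1/2)) =
    integral\<^sup>L (lebesgue_on {0..1}) (\<lambda>x. of_real (beta_weight (\<nu> + 1/2) x) * (of_real (sqrt x) * sinh (w * of_real (sqrt x))))"
proof -
  let ?M = "lebesgue_on {0..1::real}"
  have \<alpha>: "\<nu> + 1/2 > 0" and \<nu>1: "\<nu> + 1 \<ge> 0" using assms by simp_all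
  \<comment> \<open>The moment is \<open>Suc k\<close> because sqrt x from the integrand times (sqrt
    x)^{2k+1} from sinh is x^{k+1}.\<close>
  define F where "F = (\<lambda>k x. of_real (beta_weight (\<nu> + 1/2) x * x ^ (Suc k)) * (w ^ (2 * k + 1) / fact (2 * k + 1)))"
  have Fint: "integrable ?M (F k)" for k
    unfolding F_def using beta_moment(1)[OF \<alpha>, of "Suc k"]
    by (intro integrable_mult_left integrable_of_real)
  have mom: "integral\<^sup>L ?M (\<lambda>x. beta_weight (\<nu> + 1/2) x * x ^ Suc k) / fact (2 * k + 1) =
      (sqrt pi * Gamma (\<nu> + 1/2)) * (rGamma (\<nu> + 1 + real k + 1) / fact k / (2 * 4 ^ k))" for k
  proof -
    have e: "real (Suc k) + 1/2 + (\<nu> + 1/2) = \<nu> + 1 + real k + 1" by simp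
    have f: "fact (2 * Suc k) = 2 * (real k + 1) * fact (2 * k + 1)" "fact (Suc k) = (real k + 1) * fact k"
      by (simp_all add: algebra_simps)
    show ?thesis unfolding beta_moment(2)[OF \<alpha>] Gamma_nat_half e f
      using fact_nonzero[of "2 * k + 1", where 'a=real] by (simp add: divide_simps del: fact_Suc)
  qed
  have Fval: "integral\<^sup>L ?M (F k) = of_real (sqrt pi * Gamma (\<nu> + 1/2)) * (w / 2 * (of_real (rGamma (\<nu> + 1 + real k + 1) / fact k) * ((w / 2)\<^sup>2) ^ k))" for k
  proof -
    have "integral\<^sup>L ?M (F k) = of_real (integral\<^sup>L ?M (\<lambda>x. beta_weight (\<nu> + 1/2) x * x ^ Suc k)) * (w ^ (2 * k + 1) / fact (2 * k + 1))"
      unfolding F_def integral_mult_left_zero integral_complex_of_real ..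
    also have "\<dots> = of_real (integral\<^sup>L ?M (\<lambda>x. beta_weight (\<nu> + 1/2) x * x ^ Suc k) / fact (2 * k + 1)) * w ^ (2 * k + 1)"
      by simp
    finally show ?thesis unfolding mom by (simp add: power_divide power_mult) (simp only: mult_ac)
  qed
  have Fnorm: "norm (F k x) = (beta_weight (\<nu> + 1/2) x * x ^ Suc k) * (norm w ^ (2 * k + 1) / fact (2 * k + 1))" if "x \<in> {0..1}" for k x
    using that unfolding F_def norm_mult norm_of_real norm_divide norm_power norm_fact by (simp add: abs_mult)
  have Fnormval: "(LINT x|?M. norm (F k x)) = (sqrt pi * Gamma (\<nu> + 1/2) * (norm w / 2)) * (rGamma (\<nu> + 1 + real k + 1) / fact k * norm ((w / 2)\<^sup>2) ^ k)" for k
  proof -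
    have "(LINT x|?M. norm (F k x)) = (LINT x|?M. (beta_weight (\<nu> + 1/2) x * x ^ Suc k) * (norm w ^ (2 * k + 1) / fact (2 * k + 1)))"
      by (rule Bochner_Integration.integral_cong) (auto simp only: Fnorm space_restrict_space)
    also have "\<dots> = integral\<^sup>L ?M (\<lambda>x. beta_weight (\<nu> + 1/2) x * x ^ Suc k) / fact (2 * k + 1) * norm w ^ (2 * k + 1)"
      unfolding integral_mult_left_zero by simp
    finally show ?thesis unfolding mom
      by (simp add: power_divide power_mult norm_power norm_divide) (simp only: mult_ac)
  qed
  have FS: "(\<lambda>k. F k x) sums (of_real (beta_weight (\<nu> + 1/2) x) * (of_real (sqrt x) * sinh (w * of_real (sqrt x))))"
     "summable (\<lambda>k. norm (F k x))" if "x \<in> {0..1}" for x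
  proof -
    have eq: "F k x = of_real (beta_weight (\<nu> + 1/2) x) * (of_real (sqrt x) * ((w * of_real (sqrt x)) ^ (2 * k + 1) / fact (2 * k + 1)))" for k
    proof -
      have "sqrt x * (sqrt x) ^ (2 * k + 1) = x ^ Suc k"
        using that by (simp add: power_mult)
      hence "complex_of_real (sqrt x) * (complex_of_real (sqrt x)) ^ (2 * k + 1) = of_real (x ^ Suc k)"
        by (metis of_real_mult of_real_power)
      thus ?thesis by (simp only: F_def power_mult_distrib of_real_mult) (simp add: mult_ac)
    qed
    show "(\<lambda>k. F k x) sums (of_real (beta_weight (\<nu> + 1/2) x) * (of_real (sqrt x) * sinh (w * of_real (sqrt x))))"
      unfolding eq by (intro sums_mult sinh_sums_odd)
    have "(\<lambda>k. (of_real (norm (w * of_real (sqrt x))) ^ (2 * k + 1) / fact (2 * k + 1))) sums sinh (complex_of_real (norm (w * of_real (sqrt x))))"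
      by (rule sinh_sums_odd)
    hence "summable (\<lambda>k. complex_of_real (norm (w * of_real (sqrt x)) ^ (2 * k + 1) / fact (2 * k + 1)))"
      by (auto simp: sums_iff)
    hence "summable (\<lambda>k. norm (w * of_real (sqrt x)) ^ (2 * k + 1) / fact (2 * k + 1))"
      by (subst (asm) summable_complex_of_real)
    thus "summable (\<lambda>k. norm (F k x))"
      unfolding eq norm_mult norm_divide norm_power norm_fact by (intro summable_mult)
  qed
  have "(\<lambda>k. integral\<^sup>L ?M (F k)) sums (LINT x|?M. (\<Sum>k. F k x))"
  proof (rule sums_integral[OF Fint])
    show "summable (\<lambda>k. LINT x|?M. norm (F k x))"
      unfolding Fnormval by (rule summable_mult, rule bessel_e_summable_norm[OF \<nu>1])
  qed (use FS in \<open>auto intro!: AE_I2\<close>)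
  moreover have "(\<lambda>k. integral\<^sup>L ?M (F k)) sums (of_real (sqrt pi * Gamma (\<nu> + 1/2)) * (w / 2 * bessel_e (\<nu> + 1) ((w/2)\<^sup>2)))"
    unfolding Fval by (rule sums_mult, rule sums_mult, rule bessel_e_sums[OF \<nu>1])
  ultimately have "(LINT x|?M. (\<Sum>k. F k x)) = of_real (sqrt pi * Gamma (\<nu> + 1/2)) * (w / 2 * bessel_e (\<nu> + 1) ((w/2)\<^sup>2))"
    by (rule sums_unique2)
  moreover have "(LINT x|?M. (\<Sum>k. F k x)) = (LINT x|?M. of_real (beta_weight (\<nu> + 1/2) x) * (of_real (sqrt x) * sinh (w * of_real (sqrt x))))"
    by (intro Bochner_Integration.integral_cong) (use FS(1) in \<open>auto simp: sums_iff\<close>)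
  ultimately show ?thesis by (simp add: mult_ac)
qed

section \<open>Laplace's method at the end point x = 1 and the size of the Bessel function for Re w
  \<ge> 0\<close>

lemma reflected_gamma_integral:
  fixes \<alpha> \<eta> :: real
  assumes "\<alpha> > 0" "\<eta> > 0"
  shows "integrable (lebesgue_on {..<1}) (\<lambda>x. (1 - x) powr (\<alpha> - 1) * exp (- (\<eta> * (1 - x))))"
    and "integral\<^sup>L (lebesgue_on {..<1}) (\<lambda>x. (1 - x) powr (\<alpha> - 1) * exp (- (\<eta> * (1 - x)))) = Gamma \<alpha> * \<eta> powr (- \<alpha>)"
proof -
  define f where "f = (\<lambda>t. t powr (\<alpha> - 1) / exp t)"
  have im: "(\<lambda>x. \<eta> * (1 - x)) ` {..<1} = {0<..}"
  proof safe
    fix t :: real assume "t > 0"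
    thus "t \<in> (\<lambda>x. \<eta> * (1 - x)) ` {..<1}"
      using assms by (intro image_eqI[of _ _ "1 - t / \<eta>"]) auto
  qed (use assms in auto)
  have "(f has_integral Gamma \<alpha>) {0..}"
    unfolding f_def using Gamma_integral_real[OF assms(1)] .
  hence f: "(f has_integral Gamma \<alpha>) {0<..}"
    by (subst has_integral_spike_set_eq[where T="{0..}"]) (auto intro: negligible_subset[of "{0}"])
  hence "f absolutely_integrable_on {0<..}"
    by (intro nonnegative_absolutely_integrable_1) (auto simp: f_def)
  hence F: "f absolutely_integrable_on (\<lambda>x. \<eta> * (1 - x)) ` {..<1} \<and> integral ((\<lambda>x. \<eta> * (1 - x)) ` {..<1}) f = Gamma \<alpha>"
    using f im by (auto simp: integral_unique)
  have inj: "inj_on (\<lambda>x. \<eta> * (1 - x)) {..<1}"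
    using assms by (auto simp: inj_on_def)
  have der: "((\<lambda>x. \<eta> * (1 - x)) has_real_derivative - \<eta>) (at x within {..<1})" for x
    by (auto intro!: derivative_eq_intros)
  have G: "(\<lambda>x. \<bar>- \<eta>\<bar> * f (\<eta> * (1 - x))) absolutely_integrable_on {..<1} \<and>
      integral {..<1} (\<lambda>x. \<bar>- \<eta>\<bar> * f (\<eta> * (1 - x))) = Gamma \<alpha>"
    by (subst has_absolute_integral_change_of_variables_1'[OF _ der inj]) (use F in auto)
  have eq: "\<bar>- \<eta>\<bar> * f (\<eta> * (1 - x)) = \<eta> powr \<alpha> * ((1 - x) powr (\<alpha> - 1) * exp (- (\<eta> * (1 - x))))" if "x < 1" for x
  proof -
    have "\<eta> powr \<alpha> = \<eta> powr 1 * \<eta> powr (\<alpha> - 1)"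
      unfolding powr_add[symmetric] by simp
    thus ?thesis using that assms
      by (simp add: f_def powr_mult exp_minus divide_inverse mult_ac)
  qed
  have "integrable (lebesgue_on {..<1}) (\<lambda>x. \<bar>- \<eta>\<bar> * f (\<eta> * (1 - x)))"
    using G by (subst integrable_lebesgue_on_iff) auto
  moreover have "integral\<^sup>L (lebesgue_on {..<1}) (\<lambda>x. \<bar>- \<eta>\<bar> * f (\<eta> * (1 - x))) = Gamma \<alpha>"
    using lebesgue_integral_eq_integral[OF calculation] G by auto
  moreover have "integrable (lebesgue_on {..<1}) (\<lambda>x. \<bar>- \<eta>\<bar> * f (\<eta> * (1 - x))) \<longleftrightarrow>
     integrable (lebesgue_on {..<1}) (\<lambda>x. \<eta> powr \<alpha> * ((1 - x) powr (\<alpha> - 1) * exp (- (\<eta> * (1 - x)))))"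
    by (rule Bochner_Integration.integrable_cong) (rule refl, rule eq, simp)
  moreover have "integral\<^sup>L (lebesgue_on {..<1}) (\<lambda>x. \<bar>- \<eta>\<bar> * f (\<eta> * (1 - x))) =
     integral\<^sup>L (lebesgue_on {..<1}) (\<lambda>x. \<eta> powr \<alpha> * ((1 - x) powr (\<alpha> - 1) * exp (- (\<eta> * (1 - x)))))"
    by (rule Bochner_Integration.integral_cong) (rule refl, rule eq, simp)
  ultimately have H: "integrable (lebesgue_on {..<1}) (\<lambda>x. \<eta> powr \<alpha> * ((1 - x) powr (\<alpha> - 1) * exp (- (\<eta> * (1 - x)))))"
     "integral\<^sup>L (lebesgue_on {..<1}) (\<lambda>x. \<eta> powr \<alpha> * ((1 - x) powr (\<alpha> - 1) * exp (- (\<eta> * (1 - x))))) = Gamma \<alpha>"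
    by simp_all
  show "integrable (lebesgue_on {..<1}) (\<lambda>x. (1 - x) powr (\<alpha> - 1) * exp (- (\<eta> * (1 - x))))"
    using H(1) assms by simp
  show "integral\<^sup>L (lebesgue_on {..<1}) (\<lambda>x. (1 - x) powr (\<alpha> - 1) * exp (- (\<eta> * (1 - x)))) = Gamma \<alpha> * \<eta> powr (- \<alpha>)"
    using H(2) assms by (simp add: powr_minus field_simps)
qed

lemma one_plus_powr_le_exp:
  fixes \<alpha> \<delta> :: real
  assumes "\<alpha> > 0" "\<delta> > 0"
  obtains C where "C > 0" "\<And>R. R \<ge> 0 \<Longrightarrow> (1 + R) powr \<alpha> \<le> C * exp (\<delta> * R)"
proof
  \<comment> \<open>Makes 1 + R \<le> c (1 + \<delta> R / \<alpha>): c \<ge> 1 covers the constant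
    term and c \<ge> \<alpha> / \<delta> the linear one. Then 1 + x \<le> e^x is raised to the power
    \<alpha>.\<close>
  define c where "c = max 1 (\<alpha> / \<delta>)"
  show "c powr \<alpha> > 0" by (simp add: c_def)
  fix R :: real assume R: "R \<ge> 0"
  have c: "c \<ge> 1" "c \<ge> \<alpha> / \<delta>" by (auto simp: c_def)
  have "R * (\<alpha> / \<delta>) \<le> R * c" using R c by (intro mult_left_mono) auto
  hence "R \<le> c * (\<delta> * R / \<alpha>)" using assms by (simp add: field_simps)
  hence "1 + R \<le> c * (1 + \<delta> * R / \<alpha>)" using c by (simp add: algebra_simps)
  also have "\<dots> \<le> c * exp (\<delta> * R / \<alpha>)" using c by (intro mult_left_mono) auto
  finally have "(1 + R) powr \<alpha> \<le> (c * exp (\<delta> * R / \<alpha>)) powr \<alpha>"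
    using R assms by (intro powr_mono2) auto
  also have "\<dots> = c powr \<alpha> * exp (\<delta> * R)"
    using c assms by (simp add: powr_mult exp_powr_real)
  finally show "(1 + R) powr \<alpha> \<le> c powr \<alpha> * exp (\<delta> * R)" .
qed

lemma exp_le_one_plus_powr:
  fixes \<alpha> \<delta> :: real
  assumes "\<alpha> > 0" "\<delta> > 0"
  obtains C where "C > 0" "\<And>R. R \<ge> 0 \<Longrightarrow> exp (- (\<delta> * R)) \<le> C * (1 + R) powr (- \<alpha>)"
proof -
  obtain C where C: "C > 0" "\<And>R. R \<ge> 0 \<Longrightarrow> (1 + R) powr \<alpha> \<le> C * exp (\<delta> * R)"
    using one_plus_powr_le_exp[OF assms] by blast
  show ?thesis
  proof
    fix R :: real assume "R \<ge> 0"
    thus "exp (- (\<delta> * R)) \<le> C * (1 + R) powr (- \<alpha>)"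
      using C(2)[of R] by (simp add: exp_minus powr_minus field_simps)
  qed (fact C(1))
qed

lemma sqrt_le_half: "0 \<le> x \<Longrightarrow> sqrt x \<le> 1 - (1 - x) / 2"
  using arith_geo_mean_sqrt[of 1 x] by (simp add: field_simps)

text \<open>Laplace's method: by \<open>sqrt x \<le> 1 - (1 - x) / 2\<close> the mass sits at \<open>x = 1\<close>.\<close>

lemma beta_weight_exp_bound:
  fixes \<alpha> :: real
  assumes "\<alpha> > 0"
  obtains C where "C > 0"
    "\<And>R. R \<ge> 0 \<Longrightarrow> integrable (lebesgue_on {0..1}) (\<lambda>x. beta_weight \<alpha> x * exp (R * sqrt x))"
    "\<And>R. R \<ge> 0 \<Longrightarrow> integral\<^sup>L (lebesgue_on {0..1}) (\<lambda>x. beta_weight \<alpha> x * exp (R * sqrt x))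
        \<le> C * exp R * (1 + R) powr (- \<alpha>)"
proof -
  let ?M = "lebesgue_on {0..1::real}"
  obtain C where C: "C > 0" "\<And>R. R \<ge> 0 \<Longrightarrow> exp (- (1/4 * R)) \<le> C * (1 + R) powr (- \<alpha>)"
    using exp_le_one_plus_powr[OF assms, of "1/4"] by auto
  define B where "B = Gamma (1/2) * Gamma \<alpha> * rGamma (1/2 + \<alpha>)"
  have B: "integrable ?M (beta_weight \<alpha>)" "integral\<^sup>L ?M (beta_weight \<alpha>) = B"
    using beta_moment[OF assms, of 0] by (simp_all add: B_def)
  have Bpos: "B \<ge> 0" unfolding B(2)[symmetric] by (intro integral_nonneg_AE) auto
  have G: "Gamma \<alpha> > 0" using assms by (simp add: Gamma_real_pos)
  \<comment> \<open>The first summand comes from x > 1/2, the second from x \<le> 1/2.\<close>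
  define C' where "C' = sqrt 2 * exp (1/2) * Gamma \<alpha> * 2 powr \<alpha> + C * B"
  define g where "g = (\<lambda>y x. (1 - x) powr (\<alpha> - 1) * exp (- (y * (1 - x)) :: real))"
  have g: "integrable ?M (g \<eta>)" "integral\<^sup>L ?M (g \<eta>) \<le> Gamma \<alpha> * \<eta> powr (- \<alpha>)" if "\<eta> > 0" for \<eta>
  proof -
    have 1: "integrable (lebesgue_on {0..<1}) (g \<eta>)"
      using reflected_gamma_integral(1)[OF assms that]
      by (simp add: g_def integrable_lebesgue_on_iff) (rule set_integrable_subset, auto)
    have 2: "integrable ?M (g \<eta>) \<and> integral\<^sup>L ?M (g \<eta>) = integral\<^sup>L (lebesgue_on {0..<1}) (g \<eta>)"
    proof -
      have "(g \<eta> has_integral (integral\<^sup>L (lebesgue_on {0..<1}) (g \<eta>))) {0..<1}"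
        by (rule has_integral_integral_lebesgue_on[OF 1]) auto
      hence "(g \<eta> has_integral (integral\<^sup>L (lebesgue_on {0..<1}) (g \<eta>))) {0..1}"
        by (subst has_integral_spike_set_eq[where T="{0..<1}"]) (auto intro: negligible_subset[of "{1}"])
      from has_integral_nonneg_lebesgue_on[OF this] show ?thesis by (auto simp: g_def)
    qed
    show "integrable ?M (g \<eta>)" using 2 ..
    have "integral\<^sup>L (lebesgue_on {0..<1}) (g \<eta>) \<le> integral\<^sup>L (lebesgue_on {..<1}) (g \<eta>)"
      using reflected_gamma_integral(1)[OF assms that]
      by (intro integral_mono_lebesgue_on_AE) (auto simp: g_def)
    thus "integral\<^sup>L ?M (g \<eta>) \<le> Gamma \<alpha> * \<eta> powr (- \<alpha>)"
      using 2 reflected_gamma_integral(2)[OF assms that] by (simp add: g_def)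
  qed
  show ?thesis
  proof
    show "C' > 0" using C(1) Bpos G unfolding C'_def
      by (intro add_pos_nonneg mult_pos_pos mult_nonneg_nonneg) auto
    fix R :: real assume R: "R \<ge> 0"
    let ?h = "\<lambda>x. exp R * (sqrt 2 * exp (1/2) * g ((1 + R) / 2) x + exp (- (1/4 * R)) * beta_weight \<alpha> x)"
    have bound: "beta_weight \<alpha> x * exp (R * sqrt x) \<le> ?h x" if x: "x \<in> {0..1}" for x
    proof -
      have "R * sqrt x \<le> R * (1 - (1 - x) / 2)"
        using x R by (intro mult_left_mono sqrt_le_half) auto
      also have "\<dots> = R - R * (1 - x) / 2" by (simp add: algebra_simps)
      finally have e: "exp (R * sqrt x) \<le> exp (R - R * (1 - x) / 2)" by simp
      show ?thesis
      proof (cases "x \<le> 1/2")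
        case True
        \<comment> \<open>Away from x = 1 the factor e^{-R/4} is gained, which beats every power of
          1 + R.\<close>
        have "1/4 * R \<le> R * (1 - x) / 2" using True R mult_left_mono[of "1/2" "1 - x" R] by simp
        hence "exp (R * sqrt x) \<le> exp (R - 1/4 * R)" by (intro order.trans[OF e]) simp
        also have "\<dots> = exp R * exp (- (1/4 * R))" by (simp flip: exp_add)
        finally have "beta_weight \<alpha> x * exp (R * sqrt x) \<le> beta_weight \<alpha> x * (exp R * exp (- (1/4 * R)))"
          by (intro mult_left_mono) auto
        also have "\<dots> \<le> ?h x" by (simp add: g_def algebra_simps)
        finally show ?thesis .
      next
        case False
        have "x powr (-1/2) \<le> (1/2) powr (-1/2)" using False by (intro powr_mono2') auto
        also have "(1/2) powr (-1/2) = sqrt 2"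
          using powr_minus_divide[of "1/2::real" "1/2"] by (simp add: powr_half_sqrt real_sqrt_divide)
        finally have s: "x powr (-1/2) \<le> sqrt 2" .
        \<comment> \<open>Replacing R by 1 + R costs at most e^{1/2} as 1 - x \<le> 1. It keeps the
          rate (1 + R) / 2 of the Gamma integral positive down to R = 0.\<close>
        have "R - R * (1 - x) / 2 \<le> R + (1/2 - (1 + R) / 2 * (1 - x))"
          using x by (simp add: field_simps)
        hence "exp (R * sqrt x) \<le> exp (R + (1/2 - (1 + R) / 2 * (1 - x)))"
          by (intro order.trans[OF e]) simp
        also have "\<dots> = exp R * (exp (1/2) * exp (- ((1 + R) / 2 * (1 - x))))"
          unfolding exp_add[symmetric] by simp
        finally have "x powr (-1/2) * (1 - x) powr (\<alpha> - 1) * exp (R * sqrt x) \<le> sqrt 2 * (1 - x) powr (\<alpha> - 1) * (exp R * (exp (1/2) * exp (- ((1 + R) / 2 * (1 - x)))))"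
          using s by (intro mult_mono mult_right_mono) auto
        also have "\<dots> = exp R * (sqrt 2 * exp (1/2) * g ((1 + R) / 2) x)"
          by (simp add: g_def mult_ac)
        also have "\<dots> \<le> ?h x" by simp
        finally show ?thesis .
      qed
    qed
    have hint: "integrable ?M ?h"
      using B(1) g(1)[of "(1 + R) / 2"] R by (intro integrable_mult_right Bochner_Integration.integrable_add) auto
    show int: "integrable ?M (\<lambda>x. beta_weight \<alpha> x * exp (R * sqrt x))"
    proof (rule measurable_bounded_by_integrable_imp_lebesgue_integrable[OF _ hint])
      have "(\<lambda>x. exp (R * sqrt x)) \<in> borel_measurable ?M"
        by (intro continuous_imp_measurable_on_sets_lebesgue continuous_intros) auto
      thus "(\<lambda>x. beta_weight \<alpha> x * exp (R * sqrt x)) \<in> borel_measurable ?M"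
        by (rule borel_measurable_times[OF borel_measurable_integrable[OF B(1)]])
    qed (use bound in auto)
    have "integral\<^sup>L ?M (\<lambda>x. beta_weight \<alpha> x * exp (R * sqrt x)) \<le> integral\<^sup>L ?M ?h"
      by (rule integral_mono[OF int hint]) (use bound in auto)
    also have "\<dots> = exp R * (sqrt 2 * exp (1/2) * integral\<^sup>L ?M (g ((1 + R) / 2)) + exp (- (1/4 * R)) * B)"
      using B g(1)[of "(1 + R) / 2"] R by simp
    also have "\<dots> \<le> exp R * (sqrt 2 * exp (1/2) * (Gamma \<alpha> * ((1 + R) / 2) powr (- \<alpha>)) + C * (1 + R) powr (- \<alpha>) * B)"
      using g(2)[of "(1 + R) / 2"] C(2)[OF R] Bpos R
      by (intro mult_left_mono add_mono mult_right_mono) auto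
    also have "((1 + R) / 2) powr (- \<alpha>) = 2 powr \<alpha> * (1 + R) powr (- \<alpha>)"
      using R by (simp add: powr_divide powr_minus field_simps)
    also have "exp R * (sqrt 2 * exp (1/2) * (Gamma \<alpha> * (2 powr \<alpha> * (1 + R) powr (- \<alpha>))) + C * (1 + R) powr (- \<alpha>) * B) =
       C' * exp R * (1 + R) powr (- \<alpha>)"
      by (simp add: C'_def algebra_simps)
    finally show "integral\<^sup>L ?M (\<lambda>x. beta_weight \<alpha> x * exp (R * sqrt x)) \<le> C' * exp R * (1 + R) powr (- \<alpha>)" .
  qed
qed

lemma norm_cosh_le: "Re w \<ge> 0 \<Longrightarrow> norm (cosh w) \<le> exp (Re w)" 
proof -
  assume "Re w \<ge> 0"
  have "norm (exp w + exp (- w)) \<le> exp (Re w) + exp (- Re w)"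
    by (rule norm_triangle_le) simp
  also have "\<dots> \<le> exp (Re w) + exp (Re w)" using \<open>Re w \<ge> 0\<close> by simp
  finally show ?thesis by (simp add: cosh_def scaleR_conv_of_real norm_mult)
qed

lemma norm_sinh_le: "Re w \<ge> 0 \<Longrightarrow> norm (sinh w) \<le> exp (Re w)" 
proof -
  assume "Re w \<ge> 0"
  have "norm (exp w - exp (- w)) \<le> exp (Re w) + exp (- Re w)"
    by (rule norm_triangle_le_diff) simp
  also have "\<dots> \<le> exp (Re w) + exp (Re w)" using \<open>Re w \<ge> 0\<close> by simp
  finally show ?thesis by (simp add: sinh_def scaleR_conv_of_real norm_mult)
qed

text \<open>In cosh w - t sinh w the growing exponential has the coefficient (1 - t) / 2. That it
  vanishes at t = 1, where the mass of Poisson's integral sits, is the origin of the cancellation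
  between consecutive orders.\<close>

lemma norm_cosh_minus_sinh_le:
  assumes "Re w \<ge> 0" "0 \<le> t" "t \<le> 1"
  shows "norm (cosh w - of_real t * sinh w) \<le> (1 - t) * exp (Re w) + 1"
proof -
  have "cosh w - of_real t * sinh w = (of_real (1 - t) * exp w + of_real (1 + t) * exp (- w)) / 2"
    by (simp add: cosh_def sinh_def scaleR_conv_of_real field_simps)
  also have "norm \<dots> \<le> ((1 - t) * exp (Re w) + (1 + t) * exp (- Re w)) / 2"
  proof -
    have "norm (of_real (1 - t) * exp w) = (1 - t) * exp (Re w)" "norm (of_real (1 + t) * exp (- w)) = (1 + t) * exp (- Re w)"
      using assms unfolding norm_mult norm_of_real by simp_all
    thus ?thesis unfolding norm_divide norm_numeral
      by (intro divide_right_mono norm_triangle_le) auto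
  qed
  also have "\<dots> \<le> ((1 - t) * exp (Re w) + 2 * 1) / 2"
    using assms by (intro divide_right_mono add_mono mult_mono) auto
  also have "\<dots> \<le> (1 - t) * exp (Re w) + 1"
    using assms by (simp add: field_simps)
  finally show ?thesis .
qed

text \<open>For the difference, Poisson's integrals are subtracted before estimating. The
  coefficient 1 - sqrt x of the growing exponential is at most 1 - x and so raises the parameter of
  the weight from \<nu> + 1/2 to \<nu> + 3/2, which Laplace's method turns into one more power of
  decay.\<close>

lemma bessel_e_bounds:
  fixes \<nu> :: real
  assumes \<nu>: "\<nu> \<ge> 0"
  obtains C where "C > 0"
    "\<And>w. Re w \<ge> 0 \<Longrightarrow> norm (bessel_e \<nu> ((w / 2)\<^sup>2)) \<le> C * exp (Re w) * (1 + Re w) powr (- (\<nu> + 1/2))"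
    "\<And>w. Re w \<ge> 0 \<Longrightarrow> norm (w / 2 * bessel_e (\<nu> + 1) ((w / 2)\<^sup>2)) \<le> C * exp (Re w) * (1 + Re w) powr (- (\<nu> + 1/2))"
    "\<And>w. Re w \<ge> 0 \<Longrightarrow> norm (bessel_e \<nu> ((w / 2)\<^sup>2) - w / 2 * bessel_e (\<nu> + 1) ((w / 2)\<^sup>2))
        \<le> C * exp (Re w) * (1 + Re w) powr (- (\<nu> + 3/2))"
proof -
  let ?M = "lebesgue_on {0..1::real}"
  have a1: "\<nu> + 1/2 > 0" and a2: "\<nu> + 3/2 > 0" using \<nu> by auto
  obtain C1 where C1: "C1 > 0"
    "\<And>R. R \<ge> 0 \<Longrightarrow> integrable ?M (\<lambda>x. beta_weight (\<nu> + 1/2) x * exp (R * sqrt x))"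
    "\<And>R. R \<ge> 0 \<Longrightarrow> integral\<^sup>L ?M (\<lambda>x. beta_weight (\<nu> + 1/2) x * exp (R * sqrt x))
        \<le> C1 * exp R * (1 + R) powr (- (\<nu> + 1/2))"
    using beta_weight_exp_bound[OF a1] by blast
  obtain C2 where C2: "C2 > 0"
    "\<And>R. R \<ge> 0 \<Longrightarrow> integrable ?M (\<lambda>x. beta_weight (\<nu> + 3/2) x * exp (R * sqrt x))"
    "\<And>R. R \<ge> 0 \<Longrightarrow> integral\<^sup>L ?M (\<lambda>x. beta_weight (\<nu> + 3/2) x * exp (R * sqrt x))
        \<le> C2 * exp R * (1 + R) powr (- (\<nu> + 3/2))"
    using beta_weight_exp_bound[OF a2] by blast
  \<comment> \<open>For the decaying exponential in the difference: it contributes a constant, which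
    has to be hidden below e^R (1 + R)^{-(\<nu>+3/2)}.\<close>
  obtain C3 where C3: "C3 > 0" "\<And>R. R \<ge> 0 \<Longrightarrow> exp (- (1 * R)) \<le> C3 * (1 + R) powr (- (\<nu> + 3/2))"
    using exp_le_one_plus_powr[OF a2 zero_less_one] by blast
  define B where "B = Gamma (1/2) * Gamma (\<nu> + 1/2) * rGamma (1/2 + (\<nu> + 1/2))"
  have B: "integrable ?M (beta_weight (\<nu> + 1/2))" "integral\<^sup>L ?M (beta_weight (\<nu> + 1/2)) = B"
    using beta_moment[OF a1, of 0] by (simp_all add: B_def)
  have Bpos: "B \<ge> 0" unfolding B(2)[symmetric] by (intro integral_nonneg_AE) auto
  define K where "K = sqrt pi * Gamma (\<nu> + 1/2)"
  have K: "K > 0" using a1 by (simp add: K_def Gamma_real_pos)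
  define ch where "ch = (\<lambda>w x. of_real (beta_weight (\<nu> + 1/2) x) * cosh (w * complex_of_real (sqrt x)))"
  define sh where "sh = (\<lambda>w x. of_real (beta_weight (\<nu> + 1/2) x) * (of_real (sqrt x) * sinh (w * complex_of_real (sqrt x))))"
  have wm: "(\<lambda>x. complex_of_real (beta_weight (\<nu> + 1/2) x)) \<in> borel_measurable ?M"
    by (rule measurable_compose[OF borel_measurable_integrable[OF B(1)] borel_measurable_of_real])
  have mch: "ch w \<in> borel_measurable ?M" for w
    unfolding ch_def
    by (rule borel_measurable_times[OF wm], rule continuous_imp_measurable_on_sets_lebesgue)
       (auto intro!: continuous_intros)
  have msh: "sh w \<in> borel_measurable ?M" for w
    unfolding sh_def
    by (rule borel_measurable_times[OF wm], rule continuous_imp_measurable_on_sets_lebesgue)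
       (auto intro!: continuous_intros)
  have bch: "norm (ch w x) \<le> beta_weight (\<nu> + 1/2) x * exp (Re w * sqrt x)" if "Re w \<ge> 0" "x \<in> {0..1}" for w x
  proof -
    have "norm (ch w x) = beta_weight (\<nu> + 1/2) x * norm (cosh (w * of_real (sqrt x)))"
      by (simp add: ch_def norm_mult)
    thus ?thesis using norm_cosh_le[of "w * of_real (sqrt x)"] that by (simp add: mult_left_mono)
  qed
  have bsh: "norm (sh w x) \<le> beta_weight (\<nu> + 1/2) x * exp (Re w * sqrt x)" if "Re w \<ge> 0" "x \<in> {0..1}" for w x
  proof -
    have "norm (of_real (sqrt x) * sinh (w * complex_of_real (sqrt x))) \<le> 1 * exp (Re w * sqrt x)"
      using norm_sinh_le[of "w * of_real (sqrt x)"] that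
      unfolding norm_mult by (intro mult_mono) auto
    moreover have "norm (sh w x) = beta_weight (\<nu> + 1/2) x * norm (of_real (sqrt x) * sinh (w * complex_of_real (sqrt x)))"
      by (simp add: sh_def norm_mult)
    ultimately show ?thesis by (simp only: mult_1) (simp add: mult_left_mono)
  qed
  have ich: "integrable ?M (ch w)" if "Re w \<ge> 0" for w
    by (rule measurable_bounded_by_integrable_imp_lebesgue_integrable[OF mch C1(2)[OF that]])
       (use bch that in auto)
  have ish: "integrable ?M (sh w)" if "Re w \<ge> 0" for w
    by (rule measurable_bounded_by_integrable_imp_lebesgue_integrable[OF msh C1(2)[OF that]])
       (use bsh that in auto)
  have e1: "bessel_e \<nu> ((w / 2)\<^sup>2) = integral\<^sup>L ?M (ch w) / of_real K" for w
    using bessel_e_poisson_cosh[OF \<nu>, of w] K unfolding K_def[symmetric] ch_def by (simp add: field_simps)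
  have e2: "w / 2 * bessel_e (\<nu> + 1) ((w / 2)\<^sup>2) = integral\<^sup>L ?M (sh w) / of_real K" for w
    using bessel_e_poisson_sinh[OF \<nu>, of w] K unfolding K_def[symmetric] sh_def by (simp add: field_simps)
  define C where "C = (C1 + (C2 + B * C3)) / K"
  have Cle: "C1 / K \<le> C" "(C2 + B * C3) / K \<le> C"
    using K C1(1) C2(1) C3(1) Bpos by (auto simp: C_def divide_right_mono)
  have step: "norm (integral\<^sup>L ?M f / of_real K) \<le> C * exp (Re w) * (1 + Re w) powr (- \<beta>)"
    if f: "integrable ?M f" "integrable ?M g" "\<And>x. x \<in> {0..1} \<Longrightarrow> norm (f x) \<le> g x" 
      "integral\<^sup>L ?M g \<le> D * exp (Re w) * (1 + Re w) powr (- \<beta>)" "D / K \<le> C" for f :: "real \<Rightarrow> complex" and g w \<beta> D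
  proof -
    have "norm (integral\<^sup>L ?M f) \<le> integral\<^sup>L ?M g"
      by (rule Bochner_Integration.integral_norm_bound_integral[OF f(1,2)]) (use f(3) in auto)
    hence "norm (integral\<^sup>L ?M f / of_real K) \<le> (D * exp (Re w) * (1 + Re w) powr (- \<beta>)) / K"
      using K f(4) by (simp add: norm_divide divide_right_mono)
    also have "\<dots> = (D / K) * (exp (Re w) * (1 + Re w) powr (- \<beta>))" by simp
    also have "\<dots> \<le> C * (exp (Re w) * (1 + Re w) powr (- \<beta>))" using f(5) by (intro mult_right_mono) auto
    finally show ?thesis by (simp add: mult.assoc)
  qed
  show ?thesis
  proof
    show "C > 0" using K C1(1) C2(1) C3(1) Bpos unfolding C_def by (intro divide_pos_pos add_pos_nonneg) auto
    fix w :: complex assume w: "Re w \<ge> 0"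
    show "norm (bessel_e \<nu> ((w / 2)\<^sup>2)) \<le> C * exp (Re w) * (1 + Re w) powr (- (\<nu> + 1/2))"
      unfolding e1 by (rule step[OF ich[OF w] C1(2)[OF w] bch[OF w] C1(3)[OF w] Cle(1)])
    show "norm (w / 2 * bessel_e (\<nu> + 1) ((w / 2)\<^sup>2)) \<le> C * exp (Re w) * (1 + Re w) powr (- (\<nu> + 1/2))"
      unfolding e2 by (rule step[OF ish[OF w] C1(2)[OF w] bsh[OF w] C1(3)[OF w] Cle(1)])
    have "bessel_e \<nu> ((w / 2)\<^sup>2) - w / 2 * bessel_e (\<nu> + 1) ((w / 2)\<^sup>2) = integral\<^sup>L ?M (\<lambda>x. ch w x - sh w x) / of_real K"
      unfolding e1 e2 using ich[OF w] ish[OF w] by (simp add: diff_divide_distrib)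
    also have "norm \<dots> \<le> C * exp (Re w) * (1 + Re w) powr (- (\<nu> + 3/2))"
    proof (rule step[OF _ _ _ _ Cle(2)])
      let ?g = "\<lambda>x. beta_weight (\<nu> + 3/2) x * exp (Re w * sqrt x) + beta_weight (\<nu> + 1/2) x"
      show "integrable ?M (\<lambda>x. ch w x - sh w x)" using ich[OF w] ish[OF w] by simp
      show "integrable ?M ?g" by (intro Bochner_Integration.integrable_add C2(2)[OF w] B(1))
      have "integral\<^sup>L ?M ?g = integral\<^sup>L ?M (\<lambda>x. beta_weight (\<nu> + 3/2) x * exp (Re w * sqrt x)) + B"
        unfolding B(2)[symmetric] by (intro Bochner_Integration.integral_add C2(2)[OF w] B(1))
      also have "\<dots> \<le> C2 * exp (Re w) * (1 + Re w) powr (- (\<nu> + 3/2)) + B * (C3 * exp (Re w) * (1 + Re w) powr (- (\<nu> + 3/2)))"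
      proof (intro add_mono C2(3)[OF w])
        have "1 \<le> C3 * exp (Re w) * (1 + Re w) powr (- (\<nu> + 3/2))"
          using C3(2)[OF w] by (simp add: exp_minus field_simps)
        from mult_left_mono[OF this Bpos] show "B \<le> B * (C3 * exp (Re w) * (1 + Re w) powr (- (\<nu> + 3/2)))" by simp
      qed
      also have "\<dots> = (C2 + B * C3) * exp (Re w) * (1 + Re w) powr (- (\<nu> + 3/2))" by (simp add: algebra_simps)
      finally show "integral\<^sup>L ?M ?g \<le> (C2 + B * C3) * exp (Re w) * (1 + Re w) powr (- (\<nu> + 3/2))" .
      fix x :: real assume x: "x \<in> {0..1}"
      have "ch w x - sh w x = of_real (beta_weight (\<nu> + 1/2) x) * (cosh (w * of_real (sqrt x)) - of_real (sqrt x) * sinh (w * of_real (sqrt x)))"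
        by (simp add: ch_def sh_def algebra_simps)
      also have "norm \<dots> \<le> beta_weight (\<nu> + 1/2) x * ((1 - sqrt x) * exp (Re w * sqrt x) + 1)"
        using norm_cosh_minus_sinh_le[of "w * of_real (sqrt x)" "sqrt x"] w x
        unfolding norm_mult by (intro mult_mono) (auto simp: norm_mult)
      also have "\<dots> \<le> beta_weight (\<nu> + 1/2) x * ((1 - x) * exp (Re w * sqrt x) + 1)"
      proof -
        have "x \<le> sqrt x" using x by (intro real_le_rsqrt) (auto simp: power2_eq_square mult_left_le)
        thus ?thesis by (intro mult_left_mono add_right_mono mult_right_mono) auto
      qed
      also have "\<dots> =
          x powr (-1/2) * ((1 - x) * (1 - x) powr (\<nu> + 1/2 - 1)) * exp (Re w * sqrt x) + beta_weight (\<nu> + 1/2) x"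
        using distrib_left[of "beta_weight (\<nu> + 1/2) x" "(1 - x) * exp (Re w * sqrt x)" 1] by (simp add: mult_ac)
      also have "(1 - x) * (1 - x) powr (\<nu> + 1/2 - 1) = (1 - x) powr (\<nu> + 3/2 - 1)"
        using x powr_add[of "1 - x" 1 "\<nu> + 1/2 - 1"] by (cases "x = 1") (auto simp: add_ac)
      finally show "norm (ch w x - sh w x) \<le> ?g x" .
    qed
    finally show "norm (bessel_e \<nu> ((w / 2)\<^sup>2) - w / 2 * bessel_e (\<nu> + 1) ((w / 2)\<^sup>2)) \<le> C * exp (Re w) * (1 + Re w) powr (- (\<nu> + 3/2))" .
  qed
qed

subsection \<open>Kernel estimates\<close>

lemma one_plus_powr_le_exp_square:
  fixes k \<delta> :: real
  assumes "\<delta> > 0" "k \<ge> 0"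
  obtains C where "C > 0" "\<And>d. d \<ge> 0 \<Longrightarrow> (1 + d) powr k \<le> C * exp (\<delta> * d\<^sup>2)"
proof -
  \<comment> \<open>The exponent is raised by one because \<open>one_plus_powr_le_exp\<close> asks
    for a positive one, while k may be 0.\<close>
  have k1: "k + 1 > 0" using assms by simp
  obtain C where C: "C > 0" "\<And>R. R \<ge> 0 \<Longrightarrow> (1 + R) powr (k + 1) \<le> C * exp (\<delta> * R)"
    using one_plus_powr_le_exp[OF k1 assms(1)] by blast
  show ?thesis
  proof
    show "2 powr (k + 1) * C > 0" using C by simp
    fix d :: real assume d: "d \<ge> 0"
    have "0 \<le> (2 * d - 1)\<^sup>2" by simp
    hence le: "1 + d \<le> 2 * (1 + d\<^sup>2)" using d by (simp add: power2_eq_square algebra_simps)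
    have "(1 + d) powr k \<le> (1 + d) powr (k + 1)" using d by (intro powr_mono) auto
    also have "\<dots> \<le> (2 * (1 + d\<^sup>2)) powr (k + 1)" using d le k1 by (intro powr_mono2) auto
    also have "\<dots> = 2 powr (k + 1) * (1 + d\<^sup>2) powr (k + 1)" using powr_mult[of 2 "1 + d\<^sup>2" "k + 1"] by simp
    also have "\<dots> \<le> 2 powr (k + 1) * (C * exp (\<delta> * d\<^sup>2))" using C(2)[of "d\<^sup>2"] by (intro mult_left_mono) auto
    finally show "(1 + d) powr k \<le> 2 powr (k + 1) * C * exp (\<delta> * d\<^sup>2)" by simp
  qed
qed

text \<open>From N \<ge> 1 follows M \<le> N + d \<le> (1 + d) N, and likewise with M and N
  exchanged. So a power of the ratio of either sign costs only powers of 1 + d.\<close>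

lemma powr_ratio_le:
  fixes M N d k :: real
  assumes "M \<ge> 1" "N \<ge> 1" "M \<le> N + d" "N \<le> M + d" "d \<ge> 0"
  shows "(M / N) powr k \<le> (1 + d) powr \<bar>k\<bar>"
proof (cases "k \<ge> 0")
  case True
  have "d \<le> d * N" using assms mult_left_mono[of 1 N d] by simp
  hence "M \<le> (1 + d) * N" using assms by (simp add: algebra_simps)
  hence "M / N \<le> 1 + d" using assms by (simp add: divide_le_eq)
  thus ?thesis using True assms by (auto intro!: powr_mono2)
next
  case False
  have "d \<le> d * M" using assms mult_left_mono[of 1 M d] by simp
  hence "N \<le> (1 + d) * M" using assms by (simp add: algebra_simps)
  hence "N / M \<le> 1 + d" using assms by (simp add: divide_le_eq)
  hence "(N / M) powr (-k) \<le> (1 + d) powr (-k)" using False assms by (intro powr_mono2) auto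
  moreover have "(N / M) powr (-k) = (M / N) powr k"
    using assms by (simp add: powr_divide powr_minus field_simps)
  ultimately show ?thesis using False by simp
qed

text \<open>Write Y = min Y 1 * M with M = max Y 1, and P likewise with N. The minima appear in the
  claim. For the maxima, M N \<le> (1 + Y P) (1 + d) and M / N \<le> 1 + d with d = |Y - P|, so
  after division by the power of 1 + Y P only powers of 1 + d remain, and half of the Gaussian
  absorbs them. The extra factor 1 + |Y - P| is there for the derivative of the kernel.\<close>

lemma scaled_weight_bound:
  fixes a \<beta> \<eta> :: real
  assumes "\<eta> > 0" "a + \<beta> \<ge> 0"
  obtains C where "C > 0"
   "\<And>Y P. Y > 0 \<Longrightarrow> P > 0 \<Longrightarrow>
      Y powr a * P powr \<beta> * (1 + Y * P) powr (- ((a + \<beta>) / 2)) * (1 + \<bar>Y - P\<bar>) * exp (- (\<eta> * (Y - P)\<^sup>2))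
       \<le> C * (min Y 1 powr a * min P 1 powr \<beta>) * exp (- (\<eta> / 2 * (Y - P)\<^sup>2))"
proof -
  \<comment> \<open>Powers of 1 + d: (a + \<beta>) / 2 from the product M N, |a - \<beta>| / 2 from
    the ratio M / N, and 1 from the explicit factor.\<close>
  define k where "k = (a + \<beta>) / 2 + \<bar>(a - \<beta>) / 2\<bar> + 1"
  have "k \<ge> 0" using assms by (simp add: k_def)
  then obtain C where C: "C > 0" "\<And>d. d \<ge> 0 \<Longrightarrow> (1 + d) powr k \<le> C * exp (\<eta> / 2 * d\<^sup>2)"
    using one_plus_powr_le_exp_square[of "\<eta> / 2" k] assms by auto
  show ?thesis
  proof
    show "C > 0" by fact
    fix Y P :: real assume Y: "Y > 0" and P: "P > 0"
    define M where "M = max Y 1"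
    define N where "N = max P 1"
    define d where "d = \<bar>Y - P\<bar>"
    have MN: "M \<ge> 1" "N \<ge> 1" "M \<le> N + d" "N \<le> M + d" "d \<ge> 0" by (auto simp: M_def N_def d_def)
    have "M * N \<le> (1 + Y * P) * (1 + d)"
    proof -
      consider "Y \<ge> 1" "P \<ge> 1" | "Y \<ge> 1" "P < 1" | "Y < 1" "P \<ge> 1" | "Y < 1" "P < 1" by linarith
      thus ?thesis
      proof cases
        case 1
        have "M * N \<le> (1 + Y * P) * 1" using 1 by (simp add: M_def N_def)
        also have "\<dots> \<le> (1 + Y * P) * (1 + d)" using Y P MN by (intro mult_left_mono) auto
        finally show ?thesis .
      next
        case 2
        have "M * N \<le> 1 * (1 + d)" using 2 by (simp add: M_def N_def d_def)
        also have "\<dots> \<le> (1 + Y * P) * (1 + d)" using Y P MN by (intro mult_right_mono) auto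
        finally show ?thesis .
      next
        case 3
        have "M * N \<le> 1 * (1 + d)" using 3 by (simp add: M_def N_def d_def)
        also have "\<dots> \<le> (1 + Y * P) * (1 + d)" using Y P MN by (intro mult_right_mono) auto
        finally show ?thesis .
      next
        case 4
        have "M * N \<le> 1 * (1 + d)" using 4 MN by (simp add: M_def N_def)
        also have "\<dots> \<le> (1 + Y * P) * (1 + d)" using Y P MN by (intro mult_right_mono) auto
        finally show ?thesis .
      qed
    qed
    hence "(M * N) powr ((a + \<beta>) / 2) \<le> ((1 + Y * P) * (1 + d)) powr ((a + \<beta>) / 2)"
      using assms MN by (intro powr_mono2) auto
    also have "\<dots> = (1 + Y * P) powr ((a + \<beta>) / 2) * (1 + d) powr ((a + \<beta>) / 2)"
      by (rule powr_mult)
    finally have "(M * N) powr ((a + \<beta>) / 2) \<le> (1 + Y * P) powr ((a + \<beta>) / 2) * (1 + d) powr ((a + \<beta>) / 2)" .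
    hence MNle: "(M * N) powr ((a + \<beta>) / 2) * (1 + Y * P) powr (- ((a + \<beta>) / 2)) \<le> (1 + d) powr ((a + \<beta>) / 2)"
    proof -
      assume h: "(M * N) powr ((a + \<beta>) / 2) \<le> (1 + Y * P) powr ((a + \<beta>) / 2) * (1 + d) powr ((a + \<beta>) / 2)"
      have "1 + Y * P > 0" using Y P by (simp add: add_pos_pos)
      hence p: "(1 + Y * P) powr ((a + \<beta>) / 2) > 0" by simp
      show ?thesis using h p unfolding powr_minus by (simp add: divide_inverse[symmetric] pos_divide_le_eq mult.commute)
    qed
    \<comment> \<open>The symmetric part of the exponents goes to the product, the antisymmetric
      part to the ratio.\<close>
    have split: "M powr a * N powr \<beta> = (M * N) powr ((a + \<beta>) / 2) * (M / N) powr ((a - \<beta>) / 2)"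
    proof -
      have "(M * N) powr ((a + \<beta>) / 2) * (M / N) powr ((a - \<beta>) / 2) =
        (M powr ((a + \<beta>) / 2) * M powr ((a - \<beta>) / 2)) * (N powr ((a + \<beta>) / 2) * N powr (- ((a - \<beta>) / 2)))"
        using MN by (simp add: powr_mult powr_divide powr_minus field_simps)
      also have "\<dots> = M powr a * N powr \<beta>"
        unfolding powr_add[symmetric] by (simp add: field_simps)
      finally show ?thesis ..
    qed
    have YM: "Y powr a = min Y 1 powr a * M powr a"
      using Y by (subst powr_mult[symmetric]) (auto simp: M_def min_def max_def)
    have PN: "P powr \<beta> = min P 1 powr \<beta> * N powr \<beta>"
      using P by (subst powr_mult[symmetric]) (auto simp: N_def min_def max_def)
    have "(M powr a * N powr \<beta>) * (1 + Y * P) powr (- ((a + \<beta>) / 2)) * (1 + d)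
        = ((M * N) powr ((a + \<beta>) / 2) * (1 + Y * P) powr (- ((a + \<beta>) / 2))) * (M / N) powr ((a - \<beta>) / 2) * (1 + d)"
      unfolding split by (simp add: mult_ac)
    also have "\<dots> \<le> (1 + d) powr ((a + \<beta>) / 2) * (1 + d) powr \<bar>(a - \<beta>) / 2\<bar> * (1 + d)"
      using MN by (intro mult_mono MNle powr_ratio_le) auto
    also have "\<dots> = (1 + d) powr k"
      using MN unfolding k_def powr_add by simp
    also have "\<dots> \<le> C * exp (\<eta> / 2 * d\<^sup>2)" by (rule C(2)) (rule MN)
    also have "d\<^sup>2 = (Y - P)\<^sup>2" by (simp add: d_def)
    finally have main: "(M powr a * N powr \<beta>) * (1 + Y * P) powr (- ((a + \<beta>) / 2)) * (1 + d) \<le> C * exp (\<eta> / 2 * (Y - P)\<^sup>2)" .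
    have "Y powr a * P powr \<beta> * (1 + Y * P) powr (- ((a + \<beta>) / 2)) * (1 + \<bar>Y - P\<bar>) * exp (- (\<eta> * (Y - P)\<^sup>2)) =
      (min Y 1 powr a * min P 1 powr \<beta>) * exp (- (\<eta> * (Y - P)\<^sup>2)) * ((M powr a * N powr \<beta>) * (1 + Y * P) powr (- ((a + \<beta>) / 2)) * (1 + d))"
      unfolding YM PN d_def[symmetric] by (simp add: mult_ac)
    also have "\<dots> \<le> (min Y 1 powr a * min P 1 powr \<beta>) * exp (- (\<eta> * (Y - P)\<^sup>2)) * (C * exp (\<eta> / 2 * (Y - P)\<^sup>2))"
      by (intro mult_left_mono main) auto
    also have "\<dots> = C * (min Y 1 powr a * min P 1 powr \<beta>) * (exp (- (\<eta> * (Y - P)\<^sup>2)) * exp (\<eta> / 2 * (Y - P)\<^sup>2))"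
      by (simp add: mult_ac)
    also have "exp (- (\<eta> * (Y - P)\<^sup>2)) * exp (\<eta> / 2 * (Y - P)\<^sup>2) = exp (- (\<eta> / 2 * (Y - P)\<^sup>2))"
      unfolding exp_add[symmetric] by (simp add: field_simps)
    finally show "Y powr a * P powr \<beta> * (1 + Y * P) powr (- ((a + \<beta>) / 2)) * (1 + \<bar>Y - P\<bar>) * exp (- (\<eta> * (Y - P)\<^sup>2))
       \<le> C * (min Y 1 powr a * min P 1 powr \<beta>) * exp (- (\<eta> / 2 * (Y - P)\<^sup>2))" .
  qed
qed

text \<open>The part of the kernel that depends on z alone. The base is 1 / (4 z) because the Bessel
  function is evaluated at y \<rho> / (2 z) and its power takes half of the argument.\<close>

definition kernel_const :: "real \<Rightarrow> complex \<Rightarrow> complex" where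
  "kernel_const \<nu> z = 1 / (2 * z) * (1 / (4 * z)) powr of_real \<nu>"

text \<open>The power (y \<rho>)^\<nu> of the Bessel function is merged into the two prefactors.
  With general exponents, only a + \<beta> = 2 \<nu> + 1 matters for the estimates;
  \<open>p_L\<close> is the case a = - s1, \<beta> = c - s1.\<close>

definition bessel_kernel :: "real \<Rightarrow> real \<Rightarrow> real \<Rightarrow> complex \<Rightarrow> real \<Rightarrow> real \<Rightarrow> complex" where
  "bessel_kernel \<nu> a \<beta> z y \<rho> = kernel_const \<nu> z * of_real (y powr a * \<rho> powr \<beta>) *
     exp (- (of_real (y\<^sup>2 + \<rho>\<^sup>2) / (4 * z))) * bessel_e \<nu> ((of_real (y * \<rho>) / (4 * z))\<^sup>2)"

lemma p_L_eq_bessel_kernel: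
  assumes "y > 0" "\<rho> > 0"
  shows "p_L b c z y \<rho> = bessel_kernel (sqrt (discr b c)) (- s1 b c) (- s1 b c + c) z y \<rho>"
proof -
  define \<nu> where "\<nu> = sqrt (discr b c)"
  have e1: "- s1 b c = (1 - c) / 2 + \<nu>" "- s1 b c + c = (1 + c) / 2 + \<nu>"
    by (auto simp: s1_def \<nu>_def field_simps)
  have h: "of_real (y * \<rho>) / (2 * z) / 2 = of_real (y * \<rho>) * (1 / (4 * z))" by simp
  \<comment> \<open>A positive real factor may leave the principal power, so the branch only
    concerns 1 / (4 z).\<close>
  have "(of_real (y * \<rho>) / (2 * z) / 2) powr of_real \<nu> = of_real ((y * \<rho>) powr \<nu>) * (1 / (4 * z)) powr of_real \<nu>"
    unfolding h using assms powr_of_real[of "y * \<rho>" \<nu>]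
    by (subst powr_times_real_left) auto
  also have "(y * \<rho>) powr \<nu> = y powr \<nu> * \<rho> powr \<nu>" using assms by (simp add: powr_mult)
  finally have I: "bessel_I \<nu> (of_real (y * \<rho>) / (2 * z)) = of_real (y powr \<nu> * \<rho> powr \<nu>) * (1 / (4 * z)) powr of_real \<nu> * bessel_e \<nu> ((of_real (y * \<rho>) / (4 * z))\<^sup>2)"
    unfolding bessel_I_eq by simp
  show ?thesis
    unfolding p_L_def \<nu>_def[symmetric] I bessel_kernel_def kernel_const_def e1(2)
    unfolding e1(1) powr_add by (simp add: mult_ac)
qed

lemma norm_kernel_const:
  assumes "z \<noteq> 0"
  shows "norm (kernel_const \<nu> z) = (1/2) * (1/4) powr \<nu> * norm z powr (- (\<nu> + 1))"
proof -
  have "norm ((1 / (4 * z)) powr of_real \<nu>) = (1 / (4 * norm z)) powr \<nu>"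
    by (subst norm_powr_real_powr') (auto simp: norm_divide norm_mult)
  also have "\<dots> = (1/4) powr \<nu> * norm z powr (-\<nu>)"
    using assms by (simp add: powr_mult powr_divide powr_minus field_simps)
  finally show ?thesis using assms
    by (simp add: kernel_const_def norm_mult norm_divide powr_diff powr_minus powr_add field_simps)
qed

text \<open>The derivative of y^a returns the kernel times a / y. The rest is entire in y: its
  Gaussian contributes - y / (2 z), its Bessel factor raises the order. The result is grouped so
  that the bracket is the combination \<rho> I_{\<nu>+1} - y I_\<nu>, stripped of the common
  power.\<close>

lemma bessel_kernel_has_vector_derivative:
  assumes "\<nu> \<ge> 0" "y > 0" "z \<noteq> 0"
  shows "((\<lambda>x. bessel_kernel \<nu> a \<beta> z x \<rho>) has_vector_derivative
     of_real (a / y) * bessel_kernel \<nu> a \<beta> z y \<rho> +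
     kernel_const \<nu> z * of_real (y powr a * \<rho> powr \<beta>) * exp (- (of_real (y\<^sup>2 + \<rho>\<^sup>2) / (4 * z))) *
      (1 / (2 * z) * (of_real \<rho> * (of_real (y * \<rho>) / (4 * z) * bessel_e (\<nu> + 1) ((of_real (y * \<rho>) / (4 * z))\<^sup>2))
         - of_real y * bessel_e \<nu> ((of_real (y * \<rho>) / (4 * z))\<^sup>2)))) (at y)"
proof -
  \<comment> \<open>The entire factor as a function of a complex variable: it is differentiated
    there and then restricted to the real line.\<close>
  define F where "F = (\<lambda>\<zeta>. exp (- ((\<zeta>\<^sup>2 + of_real \<rho> ^ 2) / (4 * z))) * bessel_e \<nu> ((\<zeta> * of_real \<rho> / (4 * z))\<^sup>2))"
  define u where "u = complex_of_real (y * \<rho>) / (4 * z)"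
  define E where "E = exp (- (complex_of_real (y\<^sup>2 + \<rho>\<^sup>2) / (4 * z)))"
  define F' where "F' = E * (1 / (2 * z) * (of_real \<rho> * (u * bessel_e (\<nu> + 1) (u\<^sup>2)) - of_real y * bessel_e \<nu> (u\<^sup>2)))"
  have B: "((\<lambda>\<zeta>. bessel_e \<nu> ((\<zeta> * of_real \<rho> / (4 * z))\<^sup>2)) has_field_derivative
        bessel_e (\<nu> + 1) (u\<^sup>2) * (2 * u * (of_real \<rho> / (4 * z)))) (at (of_real y))"
  proof -
    have 1: "(bessel_e \<nu> has_field_derivative bessel_e (\<nu> + 1) (u\<^sup>2)) (at ((of_real y * of_real \<rho> / (4 * z))\<^sup>2))"
      using bessel_e_deriv[OF assms(1), of "u\<^sup>2"] by (simp add: u_def)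
    have 2: "((\<lambda>\<zeta>. (\<zeta> * of_real \<rho> / (4 * z))\<^sup>2) has_field_derivative 2 * u * (of_real \<rho> / (4 * z))) (at (of_real y))"
      unfolding u_def using assms(3) by (auto intro!: derivative_eq_intros simp: field_simps power2_eq_square power4_eq_xxxx)
    show ?thesis
      using DERIV_chain2[where f="bessel_e \<nu>" and g="\<lambda>\<zeta>. (\<zeta> * of_real \<rho> / (4 * z))\<^sup>2", OF 1 2] .
  qed
  have "(F has_field_derivative F') (at (of_real y))"
  proof -
    have A: "((\<lambda>\<zeta>. exp (- ((\<zeta>\<^sup>2 + (complex_of_real \<rho>)\<^sup>2) / (4 * z)))) has_field_derivative E * (- (of_real y / (2 * z)))) (at (of_real y))"
      using assms(3) by (auto intro!: derivative_eq_intros simp: E_def field_simps)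
    have u: "complex_of_real y * of_real \<rho> / (4 * z) = u" by (simp add: u_def)
    show ?thesis
      unfolding F_def using DERIV_mult[OF A B] unfolding u
      by (rule DERIV_cong) (use assms(3) in \<open>simp add: F'_def E_def field_simps\<close>)
  qed
  hence "((\<lambda>x. F (of_real x)) has_vector_derivative F') (at y)"
    by (rule has_vector_derivative_real_field)
  moreover have "((\<lambda>x. complex_of_real (x powr a)) has_vector_derivative of_real (a * y powr (a - 1))) (at y)"
    using assms by (intro has_vector_derivative_of_real)
      (simp add: has_real_derivative_powr has_real_derivative_iff_has_vector_derivative[symmetric])
  ultimately have "((\<lambda>x. complex_of_real (x powr a) * F (of_real x)) has_vector_derivative
     (of_real (y powr a) * F' + of_real (a * y powr (a - 1)) * F (of_real y))) (at y)"
    using has_vector_derivative_mult by blast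
  hence "((\<lambda>x. kernel_const \<nu> z * of_real (\<rho> powr \<beta>) * (complex_of_real (x powr a) * F (of_real x))) has_vector_derivative
     kernel_const \<nu> z * of_real (\<rho> powr \<beta>) * (of_real (y powr a) * F' + of_real (a * y powr (a - 1)) * F (of_real y))) (at y)"
    by (intro has_vector_derivative_mult_right)
  moreover have "(\<lambda>x. kernel_const \<nu> z * of_real (\<rho> powr \<beta>) * (complex_of_real (x powr a) * F (of_real x))) = (\<lambda>x. bessel_kernel \<nu> a \<beta> z x \<rho>)"
    by (rule ext) (simp add: bessel_kernel_def F_def mult_ac)
  moreover have "F (of_real y) = E * bessel_e \<nu> (u\<^sup>2)" by (simp add: F_def E_def u_def)
  moreover have "a * y powr (a - 1) = a / y * y powr a" using assms by (simp add: powr_diff)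
  ultimately show ?thesis
    unfolding bessel_kernel_def u_def[symmetric] E_def[symmetric] F'_def by (simp add: algebra_simps)
qed

text \<open>The common shape of the two right-hand sides of the theorem, spelled so that unfolding
  reproduces them literally.\<close>

definition kernel_bound :: "real \<Rightarrow> real \<Rightarrow> real \<Rightarrow> real \<Rightarrow> real \<Rightarrow> complex \<Rightarrow> real \<Rightarrow> real \<Rightarrow> real" where
  "kernel_bound C \<kappa> s a \<beta> z y \<rho> = C * norm z powr s *
     (min (y / norm z powr (1 / 2)) 1) powr a * (min (\<rho> / norm z powr (1 / 2)) 1) powr \<beta> *
     exp (- (\<bar>y - \<rho>\<bar>\<^sup>2 / (\<kappa> * norm z)))"

text \<open>With Y = y / |z|^{1/2} and P = \<rho> / |z|^{1/2} the prefactor |z|^{-\<nu>-1} y^a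
  \<rho>^\<beta> becomes |z|^{-1/2} Y^a P^\<beta>, because a + \<beta> = 2 \<nu> + 1; what remains
  is an inequality in Y and P. The Gaussian there has rate \<sigma> / 4, of which \<sigma> / 8
  survives \<open>scaled_weight_bound\<close>.\<close>

lemma bessel_kernel_estimate:
  fixes \<nu> a \<beta> \<sigma> :: real
  assumes \<nu>: "\<nu> \<ge> 0" and ab: "a + \<beta> = 2 * \<nu> + 1" and \<sigma>: "0 < \<sigma>" "\<sigma> \<le> 1"
  obtains C where "C > 0"
    "\<And>z y \<rho>. z \<noteq> 0 \<Longrightarrow> \<sigma> * norm z \<le> Re z \<Longrightarrow> y > 0 \<Longrightarrow> \<rho> > 0 \<Longrightarrow>
       norm (bessel_kernel \<nu> a \<beta> z y \<rho>) \<le> kernel_bound C (8 / \<sigma>) (- 1 / 2) a \<beta> z y \<rho>"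
    "\<And>z y \<rho>. z \<noteq> 0 \<Longrightarrow> \<sigma> * norm z \<le> Re z \<Longrightarrow> y > 0 \<Longrightarrow> \<rho> > 0 \<Longrightarrow>
       norm (bessel_kernel \<nu> a \<beta> z y \<rho>) / y +
       norm (vector_derivative (\<lambda>x. bessel_kernel \<nu> a \<beta> z x \<rho>) (at y)) \<le> kernel_bound C (8 / \<sigma>) (- 1) (a - 1) \<beta> z y \<rho>"
proof -
  obtain C0 where C0: "C0 > 0"
    "\<And>w. Re w \<ge> 0 \<Longrightarrow> norm (bessel_e \<nu> ((w / 2)\<^sup>2)) \<le> C0 * exp (Re w) * (1 + Re w) powr (- (\<nu> + 1/2))"
    "\<And>w. Re w \<ge> 0 \<Longrightarrow> norm (w / 2 * bessel_e (\<nu> + 1) ((w / 2)\<^sup>2)) \<le> C0 * exp (Re w) * (1 + Re w) powr (- (\<nu> + 1/2))"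
    "\<And>w. Re w \<ge> 0 \<Longrightarrow> norm (bessel_e \<nu> ((w / 2)\<^sup>2) - w / 2 * bessel_e (\<nu> + 1) ((w / 2)\<^sup>2))
        \<le> C0 * exp (Re w) * (1 + Re w) powr (- (\<nu> + 3/2))"
    using bessel_e_bounds[OF \<nu>] by blast
  have m: "(a + \<beta>) / 2 = \<nu> + 1/2" using ab by simp
  have "a + \<beta> \<ge> 0" using ab \<nu> by simp
  then obtain C1 where C1: "C1 > 0"
   "\<And>Y P. Y > 0 \<Longrightarrow> P > 0 \<Longrightarrow>
      Y powr a * P powr \<beta> * (1 + Y * P) powr (- (\<nu> + 1/2)) * (1 + \<bar>Y - P\<bar>) * exp (- (\<sigma> / 4 * (Y - P)\<^sup>2))
       \<le> C1 * (min Y 1 powr a * min P 1 powr \<beta>) * exp (- (\<sigma> / 4 / 2 * (Y - P)\<^sup>2))"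
    using scaled_weight_bound[of "\<sigma> / 4" a \<beta>] \<sigma> unfolding m by (metis divide_pos_pos zero_less_numeral)
  \<comment> \<open>Converts powers of 1 + Re w into powers of 1 + Y P. Since \<sigma> / 2 < 1, this
    constant for the exponent \<nu> + 3/2 also serves for \<nu> + 1/2.\<close>
  define S where "S = (\<sigma> / 2) powr (- (\<nu> + 3/2))"
  have S: "S > 0" using \<sigma> by (simp add: S_def)
  define C2 where "C2 = (1/2) * (1/4) powr \<nu> * C0 * S * C1"
  have C2: "C2 > 0" using C0 C1 S by (simp add: C2_def)
  \<comment> \<open>One C2 for the kernel divided by y, |a| times C2 for the derivative of y^a, and
    one C2 for the derivative of the entire factor.\<close>
  define C where "C = C2 * (1 + \<bar>a\<bar> + 1)"
  have CC: "C > 0" using C2 by (simp add: C_def)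
  show ?thesis
  proof (rule that[OF CC])
    fix z :: complex and y \<rho> :: real assume z: "z \<noteq> 0" "\<sigma> * norm z \<le> Re z" and y: "y > 0" and \<rho>: "\<rho> > 0"
    define r where "r = norm z powr (1/2)"
    have r: "r > 0" using z by (simp add: r_def)
    have r2: "norm z = r\<^sup>2" using z by (simp add: r_def powr_half_sqrt)
    define Y where "Y = y / r"
    define P where "P = \<rho> / r"
    have YP: "Y > 0" "P > 0" using y \<rho> r by (auto simp: Y_def P_def)
    have yr: "y = Y * r" "\<rho> = P * r" using r by (auto simp: Y_def P_def)
    define w where "w = complex_of_real (y * \<rho>) / (2 * z)"
    have wh: "complex_of_real (y * \<rho>) / (4 * z) = w / 2" by (simp add: w_def)
    \<comment> \<open>The cosine of the argument of z; the real parts needed below are multiples of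
      it.\<close>
    define \<tau> where "\<tau> = Re z / norm z"
    have \<tau>: "\<sigma> \<le> \<tau>" using z by (simp add: \<tau>_def pos_le_divide_eq)
    have inv: "Re (of_real x / z) = x * \<tau> / r\<^sup>2" for x
    proof -
      have "Re (of_real x / z) = x * Re z / (norm z)\<^sup>2" by (simp add: Re_divide cmod_power2)
      also have "\<dots> = x * (Re z / norm z) / norm z" by (simp add: power2_eq_square)
      finally show ?thesis by (simp add: \<tau>_def r2[symmetric])
    qed
    have Rew: "Re w = Y * P * \<tau> / 2"
    proof -
      have "w = of_real (y * \<rho> / 2) / z" by (simp add: w_def)
      thus ?thesis using inv[of "y * \<rho> / 2"] r unfolding yr by (simp add: power2_eq_square)
    qed
    have Rew0: "Re w \<ge> 0" unfolding Rew using YP \<tau> \<sigma> by simp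
    have le: "\<sigma> / 2 * (1 + Y * P) \<le> 1 + Re w"
    proof -
      have "\<sigma> / 2 * (1 + Y * P) = \<sigma> / 2 + Y * P * \<sigma> / 2" by (simp add: algebra_simps)
      also have "\<dots> \<le> 1 + Y * P * \<tau> / 2" using \<sigma> \<tau> YP by (intro add_mono divide_right_mono mult_left_mono) auto
      finally show ?thesis using Rew by simp
    qed
    have base: "(1 + Re w) powr (- k) \<le> (\<sigma> / 2) powr (- k) * (1 + Y * P) powr (- k)" if "k \<ge> 0" for k
    proof -
      have "0 < \<sigma> / 2 * (1 + Y * P)" using \<sigma> YP by (simp add: add_pos_pos)
      thus ?thesis using le that unfolding powr_mult[symmetric] by (intro powr_mono2') auto
    qed
    have Sle: "(\<sigma> / 2) powr (- (\<nu> + 1/2)) \<le> S"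
      unfolding S_def using \<sigma> by (intro powr_mono') auto
    define G where "G = exp (- (\<sigma> / 4 * (Y - P)\<^sup>2))"
    define T where "T = (1 + Y * P) powr (- (\<nu> + 1/2))"
    define E where "E = exp (- (complex_of_real (y\<^sup>2 + \<rho>\<^sup>2) / (4 * z)))"
    \<comment> \<open>The growth e^{Re w} of the Bessel factor supplies the mixed term that
      completes the square in the Gaussian.\<close>
    have EG: "norm E * exp (Re w) \<le> G"
    proof -
      have "Re (complex_of_real (y\<^sup>2 + \<rho>\<^sup>2) / (4 * z)) = (y\<^sup>2 + \<rho>\<^sup>2) / 4 * \<tau> / r\<^sup>2"
        using inv[of "(y\<^sup>2 + \<rho>\<^sup>2) / 4"] by simp
      also have "\<dots> = (Y\<^sup>2 + P\<^sup>2) * \<tau> / 4" using r unfolding yr by (simp add: field_simps power_mult_distrib)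
      finally have "norm E * exp (Re w) = exp (- ((Y\<^sup>2 + P\<^sup>2) * \<tau> / 4) + Y * P * \<tau> / 2)"
        unfolding E_def exp_add by (simp add: Rew)
      also have "- ((Y\<^sup>2 + P\<^sup>2) * \<tau> / 4) + Y * P * \<tau> / 2 = - (\<tau> / 4 * (Y - P)\<^sup>2)"
        by (simp add: power2_eq_square field_simps)
      also have "exp \<dots> \<le> G" unfolding G_def using \<tau> by (simp add: mult_right_mono)
      finally show ?thesis .
    qed
    have absorb: "norm E * (C0 * exp (Re w) * x) \<le> C0 * G * x'" if "x \<le> x'" "0 \<le> x" for x x'
    proof -
      have "norm E * (C0 * exp (Re w) * x) = C0 * (norm E * exp (Re w)) * x" by simp
      also have "\<dots> \<le> C0 * G * x'" using EG that C0(1) by (intro mult_mono) (auto simp: G_def)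
      finally show ?thesis .
    qed
    define A where "A = bessel_e \<nu> ((w / 2)\<^sup>2)"
    define B where "B = w / 2 * bessel_e (\<nu> + 1) ((w / 2)\<^sup>2)"
    have T1: "(1 + Re w) powr (- (\<nu> + 1/2)) \<le> S * T"
      using base[of "\<nu> + 1/2"] \<nu> mult_right_mono[OF Sle, of T] by (auto simp: T_def)
    have T2: "(1 + Re w) powr (- (\<nu> + 3/2)) \<le> S * (T / (1 + Y * P))"
    proof -
      have "(1 + Y * P) powr (- (\<nu> + 3/2)) = T / (1 + Y * P)"
      proof -
        have "- (\<nu> + 3/2) = - (\<nu> + 1/2) - 1" by simp
        thus ?thesis unfolding T_def using YP by (simp only: powr_diff) (simp add: add_pos_pos)
      qed
      thus ?thesis using base[of "\<nu> + 3/2"] \<nu> by (simp add: S_def)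
    qed
    have EA: "norm (E * A) \<le> C0 * G * (S * T)"
      unfolding norm_mult[of E] A_def B_def
      by (rule order.trans[OF mult_left_mono[OF C0(2)[OF Rew0]] absorb[OF T1]]; simp)
    have EB: "norm (E * B) \<le> C0 * G * (S * T)"
      unfolding norm_mult[of E] A_def B_def
      by (rule order.trans[OF mult_left_mono[OF C0(3)[OF Rew0]] absorb[OF T1]]; simp)
    have EAB: "norm (E * (A - B)) \<le> C0 * G * (S * (T / (1 + Y * P)))"
      unfolding norm_mult[of E] A_def B_def
      by (rule order.trans[OF mult_left_mono[OF C0(4)[OF Rew0]] absorb[OF T2]]) simp_all
    have GT: "G \<ge> 0" "T \<ge> 0" by (auto simp: G_def T_def)
    define K where "K = kernel_const \<nu> z * of_real (y powr a * \<rho> powr \<beta>)"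
    have Knorm: "norm K = (1/2) * (1/4) powr \<nu> / r * (Y powr a * P powr \<beta>)"
    proof -
      have "y powr a * \<rho> powr \<beta> = (Y powr a * P powr \<beta>) * (r powr a * r powr \<beta>)"
        using YP r unfolding yr by (simp add: powr_mult)
      also have "r powr a * r powr \<beta> = r powr (2 * \<nu> + 1)"
        unfolding powr_add[symmetric] ab ..
      finally have 1: "norm K = (1/2) * (1/4) powr \<nu> * ((norm z powr (- (\<nu> + 1))) * r powr (2 * \<nu> + 1)) * (Y powr a * P powr \<beta>)"
        unfolding K_def norm_mult norm_kernel_const[OF z(1)] norm_of_real by (simp add: abs_mult)
      have "norm z powr (- (\<nu> + 1)) = r powr (2 * (- (\<nu> + 1)))"
        unfolding r2 using r by (simp add: powr_powr flip: powr_numeral)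
      hence "(norm z powr (- (\<nu> + 1))) * r powr (2 * \<nu> + 1) = r powr (-1)"
        unfolding powr_add[symmetric] by (simp add: algebra_simps flip: powr_add)
      also have "\<dots> = 1 / r" using r by (simp add: powr_minus_divide)
      finally show ?thesis unfolding 1 by simp
    qed
    define W where "W = min Y 1 powr a * min P 1 powr \<beta> * exp (- (\<sigma> / 8 * (Y - P)\<^sup>2))"
    have main: "norm K * (C0 * G * (S * T) * (1 + \<bar>Y - P\<bar>)) \<le> C2 / r * W"
    proof -
      have "norm K * (C0 * G * (S * T) * (1 + \<bar>Y - P\<bar>)) = (1/2) * (1/4) powr \<nu> * C0 * S / r *
        (Y powr a * P powr \<beta> * T * (1 + \<bar>Y - P\<bar>) * G)"
        unfolding Knorm by simp
      also have "\<dots> \<le> (1/2) * (1/4) powr \<nu> * C0 * S / r * (C1 * (min Y 1 powr a * min P 1 powr \<beta>) * exp (- (\<sigma> / 4 / 2 * (Y - P)\<^sup>2)))"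
        unfolding T_def G_def using C0(1) S r YP by (intro mult_left_mono C1(2)) auto
      also have "\<dots> = C2 / r * W" by (simp add: C2_def W_def)
      finally show ?thesis .
    qed
    have pK: "bessel_kernel \<nu> a \<beta> z y \<rho> = K * (E * A)"
      unfolding bessel_kernel_def wh K_def E_def A_def by (simp add: mult_ac)
    have p1: "norm (bessel_kernel \<nu> a \<beta> z y \<rho>) \<le> C2 / r * W"
    proof -
      have "norm (bessel_kernel \<nu> a \<beta> z y \<rho>) \<le> norm K * (C0 * G * (S * T))"
        unfolding pK norm_mult[of K] using EA by (intro mult_left_mono) auto
      also have "\<dots> \<le> norm K * (C0 * G * (S * T) * (1 + \<bar>Y - P\<bar>))"
        using C0(1) S GT by (intro mult_left_mono) (auto simp: algebra_simps)
      also note main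
      finally show ?thesis .
    qed
    have W0: "W \<ge> 0" by (simp add: W_def)
    have rm: "norm z powr (- 1 / 2) = 1 / r" 
      unfolding r_def using z by (simp add: powr_minus_divide)
    have ex: "\<bar>y - \<rho>\<bar>\<^sup>2 / (8 / \<sigma> * norm z) = \<sigma> / 8 * (Y - P)\<^sup>2"
    proof -
      have "\<bar>y - \<rho>\<bar>\<^sup>2 = (Y - P)\<^sup>2 * r\<^sup>2" unfolding yr by (simp add: power_mult_distrib[symmetric] algebra_simps)
      thus ?thesis unfolding r2 using r \<sigma> by simp
    qed
    have goal1: "norm (bessel_kernel \<nu> a \<beta> z y \<rho>) \<le> C / r * W"
      by (rule order.trans[OF p1]) (use C2 W0 r in \<open>auto simp: C_def intro!: mult_right_mono divide_right_mono\<close>)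
    show "norm (bessel_kernel \<nu> a \<beta> z y \<rho>) \<le> kernel_bound C (8 / \<sigma>) (- 1 / 2) a \<beta> z y \<rho>"
      unfolding kernel_bound_def rm ex r_def[symmetric] Y_def[symmetric] P_def[symmetric]
      using goal1 by (simp add: W_def mult_ac)
    define D where "D = K * (E * (1 / (2 * z) * (of_real \<rho> * B - of_real y * A)))"
    have der: "vector_derivative (\<lambda>x. bessel_kernel \<nu> a \<beta> z x \<rho>) (at y) = of_real (a / y) * bessel_kernel \<nu> a \<beta> z y \<rho> + D"
      using bessel_kernel_has_vector_derivative[OF \<nu> y z(1), of a \<beta> \<rho>, unfolded wh, THEN vector_derivative_at]
      unfolding D_def K_def A_def B_def E_def by (simp add: mult_ac)
    \<comment> \<open>\<open>\<rho> B - y A\<close> equals both \<open>(\<rho> - y) B - y (A - B)\<close> and \<open>(\<rho> - y) A - \<rho> (A - B)\<close>; the factor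
      \<open>min y \<rho>\<close> is absorbed by the additional decay of \<open>A - B\<close>.\<close>
    have BA: "norm (E * (of_real \<rho> * B - of_real y * A)) \<le> r * (C0 * G * (S * T) * (1 + \<bar>Y - P\<bar>))"
    proof -
      have small: "min Y P / (1 + Y * P) \<le> 1"
      proof -
        have "min Y P \<le> 1 + Y * P"
        proof (cases "min Y P \<le> 1")
          case False
          have "min Y P * 1 \<le> Y * P" using False YP by (intro mult_mono) auto
          thus ?thesis by simp
        qed (use YP in \<open>auto intro: order.trans\<close>)
        thus ?thesis using YP by (simp add: divide_le_eq add_pos_pos)
      qed
      have small': "(min Y P * r) * (C0 * G * (S * (T / (1 + Y * P)))) \<le> r * (C0 * G * (S * T))"
      proof -
        have "(min Y P * r) * (C0 * G * (S * (T / (1 + Y * P)))) = r * (C0 * G * (S * T)) * (min Y P / (1 + Y * P))" by simp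
        also have "\<dots> \<le> r * (C0 * G * (S * T)) * 1"
          using small r C0(1) GT S by (intro mult_left_mono) auto
        finally show ?thesis by simp
      qed
      have abs: "\<bar>\<rho> - y\<bar> = r * \<bar>Y - P\<bar>"
        using r unfolding yr left_diff_distrib[symmetric] abs_mult by (simp add: abs_minus_commute)
      show ?thesis
      proof (cases "Y \<le> P")
        case True
        have "E * (of_real \<rho> * B - of_real y * A) = of_real (\<rho> - y) * (E * B) - of_real y * (E * (A - B))"
          by (simp add: algebra_simps)
        also have "norm \<dots> \<le> \<bar>\<rho> - y\<bar> * norm (E * B) + y * norm (E * (A - B))"
          by (rule order.trans[OF norm_triangle_ineq4]) (use y in \<open>simp add: norm_mult del: of_real_diff\<close>)
        also have "\<dots> \<le> \<bar>\<rho> - y\<bar> * (C0 * G * (S * T)) + y * (C0 * G * (S * (T / (1 + Y * P))))"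
          using y by (intro add_mono mult_left_mono EB EAB) auto
        also have "y * (C0 * G * (S * (T / (1 + Y * P)))) = min Y P * r * (C0 * G * (S * (T / (1 + Y * P))))"
          using True yr by (simp add: min_def)
        also have "\<bar>\<rho> - y\<bar> * (C0 * G * (S * T)) + min Y P * r * (C0 * G * (S * (T / (1 + Y * P))))
           \<le> r * \<bar>Y - P\<bar> * (C0 * G * (S * T)) + r * (C0 * G * (S * T))"
          unfolding abs using small' by simp
        finally show ?thesis by (simp add: algebra_simps)
      next
        case False
        have "E * (of_real \<rho> * B - of_real y * A) = of_real (\<rho> - y) * (E * A) - of_real \<rho> * (E * (A - B))"
          by (simp add: algebra_simps)
        also have "norm \<dots> \<le> \<bar>\<rho> - y\<bar> * norm (E * A) + \<rho> * norm (E * (A - B))"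
          by (rule order.trans[OF norm_triangle_ineq4]) (use \<rho> in \<open>simp add: norm_mult del: of_real_diff\<close>)
        also have "\<dots> \<le> \<bar>\<rho> - y\<bar> * (C0 * G * (S * T)) + \<rho> * (C0 * G * (S * (T / (1 + Y * P))))"
          using \<rho> by (intro add_mono mult_left_mono EA EAB) auto
        also have "\<rho> * (C0 * G * (S * (T / (1 + Y * P)))) = min Y P * r * (C0 * G * (S * (T / (1 + Y * P))))"
          using False yr by (simp add: min_def)
        also have "\<bar>\<rho> - y\<bar> * (C0 * G * (S * T)) + min Y P * r * (C0 * G * (S * (T / (1 + Y * P))))
           \<le> r * \<bar>Y - P\<bar> * (C0 * G * (S * T)) + r * (C0 * G * (S * T))"
          unfolding abs using small' by simp
        finally show ?thesis by (simp add: algebra_simps)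
      qed
    qed
    have Dn: "norm D \<le> C2 / r\<^sup>2 * W"
    proof -
      have "norm D = 1 / (2 * r\<^sup>2) * (norm K * norm (E * (of_real \<rho> * B - of_real y * A)))"
        unfolding D_def norm_mult norm_divide norm_one norm_numeral r2 by simp
      also have "\<dots> \<le> 1 / (2 * r\<^sup>2) * (norm K * (r * (C0 * G * (S * T) * (1 + \<bar>Y - P\<bar>))))"
        by (intro mult_left_mono BA) auto
      also have "\<dots> = 1 / (2 * r) * (norm K * (C0 * G * (S * T) * (1 + \<bar>Y - P\<bar>)))"
        using r by (simp add: power2_eq_square)
      also have "\<dots> \<le> 1 / (2 * r) * (C2 / r * W)"
        using r by (intro mult_left_mono main) auto
      also have "\<dots> \<le> C2 / r\<^sup>2 * W"
        using C2 W0 r by (simp add: power2_eq_square field_simps)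
      finally show ?thesis .
    qed
    \<comment> \<open>Division by y = r Y costs at most 1 / (r m1), that is, one power of the
      minimum and one factor |z|^{-1/2}.\<close>
    define m1 where "m1 = min Y 1"
    have m1: "0 < m1" "m1 \<le> 1" "m1 \<le> Y" using YP by (auto simp: m1_def)
    define V where "V = m1 powr (a - 1) * min P 1 powr \<beta> * exp (- (\<sigma> / 8 * (Y - P)\<^sup>2))"
    have V0: "V \<ge> 0" by (simp add: V_def)
    have WV: "W = m1 * V"
      using m1 powr_add[of m1 1 "a - 1"] unfolding W_def V_def m1_def[symmetric] by simp
    have pV: "norm (bessel_kernel \<nu> a \<beta> z y \<rho>) / y \<le> C2 / r\<^sup>2 * V"
    proof -
      have "norm (bessel_kernel \<nu> a \<beta> z y \<rho>) / y \<le> (C2 / r * W) / y"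
        using y by (intro divide_right_mono p1) auto
      also have "\<dots> = C2 / r\<^sup>2 * V * (m1 / Y)" using r YP unfolding WV yr by (simp add: power2_eq_square mult_ac)
      also have "\<dots> \<le> C2 / r\<^sup>2 * V * 1" using m1 YP C2 V0 by (intro mult_left_mono) auto
      finally show ?thesis by simp
    qed
    have "norm (of_real (a / y) * bessel_kernel \<nu> a \<beta> z y \<rho> + D) \<le> \<bar>a\<bar> * (norm (bessel_kernel \<nu> a \<beta> z y \<rho>) / y) + norm D"
      by (rule order.trans[OF norm_triangle_ineq]) (use y in \<open>simp add: norm_mult norm_divide\<close>)
    also have "\<dots> \<le> \<bar>a\<bar> * (C2 / r\<^sup>2 * V) + C2 / r\<^sup>2 * V"
    proof (intro add_mono mult_left_mono pV)
      have "C2 / r\<^sup>2 * W \<le> C2 / r\<^sup>2 * V"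
        unfolding WV using m1 V0 C2 by (intro mult_left_mono) (auto simp: mult_left_le_one_le)
      thus "norm D \<le> C2 / r\<^sup>2 * V" using Dn by simp
    qed auto
    finally have "norm (bessel_kernel \<nu> a \<beta> z y \<rho>) / y + norm (vector_derivative (\<lambda>x. bessel_kernel \<nu> a \<beta> z x \<rho>) (at y))
       \<le> C2 / r\<^sup>2 * V + (\<bar>a\<bar> * (C2 / r\<^sup>2 * V) + C2 / r\<^sup>2 * V)"
      unfolding der using pV by linarith
    also have "\<dots> = C / r\<^sup>2 * V" by (simp add: C_def algebra_simps add_divide_distrib)
    finally have goal2: "norm (bessel_kernel \<nu> a \<beta> z y \<rho>) / y + norm (vector_derivative (\<lambda>x. bessel_kernel \<nu> a \<beta> z x \<rho>) (at y))
       \<le> C / r\<^sup>2 * V" .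
    have rm1: "norm z powr (- 1) = 1 / r\<^sup>2" using z by (simp add: powr_minus_divide r2)
    show "norm (bessel_kernel \<nu> a \<beta> z y \<rho>) / y +
       norm (vector_derivative (\<lambda>x. bessel_kernel \<nu> a \<beta> z x \<rho>) (at y)) \<le> kernel_bound C (8 / \<sigma>) (- 1) (a - 1) \<beta> z y \<rho>"
      unfolding kernel_bound_def rm1 ex r_def[symmetric] Y_def[symmetric] P_def[symmetric] m1_def[symmetric]
      using goal2 by (simp add: V_def mult_ac)
  qed
qed

subsection \<open>The spaces $L^p_m$\<close>

text \<open>The \<open>p\<close>-th power of the norm. Only convergence to \<open>0\<close> matters below, for which
  \<open>\<bar>x + y\<bar>\<^sup>p \<le> 2\<^sup>p (\<bar>x\<bar>\<^sup>p + \<bar>y\<bar>\<^sup>p)\<close> replaces Minkowski's inequality.\<close>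

definition Lp_mass :: "real \<Rightarrow> real \<Rightarrow> (real \<Rightarrow> complex) \<Rightarrow> real" where
  "Lp_mass m p f = (LINT y|half_line. y powr m * norm (f y) powr p)"

lemma borel_measurable_half_line_id [measurable]: "(\<lambda>y. y) \<in> borel_measurable half_line"
  by (rule continuous_imp_measurable_on_sets_lebesgue) auto

lemma borel_measurable_half_line_powr [measurable]:
  "(\<lambda>y. y powr m) \<in> borel_measurable half_line"
  by (rule continuous_imp_measurable_on_sets_lebesgue) (auto intro!: continuous_intros)

lemma borel_measurable_weight_measure: "borel_measurable (weight_measure m) = borel_measurable half_line"
  unfolding weight_measure_def by (rule measurable_cong_sets) auto

lemma Lp_space_iff:
  "f \<in> Lp_space m p \<longleftrightarrow> f \<in> borel_measurable half_line \<and>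
     integrable half_line (\<lambda>y. y powr m * norm (f y) powr p)"
proof -
  have "integrable (weight_measure m) (\<lambda>y. norm (f y) powr p) \<longleftrightarrow> integrable half_line (\<lambda>y. y powr m * norm (f y) powr p)"
    if [measurable]: "f \<in> borel_measurable half_line"
    unfolding weight_measure_def by (subst integrable_density) auto
  thus ?thesis by (auto simp: Lp_space_def borel_measurable_weight_measure)
qed

lemma Lp_space_measurable: "f \<in> Lp_space m p \<Longrightarrow> f \<in> borel_measurable half_line"
  by (simp add: Lp_space_iff)

lemma Lp_norm_eq:
  assumes [measurable]: "f \<in> borel_measurable half_line"
  shows "Lp_norm m p f = Lp_mass m p f powr (1 / p)"
  unfolding Lp_norm_def Lp_mass_def weight_measure_def
  by (subst integral_density) auto

lemma Lp_mass_nonneg: "Lp_mass m p f \<ge> 0"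
  unfolding Lp_mass_def by (rule integral_nonneg_AE) auto

lemma Lp_norm_tendsto_0_iff:
  assumes "p > 0" "\<forall>\<^sub>F x in F. f x \<in> borel_measurable half_line"
  shows "((\<lambda>x. Lp_norm m p (f x)) \<longlongrightarrow> 0) F \<longleftrightarrow> ((\<lambda>x. Lp_mass m p (f x)) \<longlongrightarrow> 0) F"
proof -
  have "((\<lambda>x. Lp_norm m p (f x)) \<longlongrightarrow> 0) F \<longleftrightarrow> ((\<lambda>x. Lp_mass m p (f x) powr (1 / p)) \<longlongrightarrow> 0) F"
    by (rule tendsto_cong) (use assms(2) in eventually_elim, simp add: Lp_norm_eq)
  also have "\<dots> \<longleftrightarrow> ((\<lambda>x. Lp_mass m p (f x)) \<longlongrightarrow> 0) F"
  proof
    assume "((\<lambda>x. Lp_mass m p (f x) powr (1 / p)) \<longlongrightarrow> 0) F"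
    hence "((\<lambda>x. (Lp_mass m p (f x) powr (1 / p)) powr p) \<longlongrightarrow> 0) F"
      by (rule tendsto_zero_powrI[where g="\<lambda>_. p" and b=p]) (use assms(1) in auto)
    thus "((\<lambda>x. Lp_mass m p (f x)) \<longlongrightarrow> 0) F"
      using assms(1) Lp_mass_nonneg by (simp add: powr_powr)
  next
    assume "((\<lambda>x. Lp_mass m p (f x)) \<longlongrightarrow> 0) F"
    thus "((\<lambda>x. Lp_mass m p (f x) powr (1 / p)) \<longlongrightarrow> 0) F"
      by (rule tendsto_zero_powrI[where g="\<lambda>_. 1/p" and b="1/p"]) (use assms(1) Lp_mass_nonneg in auto)
  qed
  finally show ?thesis .
qed

lemma norm_add_powr_le:
  fixes x y :: "'a::real_normed_vector"
  assumes "p > 0"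
  shows "norm (x + y) powr p \<le> 2 powr p * (norm x powr p + norm y powr p)"
proof -
  have "norm (x + y) \<le> 2 * max (norm x) (norm y)"
    by (rule order.trans[OF norm_triangle_ineq]) simp
  hence "norm (x + y) powr p \<le> (2 * max (norm x) (norm y)) powr p"
    using assms by (intro powr_mono2) auto
  also have "\<dots> = 2 powr p * max (norm x) (norm y) powr p" by (rule powr_mult)
  also have "max (norm x) (norm y) powr p \<le> norm x powr p + norm y powr p"
    by (cases "norm x \<le> norm y") auto
  finally show ?thesis by simp
qed

lemma Lp_space_dominated:
  assumes "f \<in> borel_measurable half_line" "p > 0" "g \<in> Lp_space m p" "AE y in half_line. norm (f y) \<le> norm (g y)"
  shows "f \<in> Lp_space m p" "Lp_mass m p f \<le> Lp_mass m p g"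
proof -
  have [measurable]: "f \<in> borel_measurable half_line" by fact
  have g: "integrable half_line (\<lambda>y. y powr m * norm (g y) powr p)"
    using assms by (simp add: Lp_space_iff)
  have le: "AE y in half_line. norm (y powr m * norm (f y) powr p) \<le> norm (y powr m * norm (g y) powr p)"
    using assms(4) by eventually_elim (use assms(2) in \<open>auto simp: abs_mult intro!: mult_left_mono powr_mono2\<close>)
  have f: "integrable half_line (\<lambda>y. y powr m * norm (f y) powr p)"
    by (rule Bochner_Integration.integrable_bound[OF g _ le]) measurable
  thus "f \<in> Lp_space m p" by (simp add: Lp_space_iff)
  show "Lp_mass m p f \<le> Lp_mass m p g"
    unfolding Lp_mass_def using le by (intro integral_mono_AE f g) (auto simp: abs_mult)
qed

lemma Lp_space_add:
  assumes "f \<in> Lp_space m p" "g \<in> Lp_space m p" "p > 0"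
  shows "(\<lambda>y. f y + g y) \<in> Lp_space m p"
    and "Lp_mass m p (\<lambda>y. f y + g y) \<le> 2 powr p * (Lp_mass m p f + Lp_mass m p g)"
proof -
  have [measurable]: "f \<in> borel_measurable half_line" "g \<in> borel_measurable half_line"
    using assms by (auto simp: Lp_space_iff)
  have i: "integrable half_line (\<lambda>y. y powr m * norm (f y) powr p)" "integrable half_line (\<lambda>y. y powr m * norm (g y) powr p)"
    using assms by (auto simp: Lp_space_iff)
  let ?h = "\<lambda>y. 2 powr p * (y powr m * norm (f y) powr p + y powr m * norm (g y) powr p)"
  have h: "integrable half_line ?h" using i by (intro integrable_mult_right Bochner_Integration.integrable_add)
  have le: "y powr m * norm (f y + g y) powr p \<le> ?h y" for y
    using mult_left_mono[OF norm_add_powr_le[OF assms(3), of "f y" "g y"], of "y powr m"] by (simp add: algebra_simps)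
  have fg: "integrable half_line (\<lambda>y. y powr m * norm (f y + g y) powr p)"
  proof (rule Bochner_Integration.integrable_bound[OF h])
    show "AE y in half_line. norm (y powr m * norm (f y + g y) powr p) \<le> norm (?h y)"
      using le by (auto simp: abs_mult)
  qed measurable
  thus "(\<lambda>y. f y + g y) \<in> Lp_space m p" by (simp add: Lp_space_iff)
  have "Lp_mass m p (\<lambda>y. f y + g y) \<le> integral\<^sup>L half_line ?h"
    unfolding Lp_mass_def by (intro integral_mono fg h le)
  also have "\<dots> = 2 powr p * (Lp_mass m p f + Lp_mass m p g)"
    using i by (simp add: Lp_mass_def)
  finally show "Lp_mass m p (\<lambda>y. f y + g y) \<le> 2 powr p * (Lp_mass m p f + Lp_mass m p g)" .
qed

lemma Lp_space_cmult:
  assumes "f \<in> Lp_space m p"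
  shows "(\<lambda>y. c * f y) \<in> Lp_space m p"
    and "Lp_mass m p (\<lambda>y. c * f y) = norm c powr p * Lp_mass m p f"
proof -
  have e: "y powr m * norm (c * f y) powr p = norm c powr p * (y powr m * norm (f y) powr p)" for y
    by (simp add: norm_mult powr_mult)
  show "(\<lambda>y. c * f y) \<in> Lp_space m p" 
    using assms unfolding Lp_space_iff e by (auto intro!: borel_measurable_times)
  show "Lp_mass m p (\<lambda>y. c * f y) = norm c powr p * Lp_mass m p f"
    unfolding Lp_mass_def e by simp
qed

lemma Lp_space_diff:
  assumes "f \<in> Lp_space m p" "g \<in> Lp_space m p" "p > 0"
  shows "(\<lambda>y. f y - g y) \<in> Lp_space m p"
    and "Lp_mass m p (\<lambda>y. f y - g y) \<le> 2 powr p * (Lp_mass m p f + Lp_mass m p g)"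
  using Lp_space_add[OF assms(1) Lp_space_cmult(1)[OF assms(2), of "-1"] assms(3)]
    Lp_space_cmult(2)[OF assms(2), of "-1"] by simp_all

lemma Lp_space_0: "(\<lambda>y. 0) \<in> Lp_space m p"
  by (simp add: Lp_space_iff)

lemma Lp_mass_cong_AE:
  assumes "f \<in> borel_measurable half_line" "g \<in> borel_measurable half_line" "AE y in half_line. f y = g y"
  shows "Lp_mass m p f = Lp_mass m p g"
proof -
  have [measurable]: "f \<in> borel_measurable half_line" "g \<in> borel_measurable half_line" by fact+
  show ?thesis unfolding Lp_mass_def
    by (rule integral_cong_AE) (measurable, use assms(3) in \<open>eventually_elim, simp\<close>)
qed

lemma Lp_dominated_convergence:
  assumes "p > 0" "g \<in> Lp_space m p" "\<And>n::nat. f n \<in> borel_measurable half_line" "f' \<in> borel_measurable half_line"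
    "\<And>n. AE y in half_line. norm (f n y) \<le> norm (g y)"
    "AE y in half_line. (\<lambda>n. f n y) \<longlonglongrightarrow> f' y"
  shows "\<And>n. f n \<in> Lp_space m p" "f' \<in> Lp_space m p" "(\<lambda>n. Lp_mass m p (\<lambda>y. f n y - f' y)) \<longlonglongrightarrow> 0"
proof -
  have [measurable]: "f n \<in> borel_measurable half_line" "f' \<in> borel_measurable half_line" for n by fact+
  show fn: "f n \<in> Lp_space m p" for n
    by (rule Lp_space_dominated[OF assms(3,1,2,5)])
  have "AE y in half_line. \<forall>n. norm (f n y) \<le> norm (g y)"
    using assms(5) by (simp add: AE_all_countable)
  with assms(6) have le': "AE y in half_line. norm (f' y) \<le> norm (g y)"
  proof eventually_elim
    case (elim y)
    thus ?case by (intro Lim_bounded[OF tendsto_norm[OF elim(1)], of 0]) auto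
  qed
  show f': "f' \<in> Lp_space m p"
    by (rule Lp_space_dominated[OF assms(4,1,2) le'])
  have g: "integrable half_line (\<lambda>y. y powr m * norm (g y) powr p)" using assms(2) by (simp add: Lp_space_iff)
  have "(\<lambda>n. LINT y|half_line. y powr m * norm (f n y - f' y) powr p) \<longlonglongrightarrow> (LINT y|half_line. 0)"
  proof (rule integral_dominated_convergence)
    \<comment> \<open>Both functions in the difference are at most |g|, whence the factor 2
      inside.\<close>
    show "integrable half_line (\<lambda>y. 2 powr p * (2 * (y powr m * norm (g y) powr p)))"
      using g by (intro integrable_mult_right)
    show "AE y in half_line. (\<lambda>n. y powr m * norm (f n y - f' y) powr p) \<longlonglongrightarrow> 0"
      using assms(6)
    proof eventually_elim
      case (elim y)
      have "(\<lambda>n. norm (f n y - f' y)) \<longlonglongrightarrow> 0"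
        using elim by (simp add: LIM_zero_iff tendsto_norm_zero)
      hence "(\<lambda>n. norm (f n y - f' y) powr p) \<longlonglongrightarrow> 0"
        by (rule tendsto_zero_powrI[where g="\<lambda>_. p" and b=p]) (use assms(1) in auto)
      from tendsto_mult_left[OF this, of "y powr m"] show ?case by simp
    qed
    show "AE y in half_line. norm (y powr m * norm (f n y - f' y) powr p) \<le> 2 powr p * (2 * (y powr m * norm (g y) powr p))" for n
      using assms(5)[of n] le'
    proof eventually_elim
      case (elim y)
      have "norm (f n y + - f' y) powr p \<le> 2 powr p * (norm (f n y) powr p + norm (- f' y) powr p)"
        by (rule norm_add_powr_le[OF assms(1)])
      also have "\<dots> \<le> 2 powr p * (norm (g y) powr p + norm (g y) powr p)"
        using elim assms(1) by (intro mult_left_mono add_mono powr_mono2) auto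
      finally have "y powr m * norm (f n y - f' y) powr p \<le> y powr m * (2 powr p * (norm (g y) powr p + norm (g y) powr p))"
        by (intro mult_left_mono) auto
      thus ?case by (simp add: abs_mult algebra_simps)
    qed
  qed measurable
  thus "(\<lambda>n. Lp_mass m p (\<lambda>y. f n y - f' y)) \<longlonglongrightarrow> 0" by (simp add: Lp_mass_def)
qed

text \<open>Optimizing over \<open>t\<close> would give Hoelder's inequality.\<close>

lemma dual_weight_integrable:
  assumes pq: "1 < p" "1 < q" "1 / p + 1 / q = 1"
    and k: "k \<in> borel_measurable half_line" "integrable half_line (\<lambda>y. (norm (k y :: complex) * y powr (- m / p)) powr q)"
    and f: "f \<in> Lp_space m p"
  shows "integrable half_line (\<lambda>y. k y * f y)"
    and "t > 0 \<Longrightarrow> (LINT y|half_line. norm (k y * f y)) \<le>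
      t * (LINT y|half_line. (norm (k y) * y powr (- m / p)) powr q) + t powr (1 - p) * Lp_mass m p f"
proof -
  have [measurable]: "k \<in> borel_measurable half_line" "f \<in> borel_measurable half_line"
    using k f by (auto simp: Lp_space_iff)
  have fi: "integrable half_line (\<lambda>y. y powr m * norm (f y) powr p)" using f by (simp add: Lp_space_iff)
  have le: "norm (k y * f y) \<le> t * (norm (k y) * y powr (- m / p)) powr q + t powr (1 - p) * (y powr m * norm (f y) powr p)"
    if "y > 0" "t > 0" for y t
  proof -
    \<comment> \<open>The weight is distributed so that the p-th power of the second factor carries
      exactly y^m. Young's inequality is applied with t moved between the factors, which leaves t in
      front of the dual term and t^{1-p} in front of the mass.\<close>
    let ?a = "norm (k y) * y powr (- m / p)" and ?b = "y powr (m / p) * norm (f y) / t"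
    have "?a * ?b \<le> ?a powr p' / p' + ?b powr p / p" if "p' = q" for p'
      using Youngs_inequality[of q p ?a ?b] pq that \<open>t > 0\<close> by (simp add: add.commute)
    hence "?a * ?b \<le> ?a powr q / q + ?b powr p / p" by blast
    also have "\<dots> \<le> ?a powr q + ?b powr p"
    proof -
      have "x / r \<le> x" if "x \<ge> 0" "r > 1" for x r :: real
        using that mult_left_mono[of 1 r x] by (simp add: divide_le_eq)
      thus ?thesis using pq by (intro add_mono) (simp_all only: powr_ge_zero)
    qed
    finally have "t * (?a * ?b) \<le> t * (?a powr q + ?b powr p)" using that by (intro mult_left_mono) auto
    moreover have "t * (?a * ?b) = norm (k y * f y)"
      using that by (simp add: norm_mult powr_minus_divide)
    moreover have "t * ?b powr p = t powr (1 - p) * (y powr m * norm (f y) powr p)"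
      using that pq by (simp add: powr_divide powr_mult powr_powr powr_diff)
    ultimately show ?thesis by (simp add: distrib_left)
  qed
  have r: "integrable half_line (\<lambda>y. t * (norm (k y) * y powr (- m / p)) powr q + t powr (1 - p) * (y powr m * norm (f y) powr p))" for t
    using k(2) fi by (intro Bochner_Integration.integrable_add integrable_mult_right)
  show i: "integrable half_line (\<lambda>y. k y * f y)"
    by (rule measurable_bounded_by_integrable_imp_lebesgue_integrable[OF _ r[of 1]])
      (use le[of _ 1] in auto)
  show "(LINT y|half_line. norm (k y * f y)) \<le>
      t * (LINT y|half_line. (norm (k y) * y powr (- m / p)) powr q) + t powr (1 - p) * Lp_mass m p f" if t: "t > 0"
  proof -
    have "(LINT y|half_line. norm (k y * f y)) \<le> (LINT y|half_line. t * (norm (k y) * y powr (- m / p)) powr q + t powr (1 - p) * (y powr m * norm (f y) powr p))"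
      by (rule integral_mono[OF integrable_norm[OF i] r]) (use le t in auto)
    also have "\<dots> = t * (LINT y|half_line. (norm (k y) * y powr (- m / p)) powr q) + t powr (1 - p) * Lp_mass m p f"
      unfolding Lp_mass_def using k(2) fi by simp
    finally show ?thesis .
  qed
qed

text \<open>First t is fixed so that the dual term is at most e / 2; then the mass, whose
  coefficient t^{1-p} is now fixed, tends to 0.\<close>

lemma dual_weight_tendsto_0:
  assumes pq: "1 < p" "1 < q" "1 / p + 1 / q = 1"
    and k: "k \<in> borel_measurable half_line" "integrable half_line (\<lambda>y. (norm (k y :: complex) * y powr (- m / p)) powr q)"
    and f: "\<forall>\<^sub>F x in F. f x \<in> Lp_space m p" "((\<lambda>x. Lp_mass m p (f x)) \<longlongrightarrow> 0) F"
  shows "((\<lambda>x. LINT y|half_line. k y * f x y) \<longlongrightarrow> 0) F"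
proof (rule tendsto_norm_zero_cancel, rule tendstoI)
  fix e :: real assume e: "e > 0"
  define B where "B = (LINT y|half_line. (norm (k y) * y powr (- m / p)) powr q)"
  have B: "B \<ge> 0" unfolding B_def by (rule integral_nonneg_AE) auto
  \<comment> \<open>B + 1 instead of B, since the dual integral may be 0.\<close>
  define t where "t = e / (2 * (B + 1))"
  have t: "t > 0" using e B by (simp add: t_def)
  have tB: "t * B \<le> e / 2" using e B by (simp add: t_def field_simps)
  have "\<forall>\<^sub>F x in F. Lp_mass m p (f x) < e / 2 / t powr (1 - p)"
    using f(2) e t by (intro order_tendstoD(2)[where y=0]) auto
  with f(1) show "\<forall>\<^sub>F x in F. dist (norm (LINT y|half_line. k y * f x y)) 0 < e"
  proof eventually_elim
    case (elim x)
    have "norm (LINT y|half_line. k y * f x y) \<le> (LINT y|half_line. norm (k y * f x y))" by (rule integral_norm_bound)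
    also have "\<dots> \<le> t * B + t powr (1 - p) * Lp_mass m p (f x)"
      unfolding B_def by (rule dual_weight_integrable(2)[OF pq k elim(1) t])
    also have "t powr (1 - p) * Lp_mass m p (f x) < e / 2" using elim(2) t by (simp add: field_simps)
    finally show ?case using tB by simp
  qed
qed

text \<open>On an interval away from 0 and infinity every power weight is bounded. Integration over
  such an interval is therefore continuous on each of the spaces, whatever m and p.\<close>

lemma indicator_dual_weight:
  assumes "0 < l" "l < u"
  shows "(indicator {l<..<u} :: real \<Rightarrow> complex) \<in> borel_measurable half_line"
    and "integrable half_line (\<lambda>y. (norm (indicator {l<..<u} y :: complex) * y powr r) powr q)"
proof -
  have m: "{l<..<u} \<in> sets half_line" using assms by (auto simp: sets_restrict_space intro!: image_eqI[of _ _ "{l<..<u}"])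
  show ind: "(indicator {l<..<u} :: real \<Rightarrow> complex) \<in> borel_measurable half_line"
    by (rule borel_measurable_indicator[OF m])
  have c: "continuous_on {l..u} (\<lambda>y. (y powr r) powr q)"
    using assms by (auto intro!: continuous_intros)
  have "compact ((\<lambda>y. (y powr r) powr q) ` {l..u})" by (rule compact_continuous_image[OF c]) auto
  then have "bounded ((\<lambda>y. (y powr r) powr q) ` {l..u})" by (rule compact_imp_bounded)
  then obtain B where B: "\<And>y. y \<in> {l..u} \<Longrightarrow> norm ((y powr r) powr q) \<le> B"
    by (auto simp only: bounded_iff ball_simps)
  have "emeasure lebesgue {l<..<u} < \<infinity>" using assms by simp
  hence "emeasure half_line {l<..<u} < \<infinity>"
    using assms by (subst emeasure_restrict_space) auto
  hence i: "integrable half_line (\<lambda>y. B * indicator {l<..<u} y)"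
    using m by (intro integrable_mult_right integrable_real_indicator) auto
  show "integrable half_line (\<lambda>y. (norm (indicator {l<..<u} y :: complex) * y powr r) powr q)"
  proof (rule measurable_bounded_by_integrable_imp_lebesgue_integrable[OF _ i])
    show "(\<lambda>y. (norm (indicator {l<..<u} y :: complex) * y powr r) powr q) \<in> borel_measurable half_line"
      using ind by measurable
    show "norm ((norm (indicator {l<..<u} y :: complex) * y powr r) powr q) \<le> B * indicator {l<..<u} y" for y
      using B[of y] by (auto simp: indicator_def)
  qed auto
qed

lemma Lp_interval_integrable:
  assumes "1 < p" "f \<in> Lp_space m p" "0 < l" "l < u"
  shows "integrable half_line (\<lambda>y. indicator {l<..<u} y * f y)"
  by (rule dual_weight_integrable(1)[of p "p / (p - 1)", OF _ _ _ indicator_dual_weight[OF assms(3,4)] assms(2)])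
     (use assms(1) in \<open>auto simp: field_simps\<close>)

lemma Lp_interval_tendsto_0:
  assumes "1 < p" "0 < l" "l < u" "\<forall>\<^sub>F x in F. f x \<in> Lp_space m p" "((\<lambda>x. Lp_mass m p (f x)) \<longlongrightarrow> 0) F"
  shows "((\<lambda>x. LINT y|half_line. indicator {l<..<u} y * f x y) \<longlongrightarrow> 0) F"
  by (rule dual_weight_tendsto_0[of p "p / (p - 1)", OF _ _ _ indicator_dual_weight[OF assms(2,3)] assms(4,5)])
     (use assms(1) in \<open>auto simp: field_simps\<close>)

section \<open>From integrals over intervals to equality almost everywhere\<close>

lemma sigma_sets_open_intervals:
  "sigma_sets UNIV (range (\<lambda>(a::real, b). {a<..<b})) = sets borel"
  using arg_cong[OF borel_eq_box[where 'a=real], of sets] by (simp add: box_real sets_measure_of)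

text \<open>Dynkin's theorem for the open intervals, a generator stable under intersection. It
  serves two purposes: vanishing of integrals below, and density of the Gaussians at the
  end.\<close>

lemma borel_open_interval_induct [consumes 1, case_names interval empty compl union]:
  fixes A :: "real set"
  assumes "A \<in> sets borel" "\<And>a b. P {a<..<b}" "P {}"
    "\<And>A. A \<in> sets borel \<Longrightarrow> P A \<Longrightarrow> P (UNIV - A)"
    "\<And>A. disjoint_family A \<Longrightarrow> (\<And>i::nat. A i \<in> sets borel) \<Longrightarrow> (\<And>i. P (A i)) \<Longrightarrow> P (\<Union>i. A i)"
  shows "P A"
proof -
  have ist: "Int_stable (range (\<lambda>(a::real, b). {a<..<b}))"
  proof (rule Int_stableI, safe)
    fix a b c d :: real
    show "{a<..<b} \<inter> {c<..<d} \<in> range (\<lambda>(a, b). {a<..<b})"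
      by (rule image_eqI[of _ _ "(max a c, min b d)"]) auto
  qed
  have A: "A \<in> sigma_sets UNIV (range (\<lambda>(a, b). {a<..<b}))"
    using assms(1) by (simp only: sigma_sets_open_intervals)
  show ?thesis
    using ist Pow_UNIV[THEN equalityD2, THEN subset_trans[OF subset_UNIV]] A
  proof (induction rule: sigma_sets_induct_disjoint)
    case (basic A)
    then obtain a b where "A = {a<..<b}" by auto
    thus ?case using assms(2) by simp
  next
    case (compl A)
    thus ?case unfolding sigma_sets_open_intervals by (rule assms(4))
  next
    case (union A)
    have "A i \<in> sets borel" for i using union(2) unfolding sigma_sets_open_intervals by blast
    thus ?case by (rule assms(5)[OF union(1) _ union(3)])
  qed (rule assms(3))
qed

text \<open>The Borel sets over which f has integral 0 form a Dynkin system; the assumption on the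
  whole line gives closure under complements.\<close>

lemma AE_zero_of_interval_integrals_UNIV:
  fixes f :: "real \<Rightarrow> complex"
  assumes f: "integrable lborel f" and z: "\<And>l u. l < u \<Longrightarrow> (LINT y:{l<..<u}|lborel. f y) = 0"
    and z0: "(LINT y|lborel. f y) = 0"
  shows "AE y in lborel. f y = 0"
proof (rule sigma_finite_measure.density_zero[OF sigma_finite_lborel f])
  have si: "set_integrable lborel A f" if "A \<in> sets borel" for A
    using integrable_mult_indicator[of A lborel f] f that by (simp add: set_integrable_def)
  fix A :: "real set" assume "A \<in> sets lborel"
  hence "A \<in> sets borel" by simp
  thus "(LINT y:A|lborel. f y) = 0"
  proof (induction rule: borel_open_interval_induct)
    case (interval a b)
    show ?case using z[of a b] by (cases "a < b") (auto simp: set_lebesgue_integral_def)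
  next
    case empty
    show ?case by (simp add: set_lebesgue_integral_def)
  next
    case (compl A)
    have "(LINT y:A \<union> (UNIV - A)|lborel. f y) = (LINT y:A|lborel. f y) + (LINT y:UNIV - A|lborel. f y)"
      by (rule set_integral_Un) (use compl(1) in \<open>auto intro: si\<close>)
    moreover have "(LINT y:A \<union> (UNIV - A)|lborel. f y) = 0"
      using z0 by (simp add: set_lebesgue_integral_def)
    ultimately show ?case using compl(2) by simp
  next
    case (union A)
    have "(LINT y:(\<Union>i. A i)|lborel. f y) = (\<Sum>i. (LINT y:A i|lborel. f y))"
    proof (rule lebesgue_integral_countable_add)
      show "A i \<in> sets lborel" for i using union(2) by simp
      show "A i \<inter> A j = {}" if "i \<noteq> j" for i j
        using union(1) that by (auto simp: disjoint_family_on_def)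
      show "set_integrable lborel (\<Union>i. A i) f" by (rule si) (use union(2) in auto)
    qed
    thus ?case using union(3) by simp
  qed
qed

text \<open>The Dynkin argument only reaches Borel sets, so Lebesgue measurable functions are first
  replaced by Borel measurable ones; real and imaginary parts are treated separately.\<close>

lemma completion_ex_borel_measurable_complex:
  fixes f :: "'a \<Rightarrow> complex"
  assumes "f \<in> borel_measurable (completion M)"
  obtains g where "g \<in> borel_measurable M" "AE x in M. f x = g x"
proof -
  have "(\<lambda>x. Re (f x)) \<in> borel_measurable (completion M)" "(\<lambda>x. Im (f x)) \<in> borel_measurable (completion M)"
    using assms by auto
  then obtain g h where g: "g \<in> borel_measurable M" "AE x in M. Re (f x) = g x"
    and h: "h \<in> borel_measurable M" "AE x in M. Im (f x) = h x"
    using completion_ex_borel_measurable_real by metis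
  have "AE x in M. f x = Complex (g x) (h x)"
    using g(2) h(2) by eventually_elim (simp add: complex_eq_iff)
  moreover have "(\<lambda>x. Complex (g x) (h x)) \<in> borel_measurable M"
    unfolding Complex_eq using g(1) h(1) by measurable
  ultimately show ?thesis using that by blast
qed

text \<open>Local form for functions that need not be integrable near 0 or at infinity. Cut off to
  (l, u), f has a Borel representative g whose integral over any interval is an integral of f over a
  subinterval of (l, u); countably many (l, u) exhaust the half-line.\<close>

lemma AE_zero_of_interval_integrals:
  fixes f :: "real \<Rightarrow> complex"
  assumes f: "\<And>l u. 0 < l \<Longrightarrow> l < u \<Longrightarrow> integrable half_line (\<lambda>y. indicator {l<..<u} y * f y)"
    and z: "\<And>l u. 0 < l \<Longrightarrow> l < u \<Longrightarrow> (LINT y|half_line. indicator {l<..<u} y * f y) = 0"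
  shows "AE y in half_line. f y = 0"
proof -
  have conv: "integrable half_line (\<lambda>y. indicator {l<..<u} y * f y) \<longleftrightarrow> integrable lebesgue (\<lambda>y. indicator {l<..<u} y * f y)"
     "(LINT y|half_line. indicator {l<..<u} y * f y) = (LINT y|lebesgue. indicator {l<..<u} y * f y)" if "0 < l" for l u
  proof -
    have e: "indicat_real {0<..} y *\<^sub>R (indicator {l<..<u} y * f y) = indicator {l<..<u} y * f y" for y
      using that by (auto simp: indicator_def)
    show "integrable half_line (\<lambda>y. indicator {l<..<u} y * f y) \<longleftrightarrow> integrable lebesgue (\<lambda>y. indicator {l<..<u} y * f y)"
      "(LINT y|half_line. indicator {l<..<u} y * f y) = (LINT y|lebesgue. indicator {l<..<u} y * f y)"
      by (simp_all add: integrable_restrict_space integral_restrict_space e)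
  qed
  have main: "AE y in lebesgue. y \<in> {l<..<u} \<longrightarrow> f y = 0" if lu: "0 < l" "l < u" for l u
  proof -
    let ?F = "\<lambda>y. indicator {l<..<u} y * f y"
    have i: "integrable lebesgue ?F" using f[OF lu] conv(1)[OF lu(1)] by simp
    then have "?F \<in> borel_measurable lebesgue" by auto
    then obtain g where g: "g \<in> borel_measurable lborel" "AE y in lborel. ?F y = g y"
      by (rule completion_ex_borel_measurable_complex)
    have gc: "AE y in lebesgue. ?F y = g y" using g(2) by (rule AE_completion)
    have gm: "g \<in> borel_measurable lebesgue" using g(1) by (rule measurable_completion)
    have "integrable lebesgue g"
      using i gc gm integrable_cong_AE[of ?F lebesgue g] by (auto dest: borel_measurable_integrable)
    hence gi: "integrable lborel g" using g(1) by (simp add: integrable_completion)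
    have gint: "(LINT y:{a<..<b}|lborel. g y) = 0" for a b
    proof -
      have "(LINT y:{a<..<b}|lborel. g y) = (LINT y|lebesgue. indicat_real {a<..<b} y *\<^sub>R g y)"
        unfolding set_lebesgue_integral_def using g(1) by (subst integral_completion) auto
      also have "\<dots> = (LINT y|lebesgue. indicator {max a l<..<min b u} y * f y)"
      proof (rule integral_cong_AE)
        have [measurable]: "g \<in> borel_measurable lebesgue" "?F \<in> borel_measurable lebesgue"
          using gm i by auto
        show "(\<lambda>y. indicat_real {a<..<b} y *\<^sub>R g y) \<in> borel_measurable lebesgue"
          by (intro borel_measurable_scaleR borel_measurable_indicator) auto
        have e: "indicator {max a l<..<min b u} y * f y = indicat_real {a<..<b} y *\<^sub>R ?F y" for y
          by (auto simp: indicator_def)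
        show "(\<lambda>y. indicator {max a l<..<min b u} y * f y) \<in> borel_measurable lebesgue"
          unfolding e by (intro borel_measurable_scaleR borel_measurable_indicator) auto
        show "AE y in lebesgue. indicat_real {a<..<b} y *\<^sub>R g y = indicator {max a l<..<min b u} y * f y"
          unfolding e using gc by eventually_elim simp
      qed
      also have "\<dots> = 0"
        using z[of "max a l" "min b u"] conv(2)[of "max a l" "min b u"] lu
        by (cases "max a l < min b u") auto
      finally show ?thesis .
    qed
    have "(LINT y|lborel. g y) = (LINT y:{l<..<u}|lborel. g y)"
      unfolding set_lebesgue_integral_def
    proof (rule integral_cong_AE)
      show "AE y in lborel. g y = indicat_real {l<..<u} y *\<^sub>R g y"
        using g(2) by eventually_elim (auto simp: indicator_def split: if_splits)
    qed (use g in auto)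
    hence "AE y in lborel. g y = 0"
      by (intro AE_zero_of_interval_integrals_UNIV gi gint) (simp add: gint)
    hence "AE y in lebesgue. g y = 0" by (rule AE_completion)
    with gc show ?thesis by eventually_elim auto
  qed
  \<comment> \<open>The offset 2 makes the lower end smaller than the upper one already for n =
    0.\<close>
  have "AE y in lebesgue. \<forall>n::nat. y \<in> {1 / real (n + 2)<..<real (n + 2)} \<longrightarrow> f y = 0"
    unfolding AE_all_countable by (intro allI main) (auto simp: divide_less_eq intro!: less_1_mult)
  hence "AE y in lebesgue. y \<in> {0<..} \<longrightarrow> f y = 0"
  proof eventually_elim
    case (elim y)
    show ?case
    proof
      assume "y \<in> {0<..}"
      hence y: "y > 0" by simp
      obtain n1 :: nat where n1: "1 / y < real n1" using reals_Archimedean2 by blast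
      obtain n2 :: nat where n2: "y < real n2" using reals_Archimedean2 by blast
      define n where "n = max n1 n2"
      have "1 / y < real (n + 2)" "y < real (n + 2)" using n1 n2 by (auto simp: n_def)
      hence "y \<in> {1 / real (n + 2)<..<real (n + 2)}" using y by (auto simp: field_simps)
      thus "f y = 0" using elim by blast
    qed
  qed
  thus ?thesis by (simp add: AE_restrict_space_iff)
qed

subsection \<open>Weak derivatives and the operator $L$\<close>

text \<open>The standard smooth function that is flat at 0, multiplied by the powers of 1 / x that
  its derivatives bring in.\<close>

definition flat :: "nat \<Rightarrow> real \<Rightarrow> real" where
  "flat k x = (if x > 0 then inverse x ^ k * exp (- inverse x) else 0)"

lemma flat_tendsto_0: "(flat k \<longlongrightarrow> 0) (at_right 0)"
proof -
  have "((\<lambda>t::real. t ^ k / exp t) \<longlongrightarrow> 0) at_top" by (rule tendsto_power_div_exp_0)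
  hence "((\<lambda>x::real. inverse x ^ k / exp (inverse x)) \<longlongrightarrow> 0) (at_right 0)"
    by (rule filterlim_compose) (rule filterlim_inverse_at_top_right)
  thus ?thesis
    by (rule Lim_transform_eventually)
       (auto simp: flat_def eventually_at_filter exp_minus divide_inverse)
qed

lemma flat_tendsto_0_at: "(flat k \<longlongrightarrow> 0) (at 0)"
proof -
  have "(flat k \<longlongrightarrow> 0) (at_left 0)"
    by (rule tendsto_eventually) (auto simp: flat_def eventually_at_filter)
  thus ?thesis using flat_tendsto_0 by (simp add: filterlim_split_at)
qed

lemma flat_deriv: "(flat k has_real_derivative flat (k + 2) x - real k * flat (k + 1) x) (at x)"
proof -
  consider "x > 0" | "x < 0" | "x = 0" by linarith
  thus ?thesis
  proof cases
    case 1
    have "((\<lambda>x. inverse x ^ k * exp (- inverse x)) has_real_derivative flat (k + 2) x - real k * flat (k + 1) x) (at x)"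
    proof (cases k)
      case 0
      show ?thesis using 1 unfolding 0
        by (auto intro!: derivative_eq_intros simp: flat_def power2_eq_square)
    next
      case (Suc n)
      have "inverse x * inverse x ^ (n - Suc 0) = inverse x ^ n" if "n > 0"
        using that by (cases n) auto
      thus ?thesis using 1 unfolding Suc
        by (cases "n = 0") (auto intro!: derivative_eq_intros simp: flat_def power2_eq_square algebra_simps)
    qed
    thus ?thesis
      by (rule has_field_derivative_transform_within_open[where S="{0<..}"]) (use 1 in \<open>auto simp: flat_def\<close>)
  next
    case 2
    have "((\<lambda>x. 0) has_real_derivative 0) (at x)" by simp
    hence "(flat k has_real_derivative 0) (at x)"
      by (rule has_field_derivative_transform_within_open[where S="{..<0}"]) (use 2 in \<open>auto simp: flat_def\<close>)
    thus ?thesis using 2 by (simp add: flat_def)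
  next
    case 3
    \<comment> \<open>At 0 the difference quotient of \<open>flat k\<close> is
      \<open>flat (k + 1)\<close> itself.\<close>
    have "(\<lambda>h. (flat k (0 + h) - flat k 0) / h) = (\<lambda>h. flat (k + 1) h)"
      by (auto simp: flat_def divide_inverse fun_eq_iff)
    hence "(flat k has_real_derivative 0) (at 0)"
      using flat_tendsto_0_at[of "k + 1"] unfolding DERIV_def by simp
    thus ?thesis using 3 by (simp add: flat_def)
  qed
qed

text \<open>A class of functions closed under differentiation, hence consisting of smooth functions.\<close>

inductive flat_generated :: "(real \<Rightarrow> real) \<Rightarrow> bool" where
  flat_const: "flat_generated (\<lambda>x. c)"
| flat_affine: "flat_generated (\<lambda>x. flat k (a * x + b))"
| flat_add: "flat_generated f \<Longrightarrow> flat_generated g \<Longrightarrow> flat_generated (\<lambda>x. f x + g x)"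
| flat_mult: "flat_generated f \<Longrightarrow> flat_generated g \<Longrightarrow> flat_generated (\<lambda>x. f x * g x)"

lemma flat_generated_deriv:
  "flat_generated f \<Longrightarrow> \<exists>f'. flat_generated f' \<and> (\<forall>x. (f has_real_derivative f' x) (at x))"
proof (induction rule: flat_generated.induct)
  case (flat_const c)
  show ?case by (rule exI[of _ "\<lambda>x. 0"]) (auto intro: flat_generated.intros)
next
  case (flat_affine k a b)
  have "((\<lambda>x. flat k (a * x + b)) has_real_derivative (flat (k + 2) (a * x + b) + (- real k) * flat (k + 1) (a * x + b)) * a) (at x)" for x
  proof -
    have "((\<lambda>x. a * x + b) has_real_derivative a) (at x)" by (auto intro!: derivative_eq_intros)
    from DERIV_chain2[where f="flat k" and g="\<lambda>x. a * x + b", OF flat_deriv[of k "a * x + b"] this]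
    show ?thesis by simp
  qed
  moreover have "flat_generated (\<lambda>x. (flat (k + 2) (a * x + b) + (- real k) * flat (k + 1) (a * x + b)) * a)"
    by (intro flat_generated.intros)
  ultimately show ?case by blast
next
  case (flat_add f g)
  then obtain f' g' where "flat_generated f'" "flat_generated g'"
    "\<And>x. (f has_real_derivative f' x) (at x)" "\<And>x. (g has_real_derivative g' x) (at x)" by blast
  thus ?case by (intro exI[of _ "\<lambda>x. f' x + g' x"]) (auto intro!: flat_generated.flat_add DERIV_add)
next
  case (flat_mult f g)
  then obtain f' g' where "flat_generated f'" "flat_generated g'"
    "\<And>x. (f has_real_derivative f' x) (at x)" "\<And>x. (g has_real_derivative g' x) (at x)" by blast
  thus ?case using flat_mult.hyps
    by (intro exI[of _ "\<lambda>x. f' x * g x + g' x * f x"])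
       (auto intro!: flat_generated.flat_add flat_generated.flat_mult DERIV_mult)
qed

lemma flat_generated_iterate: "flat_generated f \<Longrightarrow> flat_generated ((deriv ^^ n) f)"
proof (induction n)
  case (Suc n)
  obtain f' where f': "flat_generated f'" "\<And>x. ((deriv ^^ n) f has_real_derivative f' x) (at x)"
    using flat_generated_deriv[OF Suc.IH[OF Suc.prems]] by blast
  have "deriv ((deriv ^^ n) f) = f'" using f'(2) by (intro ext DERIV_imp_deriv)
  thus ?case using f'(1) by simp
qed simp

text \<open>A smooth function supported in [l, u] that tends to the indicator of (l, u), since
  exp(-1 / (n d)) tends to 1 for d > 0. The arguments are written as affine functions to match the
  rules of \<open>flat_generated\<close>.\<close>

definition bump :: "real \<Rightarrow> real \<Rightarrow> nat \<Rightarrow> real \<Rightarrow> real" where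
  "bump l u n x = flat 0 (real n * x + - (real n * l)) * flat 0 (- real n * x + real n * u)"

lemma flat0_bounds: "0 \<le> flat 0 x" "flat 0 x \<le> 1"
  by (auto simp: flat_def)

lemma bump_eq: "bump l u n x = flat 0 (real n * (x - l)) * flat 0 (real n * (u - x))"
  by (simp add: bump_def algebra_simps)

lemma bump_zero: "x \<notin> {l<..<u} \<Longrightarrow> bump l u n x = 0"
  by (auto simp: bump_eq flat_def mult_le_0_iff zero_less_mult_iff)

lemma bump_bounds: "0 \<le> bump l u n x" "bump l u n x \<le> 1"
  unfolding bump_eq using flat0_bounds by (auto intro!: mult_le_one)

lemma test_function_bump:
  assumes "0 < l" "l < u"
  shows "test_function (bump l u n)"
  unfolding test_function_def
proof (intro conjI allI exI[of _ "{l..u}"])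
  fix k x
  have "flat_generated (bump l u n)"
    unfolding bump_def[abs_def] by (intro flat_generated.intros)
  hence "flat_generated ((deriv ^^ k) (bump l u n))" by (rule flat_generated_iterate)
  thus "(deriv ^^ k) (bump l u n) field_differentiable (at x)"
    using flat_generated_deriv field_differentiable_def by blast
  show "x \<notin> {l..u} \<longrightarrow> bump l u n x = 0" by (auto intro: bump_zero)
qed (use assms in auto)

lemma flat0_scaled_tendsto: "d > 0 \<Longrightarrow> (\<lambda>n. flat 0 (real n * d)) \<longlonglongrightarrow> 1"
proof -
  assume d: "d > 0"
  have "(\<lambda>n. exp (- (inverse (real n) * inverse d))) \<longlonglongrightarrow> exp (- (0 * inverse d))"
    by (intro tendsto_intros lim_inverse_n)
  hence "(\<lambda>n. exp (- (inverse (real n) * inverse d))) \<longlonglongrightarrow> 1" by simp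
  thus ?thesis
    by (rule Lim_transform_eventually)
       (use d in \<open>auto simp: flat_def intro!: eventually_mono[OF eventually_gt_at_top[of 0]]\<close>)
qed

lemma bump_tendsto: "(\<lambda>n. bump l u n x) \<longlonglongrightarrow> indicator {l<..<u} x"
proof (cases "x \<in> {l<..<u}")
  case True
  hence "(\<lambda>n. bump l u n x) \<longlonglongrightarrow> 1 * 1"
    unfolding bump_eq by (intro tendsto_mult flat0_scaled_tendsto) auto
  thus ?thesis using True by simp
qed (simp add: bump_zero)

lemma test_function_continuous:
  assumes "test_function \<phi>"
  shows "continuous_on UNIV \<phi>" "continuous_on UNIV (deriv \<phi>)" "(\<phi> has_real_derivative deriv \<phi> x) (at x)"
proof -
  have d: "(deriv ^^ n) \<phi> field_differentiable (at x)" for n x using assms by (simp add: test_function_def)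
  show "continuous_on UNIV \<phi>" using d[of 0]
    by (auto intro!: continuous_at_imp_continuous_on field_differentiable_imp_continuous_at)
  show "continuous_on UNIV (deriv \<phi>)" using d[of 1]
    by (auto intro!: continuous_at_imp_continuous_on field_differentiable_imp_continuous_at)
  show "(\<phi> has_real_derivative deriv \<phi> x) (at x)" using d[of 0 x] by (simp add: field_differentiable_derivI)
qed

lemma compact_half_line_interval:
  assumes "compact K" "K \<subseteq> {0<..}"
  obtains l u :: real where "0 < l" "l < u" "K \<subseteq> {l<..<u}"
proof (cases "K = {}")
  case False
  obtain m where m: "m \<in> K" "\<And>x. x \<in> K \<Longrightarrow> m \<le> x" using compact_attains_inf[OF assms(1) False] by blast
  obtain M where M: "M \<in> K" "\<And>x. x \<in> K \<Longrightarrow> x \<le> M" using compact_attains_sup[OF assms(1) False] by blast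
  have "m > 0" using m assms by auto
  show ?thesis
  proof (rule that[of "m / 2" "M + 1"])
    show "m / 2 < M + 1" using m(2)[OF M(1)] \<open>m > 0\<close> by simp
    show "K \<subseteq> {m / 2<..<M + 1}" using m(2) M(2) \<open>m > 0\<close> by force
  qed (use \<open>m > 0\<close> in auto)
qed (use that[of 1 2] in auto)

lemma test_function_support:
  assumes "test_function \<phi>"
  obtains l u where "0 < l" "l < u" "\<And>x. x \<notin> {l<..<u} \<Longrightarrow> \<phi> x = 0" "\<And>x. x \<notin> {l<..<u} \<Longrightarrow> deriv \<phi> x = 0"
proof -
  obtain K where K: "compact K" "K \<subseteq> {0<..}" "\<And>x. x \<notin> K \<Longrightarrow> \<phi> x = 0"
    using assms by (auto simp: test_function_def)
  obtain l u where lu: "0 < l" "l < u" "K \<subseteq> {l<..<u}" using compact_half_line_interval[OF K(1,2)] by blast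
  show ?thesis
  proof (rule that[OF lu(1,2)])
    fix x assume x: "x \<notin> {l<..<u}"
    thus "\<phi> x = 0" using K(3) lu(3) by blast
    have "open (- K)" using K(1) by (simp add: compact_imp_closed open_Compl)
    moreover have "((\<lambda>_. 0) has_real_derivative 0) (at x)" by simp
    moreover have "x \<in> - K" using lu(3) x by auto
    ultimately have "(\<phi> has_real_derivative 0) (at x)"
      using K(3) by (intro has_field_derivative_transform_within_open[of "\<lambda>_. 0" 0 x "- K" \<phi>]) auto
    thus "deriv \<phi> x = 0" by (rule DERIV_imp_deriv)
  qed
qed

section \<open>Weak derivatives: uniqueness, and agreement with classical derivatives\<close>

lemma integrable_lebesgue_on_subset:
  fixes f :: "real \<Rightarrow> 'a::euclidean_space"
  assumes "integrable (lebesgue_on S) f" "T \<subseteq> S" "S \<in> sets lebesgue" "T \<in> sets lebesgue"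
  shows "integrable (lebesgue_on T) f"
  using assms set_integrable_subset[of lebesgue S f T] by (simp add: integrable_lebesgue_on_iff)

lemma half_line_supported:
  fixes f :: "real \<Rightarrow> 'a::euclidean_space"
  assumes "0 < l" "integrable (lebesgue_on {l..u}) f" "\<And>x. x > 0 \<Longrightarrow> x \<notin> {l..u} \<Longrightarrow> f x = 0"
  shows "integrable half_line f" "integral\<^sup>L half_line f = integral\<^sup>L (lebesgue_on {l..u}) f"
proof -
  have e: "indicat_real {0<..} x *\<^sub>R f x = indicat_real {l..u} x *\<^sub>R f x" for x
    using assms(1,3) by (auto simp: indicator_def)
  show "integrable half_line f" using assms(2) by (simp add: integrable_restrict_space e)
  show "integral\<^sup>L half_line f = integral\<^sup>L (lebesgue_on {l..u}) f"
    by (simp add: integral_restrict_space e)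
qed

lemma continuous_Lp_loc:
  fixes u :: "real \<Rightarrow> complex"
  assumes "continuous_on {0<..} u" "p > 0"
  shows "u \<in> Lp_loc p"
  unfolding Lp_loc_def
proof (intro CollectI conjI allI impI)
  show "u \<in> borel_measurable half_line" using assms by (intro continuous_imp_measurable_on_sets_lebesgue) auto
  fix K :: "real set" assume K: "compact K \<and> K \<subseteq> {0<..}"
  then obtain l v where lv: "0 < l" "l < v" "K \<subseteq> {l<..<v}" using compact_half_line_interval by metis
  have "continuous_on {l..v} u" using assms(1) lv by (rule_tac continuous_on_subset) auto
  hence "continuous_on {l..v} (\<lambda>y. norm (u y) powr p)"
    using assms(2) by (intro continuous_on_powr' continuous_intros) auto
  hence "integrable (lebesgue_on {l..v}) (\<lambda>y. norm (u y) powr p)" by (rule continuous_imp_integrable_real)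
  thus "integrable (lebesgue_on K) (\<lambda>y. norm (u y) powr p)"
  proof (rule integrable_lebesgue_on_subset)
    show "K \<subseteq> {l..v}" using lv(3) by auto
  qed (use K in \<open>auto simp: lmeasurable_compact fmeasurableD\<close>)
qed

lemma Lp_loc_1_integrable:
  assumes "v \<in> Lp_loc 1" "0 < l"
  shows "integrable (lebesgue_on {l..u}) v"
proof -
  have "compact {l..u} \<and> {l..u} \<subseteq> {0<..}" using assms(2) by auto
  hence i: "integrable (lebesgue_on {l..u}) (\<lambda>y. norm (v y))" using assms(1) by (auto simp: Lp_loc_def)
  have "v \<in> borel_measurable (lebesgue_on {l..u})"
    using assms by (auto simp: Lp_loc_def intro!: measurable_restrict_mono[of v lebesgue "{0<..}"])
  with i show ?thesis using integrable_norm_iff by blast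
qed

text \<open>Fundamental lemma of the calculus of variations. The test functions
  \<open>bump l t n\<close> are bounded by 1 and tend to the indicator of (l, t), so the difference
  of two weak derivatives has integral 0 over every interval.\<close>

lemma is_weak_deriv_unique:
  assumes "is_weak_deriv u v" "is_weak_deriv u w"
  shows "AE y in half_line. v y = w y"
proof -
  have loc: "v \<in> Lp_loc 1" "w \<in> Lp_loc 1" using assms by (auto simp: is_weak_deriv_def)
  have m: "v \<in> borel_measurable half_line" "w \<in> borel_measurable half_line" using loc by (auto simp: Lp_loc_def)
  have main: "integrable half_line (\<lambda>y. indicator {l<..<t} y * f y)"
    "(\<lambda>n. LINT y|half_line. f y * of_real (bump l t n y)) \<longlonglongrightarrow> (LINT y|half_line. indicator {l<..<t} y * f y)"
    if f: "f \<in> Lp_loc 1" and lt: "0 < l" "l < t" for f l t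
  proof -
    have fm [measurable]: "f \<in> borel_measurable half_line" using f by (auto simp: Lp_loc_def)
    have "integrable (lebesgue_on {l..t}) (\<lambda>y. indicator {l..t} y * norm (f y)) \<longleftrightarrow> integrable (lebesgue_on {l..t}) (\<lambda>y. norm (f y))"
      by (rule Bochner_Integration.integrable_cong) auto
    hence "integrable (lebesgue_on {l..t}) (\<lambda>y. indicator {l..t} y * norm (f y))"
      using integrable_norm[OF Lp_loc_1_integrable[OF f lt(1)], of t] by simp
    from half_line_supported(1)[OF lt(1) this]
    have dom: "integrable half_line (\<lambda>y. indicator {l..t} y * norm (f y))" by simp
    have im: "(\<lambda>y. indicator {l<..<t} y :: complex) \<in> borel_measurable half_line" using indicator_dual_weight(1)[OF lt] by simp
    have bm: "(\<lambda>y. complex_of_real (bump l t n y)) \<in> borel_measurable half_line" for n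
    proof -
      have "continuous_on {0<..} (\<lambda>y. complex_of_real (bump l t n y))"
        using test_function_continuous(1)[OF test_function_bump[OF lt, of n]]
        by (intro continuous_intros) (rule continuous_on_subset, auto)
      thus ?thesis by (intro continuous_imp_measurable_on_sets_lebesgue) auto
    qed
    show "integrable half_line (\<lambda>y. indicator {l<..<t} y * f y)"
      by (rule measurable_bounded_by_integrable_imp_lebesgue_integrable[OF borel_measurable_times[OF im fm] dom])
         (auto simp: indicator_def norm_mult)
    show "(\<lambda>n. LINT y|half_line. f y * of_real (bump l t n y)) \<longlonglongrightarrow> (LINT y|half_line. indicator {l<..<t} y * f y)"
    proof (rule integral_dominated_convergence[OF borel_measurable_times[OF im fm] borel_measurable_times[OF fm bm] dom])
      show "AE y in half_line. (\<lambda>n. f y * of_real (bump l t n y)) \<longlonglongrightarrow> indicator {l<..<t} y * f y"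
      proof (rule AE_I2)
        fix y
        have "(\<lambda>n. f y * complex_of_real (bump l t n y)) \<longlonglongrightarrow> f y * of_real (indicator {l<..<t} y)"
          by (intro tendsto_intros bump_tendsto)
        thus "(\<lambda>n. f y * of_real (bump l t n y)) \<longlonglongrightarrow> indicator {l<..<t} y * f y"
          by (auto simp: indicator_def)
      qed
      show "AE y in half_line. norm (f y * of_real (bump l t n y)) \<le> indicator {l..t} y * norm (f y)" for n
      proof (rule AE_I2)
        fix y show "norm (f y * of_real (bump l t n y)) \<le> indicator {l..t} y * norm (f y)"
          using bump_bounds[of l t n y] bump_zero[of y l t n]
          by (cases "y \<in> {l<..<t}") (auto simp: norm_mult mult_left_le)
      qed
    qed
  qed
  have "AE y in half_line. v y - w y = 0"
  proof (rule AE_zero_of_interval_integrals)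
    fix l t :: real assume lt: "0 < l" "l < t"
    have e: "indicator {l<..<t} y * (v y - w y) = indicator {l<..<t} y * v y - indicator {l<..<t} y * w y" for y
      by (simp add: algebra_simps)
    show "integrable half_line (\<lambda>y. indicator {l<..<t} y * (v y - w y))"
      unfolding e using main(1)[OF loc(1) lt] main(1)[OF loc(2) lt] by simp
    have "(LINT y|half_line. v y * of_real (bump l t n y)) = (LINT y|half_line. w y * of_real (bump l t n y))" for n
    proof -
      have "- (LINT y|half_line. v y * of_real (bump l t n y)) = - (LINT y|half_line. w y * of_real (bump l t n y))"
        using assms test_function_bump[OF lt, of n] unfolding is_weak_deriv_def by (elim conjE allE[of _ "bump l t n"]) auto
      thus ?thesis by simp
    qed
    hence "(LINT y|half_line. indicator {l<..<t} y * v y) = (LINT y|half_line. indicator {l<..<t} y * w y)"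
      using main(2)[OF loc(1) lt] main(2)[OF loc(2) lt] LIMSEQ_unique by simp
    thus "(LINT y|half_line. indicator {l<..<t} y * (v y - w y)) = 0"
      unfolding e using main(1)[OF loc(1) lt] main(1)[OF loc(2) lt] by simp
  qed
  thus ?thesis by simp
qed

text \<open>The second derivative in \<open>L_op\<close> is taken of \<open>weak_deriv u\<close>, an
  arbitrary choice that agrees with the classical derivative only almost everywhere.\<close>

lemma is_weak_deriv_cong_AE:
  assumes "is_weak_deriv u v" "u' \<in> Lp_loc 1" "AE y in half_line. u y = u' y"
  shows "is_weak_deriv u' v"
  unfolding is_weak_deriv_def
proof (intro conjI allI impI)
  fix \<phi> assume \<phi>: "test_function \<phi>"
  have m: "u \<in> borel_measurable half_line" "u' \<in> borel_measurable half_line"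
    using assms by (auto simp: is_weak_deriv_def Lp_loc_def)
  have "continuous_on {0<..} (\<lambda>y. complex_of_real (deriv \<phi> y))"
    using test_function_continuous(2)[OF \<phi>] by (intro continuous_intros) (rule continuous_on_subset, auto)
  hence d: "(\<lambda>y. complex_of_real (deriv \<phi> y)) \<in> borel_measurable half_line"
    by (intro continuous_imp_measurable_on_sets_lebesgue) auto
  have "(LINT y|half_line. u' y * of_real (deriv \<phi> y)) = (LINT y|half_line. u y * of_real (deriv \<phi> y))"
    by (rule integral_cong_AE) (use m d assms(3) in \<open>auto intro!: borel_measurable_times\<close>)
  thus "(LINT y|half_line. u' y * of_real (deriv \<phi> y)) = - (LINT y|half_line. v y * of_real (\<phi> y))"
    using assms(1) \<phi> by (simp add: is_weak_deriv_def)
qed (use assms in \<open>auto simp: is_weak_deriv_def\<close>)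

text \<open>Integration by parts: the derivative of u \<phi> has integral 0 over an interval at
  whose ends \<phi> vanishes.\<close>

lemma classical_imp_weak_deriv:
  assumes "continuous_on {0<..} u'" "\<And>y. y > 0 \<Longrightarrow> (u has_vector_derivative u' y) (at y)"
  shows "is_weak_deriv u u'"
  unfolding is_weak_deriv_def
proof (intro conjI allI impI)
  have cu: "continuous_on {0<..} u"
    by (rule continuous_at_imp_continuous_on) (use assms(2) has_vector_derivative_continuous in blast)
  show "u \<in> Lp_loc 1" "u' \<in> Lp_loc 1" using cu assms(1) by (auto intro: continuous_Lp_loc)
  fix \<phi> assume \<phi>: "test_function \<phi>"
  obtain l t where lt: "0 < l" "l < t" "\<And>x. x \<notin> {l<..<t} \<Longrightarrow> \<phi> x = 0" "\<And>x. x \<notin> {l<..<t} \<Longrightarrow> deriv \<phi> x = 0"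
    using test_function_support[OF \<phi>] by blast
  have cont: "continuous_on {l..t} u" "continuous_on {l..t} u'" "continuous_on {l..t} (\<lambda>y. complex_of_real (\<phi> y))"
     "continuous_on {l..t} (\<lambda>y. complex_of_real (deriv \<phi> y))"
    using cu assms(1) test_function_continuous(1,2)[OF \<phi>] lt
    by (auto intro!: continuous_intros elim!: continuous_on_subset)
  have i: "integrable (lebesgue_on {l..t}) (\<lambda>y. u y * of_real (deriv \<phi> y))" "integrable (lebesgue_on {l..t}) (\<lambda>y. u' y * of_real (\<phi> y))"
    unfolding interval_cbox using cont
    by (intro continuous_imp_integrable continuous_on_mult; simp)+
  have "((\<lambda>y. u y * of_real (deriv \<phi> y) + u' y * of_real (\<phi> y)) has_integral (u t * of_real (\<phi> t) - u l * of_real (\<phi> l))) {l..t}"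
  proof (rule fundamental_theorem_of_calculus)
    fix y assume y: "y \<in> {l..t}"
    have "((\<lambda>y. complex_of_real (\<phi> y)) has_vector_derivative of_real (deriv \<phi> y)) (at y)"
      using test_function_continuous(3)[OF \<phi>]
      by (intro has_vector_derivative_of_real) (simp add: has_real_derivative_iff_has_vector_derivative[symmetric])
    moreover have "(u has_vector_derivative u' y) (at y)" using assms(2) y lt by auto
    ultimately have "((\<lambda>y. u y * complex_of_real (\<phi> y)) has_vector_derivative (u y * of_real (deriv \<phi> y) + u' y * of_real (\<phi> y))) (at y)"
      by (rule has_vector_derivative_mult[rotated])
    thus "((\<lambda>y. u y * complex_of_real (\<phi> y)) has_vector_derivative (u y * of_real (deriv \<phi> y) + u' y * of_real (\<phi> y))) (at y within {l..t})"
      by (rule has_vector_derivative_at_within)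
  qed (use lt in auto)
  hence "integral {l..t} (\<lambda>y. u y * of_real (deriv \<phi> y) + u' y * of_real (\<phi> y)) = 0"
    using lt(3)[of l] lt(3)[of t] by (simp add: integral_unique)
  hence "(LINT y|lebesgue_on {l..t}. u y * of_real (deriv \<phi> y) + u' y * of_real (\<phi> y)) = 0"
    using i by (subst lebesgue_integral_eq_integral) auto
  hence "(LINT y|lebesgue_on {l..t}. u y * of_real (deriv \<phi> y)) + (LINT y|lebesgue_on {l..t}. u' y * of_real (\<phi> y)) = 0"
    using i by simp
  moreover have "(LINT y|half_line. u y * of_real (deriv \<phi> y)) = (LINT y|lebesgue_on {l..t}. u y * of_real (deriv \<phi> y))"
    by (rule half_line_supported(2)[OF lt(1) i(1)]) (use lt(4) in auto)
  moreover have "(LINT y|half_line. u' y * of_real (\<phi> y)) = (LINT y|lebesgue_on {l..t}. u' y * of_real (\<phi> y))"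
    by (rule half_line_supported(2)[OF lt(1) i(2)]) (use lt(3) in auto)
  ultimately show "(LINT y|half_line. u y * of_real (deriv \<phi> y)) = - (LINT y|half_line. u' y * of_real (\<phi> y))"
    by (simp add: eq_neg_iff_add_eq_0)
qed

lemma is_weak_deriv_weak_deriv: "is_weak_deriv u v \<Longrightarrow> is_weak_deriv u (weak_deriv u)"
  unfolding weak_deriv_def by (rule someI[where P="is_weak_deriv u"])

text \<open>Reduces \<open>L_op\<close>, which rests on chosen weak derivatives, to a computation
  with classical ones.\<close>

lemma L_op_classical:
  assumes "continuous_on {0<..} u''" "\<And>y. y > 0 \<Longrightarrow> (u has_vector_derivative u' y) (at y)"
    "\<And>y. y > 0 \<Longrightarrow> (u' has_vector_derivative u'' y) (at y)"
  shows "AE y in half_line. L_op b c u y = u'' y + of_real (c / y) * u' y - of_real (b / y\<^sup>2) * u y"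
    and "L_op b c u \<in> borel_measurable half_line"
    and "p > 0 \<Longrightarrow> u \<in> W2p_loc p"
proof -
  have cu': "continuous_on {0<..} u'"
    by (rule continuous_at_imp_continuous_on) (use assms(3) has_vector_derivative_continuous in blast)
  have cu: "continuous_on {0<..} u"
    by (rule continuous_at_imp_continuous_on) (use assms(2) has_vector_derivative_continuous in blast)
  have w1: "is_weak_deriv u u'" by (rule classical_imp_weak_deriv[OF cu' assms(2)])
  have w2: "is_weak_deriv u' u''" by (rule classical_imp_weak_deriv[OF assms(1,3)])
  note W1 = is_weak_deriv_weak_deriv[OF w1]
  have a1: "AE y in half_line. weak_deriv u y = u' y" by (rule is_weak_deriv_unique[OF W1 w1])
  have l1: "weak_deriv u \<in> Lp_loc 1" using W1 by (simp add: is_weak_deriv_def)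
  have w3: "is_weak_deriv (weak_deriv u) u''"
    by (rule is_weak_deriv_cong_AE[OF w2 l1]) (use a1 in eventually_elim, simp)
  note W3 = is_weak_deriv_weak_deriv[OF w3]
  have a2: "AE y in half_line. weak_deriv (weak_deriv u) y = u'' y" by (rule is_weak_deriv_unique[OF W3 w3])
  show "AE y in half_line. L_op b c u y = u'' y + of_real (c / y) * u' y - of_real (b / y\<^sup>2) * u y"
    using a1 a2 by eventually_elim (simp add: L_op_def)
  have m: "u \<in> borel_measurable half_line" "weak_deriv u \<in> borel_measurable half_line" "weak_deriv (weak_deriv u) \<in> borel_measurable half_line"
    using w1 l1 W3 by (auto simp: is_weak_deriv_def Lp_loc_def)
  have c: "(\<lambda>y. complex_of_real (c / y)) \<in> borel_measurable half_line" "(\<lambda>y. complex_of_real (b / y\<^sup>2)) \<in> borel_measurable half_line"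
    by (auto intro!: continuous_imp_measurable_on_sets_lebesgue continuous_intros simp del: of_real_divide)
  show "L_op b c u \<in> borel_measurable half_line"
    unfolding L_op_def using m c by (intro borel_measurable_add borel_measurable_diff borel_measurable_times)
  show "u \<in> W2p_loc p" if "p > 0"
    unfolding W2p_loc_def using w1 w2 cu cu' assms(1) that by (auto intro!: continuous_Lp_loc)
qed

subsection \<open>Uniqueness of orbits of an analytic semigroup\<close>

lemma sector_half_pi: "z \<in> sector (pi / 2) \<longleftrightarrow> Re z > 0"
  unfolding sector_def mem_Collect_eq Arg_Re_pos by auto

text \<open>These functionals are continuous on the space and determine an element almost
  everywhere. They turn calculus of vector-valued curves into calculus of complex-valued
  functions.\<close>

definition interval_functional :: "real \<Rightarrow> real \<Rightarrow> (real \<Rightarrow> complex) \<Rightarrow> complex" where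
  "interval_functional l r f = (LINT y|half_line. indicator {l<..<r} y * f y)"

lemma Lp_mass_eq_0_imp_AE:
  assumes "f \<in> Lp_space m p" "Lp_mass m p f = 0"
  shows "AE y in half_line. f y = 0"
proof -
  have i: "integrable half_line (\<lambda>y. y powr m * norm (f y) powr p)" using assms by (simp add: Lp_space_iff)
  have "AE y in half_line. y powr m * norm (f y) powr p = 0"
    using assms(2) integral_nonneg_eq_0_iff_AE[OF i] by (auto simp: Lp_mass_def)
  moreover have "AE y in half_line. y > 0" by (rule AE_I2) auto
  ultimately show ?thesis by eventually_elim auto
qed

text \<open>Differentiability implies continuity: f = k ((f / k - g) + g), where k tends to 0 and
  the bracket has bounded mass.\<close>

lemma Lp_mass_divide_tendsto:
  fixes k :: "'a \<Rightarrow> complex"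
  assumes "p > 0" "((\<lambda>x. Lp_mass m p (\<lambda>y. f x y / k x - g y)) \<longlongrightarrow> 0) F" "\<forall>\<^sub>F x in F. f x \<in> Lp_space m p"
    "g \<in> Lp_space m p" "(k \<longlongrightarrow> 0) F" "\<forall>\<^sub>F x in F. k x \<noteq> 0"
  shows "((\<lambda>x. Lp_mass m p (f x)) \<longlongrightarrow> 0) F"
proof (rule tendsto_sandwich[of "\<lambda>_. 0"])
  let ?b = "\<lambda>x. norm (k x) powr p * (2 powr p * (Lp_mass m p (\<lambda>y. f x y / k x - g y) + Lp_mass m p g))"
  show "\<forall>\<^sub>F x in F. Lp_mass m p (f x) \<le> ?b x"
    using assms(3,6)
  proof eventually_elim
    case (elim x)
    have q: "(\<lambda>y. f x y / k x - g y) \<in> Lp_space m p"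
      using Lp_space_diff(1)[OF Lp_space_cmult(1)[OF elim(1), of "1 / k x"] assms(4,1)] by simp
    have s: "(\<lambda>y. (f x y / k x - g y) + g y) \<in> Lp_space m p" by (rule Lp_space_add(1)[OF q assms(4,1)])
    have "f x = (\<lambda>y. k x * ((f x y / k x - g y) + g y))" using elim(2) by (simp add: field_simps)
    hence "Lp_mass m p (f x) = norm (k x) powr p * Lp_mass m p (\<lambda>y. (f x y / k x - g y) + g y)"
      using Lp_space_cmult(2)[OF s, of "k x"] by simp
    also have "\<dots> \<le> ?b x" by (intro mult_left_mono Lp_space_add(2)[OF q assms(4,1)]) auto
    finally show ?case .
  qed
  have "((\<lambda>x. norm (k x) powr p) \<longlongrightarrow> 0) F"
    by (rule tendsto_zero_powrI[where g="\<lambda>_. p" and b=p]) (use assms(1,5) tendsto_norm_zero in auto)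
  moreover have "((\<lambda>x. 2 powr p * (Lp_mass m p (\<lambda>y. f x y / k x - g y) + Lp_mass m p g)) \<longlongrightarrow> 2 powr p * (0 + Lp_mass m p g)) F"
    by (intro tendsto_intros assms(2))
  ultimately show "(?b \<longlongrightarrow> 0) F" using tendsto_mult by fastforce
qed (auto intro!: always_eventually Lp_mass_nonneg)

lemma interval_functional_add:
  assumes "1 < p" "f \<in> Lp_space m p" "g \<in> Lp_space m p" "0 < l" "l < r"
  shows "interval_functional l r (\<lambda>y. f y + g y) = interval_functional l r f + interval_functional l r g"
  unfolding interval_functional_def using Lp_interval_integrable[OF assms(1) _ assms(4,5)] assms(2,3)
  by (simp add: distrib_left)

lemma interval_functional_diff:
  assumes "1 < p" "f \<in> Lp_space m p" "g \<in> Lp_space m p" "0 < l" "l < r"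
  shows "interval_functional l r (\<lambda>y. f y - g y) = interval_functional l r f - interval_functional l r g"
  unfolding interval_functional_def using Lp_interval_integrable[OF assms(1) _ assms(4,5)] assms(2,3)
  by (simp add: right_diff_distrib)

lemma interval_functional_cmult: "interval_functional l r (\<lambda>y. c * f y) = c * interval_functional l r f"
  unfolding interval_functional_def
  by (subst integral_mult_right_zero[symmetric]) (simp add: mult_ac)

lemma interval_functional_cong:
  assumes "AE y in half_line. f y = g y" "0 < l" "l < r" "f \<in> borel_measurable half_line" "g \<in> borel_measurable half_line"
  shows "interval_functional l r f = interval_functional l r g"
  unfolding interval_functional_def
  by (rule integral_cong_AE)
     (use assms indicator_dual_weight(1)[OF assms(2,3)] in \<open>auto intro!: borel_measurable_times\<close>)

locale analytic_semigroup =
  fixes m p :: real and T :: "complex \<Rightarrow> (real \<Rightarrow> complex) \<Rightarrow> (real \<Rightarrow> complex)"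
  assumes p: "1 < p" and bas: "bounded_analytic_semigroup m p (pi / 2) T"
begin

lemma p0: "p > 0" using p by simp

lemma T_Lp: "Re z > 0 \<Longrightarrow> f \<in> Lp_space m p \<Longrightarrow> T z f \<in> Lp_space m p"
  using bas sector_half_pi[of z] unfolding bounded_analytic_semigroup_def by blast

lemma T_linear:
  assumes "Re z > 0" "f \<in> Lp_space m p" "g \<in> Lp_space m p"
  shows "AE y in half_line. T z (\<lambda>x. \<alpha> * f x + \<beta> * g x) y = \<alpha> * T z f y + \<beta> * T z g y"
  using bas assms sector_half_pi[of z] unfolding bounded_analytic_semigroup_def by blast

lemma T_cmult: "Re z > 0 \<Longrightarrow> f \<in> Lp_space m p \<Longrightarrow> AE y in half_line. T z (\<lambda>x. \<alpha> * f x) y = \<alpha> * T z f y"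
  using T_linear[of z f f \<alpha> 0] by simp

lemma T_diff: "Re z > 0 \<Longrightarrow> f \<in> Lp_space m p \<Longrightarrow> g \<in> Lp_space m p \<Longrightarrow> AE y in half_line. T z (\<lambda>x. f x - g x) y = T z f y - T z g y"
  using T_linear[of z f g 1 "-1"] by simp

lemma T_semigroup: "Re z > 0 \<Longrightarrow> Re w > 0 \<Longrightarrow> f \<in> Lp_space m p \<Longrightarrow> AE y in half_line. T (z + w) f y = T z (T w f) y"
  using bas sector_half_pi[of z] sector_half_pi[of w] unfolding bounded_analytic_semigroup_def by blast

lemma T_bounded:
  assumes "0 < \<phi>" "\<phi> < pi / 2"
  obtains M where "M \<ge> 0" "\<And>z f. z \<in> sector \<phi> \<Longrightarrow> f \<in> Lp_space m p \<Longrightarrow> Lp_mass m p (T z f) \<le> M * Lp_mass m p f"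
proof -
  obtain M where M: "\<And>z f. z \<in> sector \<phi> \<Longrightarrow> f \<in> Lp_space m p \<Longrightarrow> Lp_norm m p (T z f) \<le> M * Lp_norm m p f"
    using bas assms unfolding bounded_analytic_semigroup_def by meson
  \<comment> \<open>M comes without a sign, hence the absolute value before the p-th power is
    taken.\<close>
  have "Lp_mass m p (T z f) \<le> \<bar>M\<bar> powr p * Lp_mass m p f" if z: "z \<in> sector \<phi>" and f: "f \<in> Lp_space m p" for z f
  proof -
    have "z \<in> sector (pi / 2)" using z assms(2) by (auto simp: sector_def)
    hence "T z f \<in> Lp_space m p" using f by (intro T_Lp) (simp_all add: sector_half_pi)
    hence e: "Lp_norm m p (T z f) = Lp_mass m p (T z f) powr (1 / p)" "Lp_norm m p f = Lp_mass m p f powr (1 / p)"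
      using f by (auto intro!: Lp_norm_eq Lp_space_measurable)
    have "Lp_mass m p (T z f) powr (1 / p) \<le> M * Lp_mass m p f powr (1 / p)" using M[OF z f] by (simp add: e)
    also have "\<dots> \<le> \<bar>M\<bar> * Lp_mass m p f powr (1 / p)" by (intro mult_right_mono) auto
    finally have "(Lp_mass m p (T z f) powr (1 / p)) powr p \<le> (\<bar>M\<bar> * Lp_mass m p f powr (1 / p)) powr p"
      using p0 by (intro powr_mono2) auto
    thus ?thesis using p0 Lp_mass_nonneg by (simp add: powr_powr powr_mult)
  qed
  thus ?thesis using that[of "\<bar>M\<bar> powr p"] by auto
qed

text \<open>The bound is uniform in a smaller sector, so the time may vary along the filter together
  with the vector.\<close>

lemma T_tendsto_0:
  assumes "0 < \<phi>" "\<phi> < pi / 2" "\<forall>\<^sub>F x in F. z x \<in> sector \<phi>" "\<forall>\<^sub>F x in F. f x \<in> Lp_space m p"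
    "((\<lambda>x. Lp_mass m p (f x)) \<longlongrightarrow> 0) F"
  shows "((\<lambda>x. Lp_mass m p (T (z x) (f x))) \<longlongrightarrow> 0) F"
proof -
  obtain M where M: "M \<ge> 0" "\<And>z f. z \<in> sector \<phi> \<Longrightarrow> f \<in> Lp_space m p \<Longrightarrow> Lp_mass m p (T z f) \<le> M * Lp_mass m p f"
    using T_bounded[OF assms(1,2)] by blast
  show ?thesis
  proof (rule tendsto_sandwich[of "\<lambda>_. 0"])
    show "\<forall>\<^sub>F x in F. Lp_mass m p (T (z x) (f x)) \<le> M * Lp_mass m p (f x)"
      using assms(3,4) by eventually_elim (rule M(2))
    show "((\<lambda>x. M * Lp_mass m p (f x)) \<longlongrightarrow> 0) F" using tendsto_mult_left[OF assms(5), of M] by simp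
  qed (auto intro!: always_eventually Lp_mass_nonneg)
qed

text \<open>A smaller sector that contains z contains the whole open ray through z. One bound thus
  serves all times (1 - s) z with s < 1.\<close>

lemma T_bounded_at:
  assumes "Re z > 0"
  obtains \<phi> where "0 < \<phi>" "\<phi> < pi / 2" "\<And>t. t > 0 \<Longrightarrow> of_real t * z \<in> sector \<phi>"
proof -
  have z: "z \<noteq> 0" using assms by auto
  have "\<bar>Arg z\<bar> < pi / 2" using assms unfolding Arg_Re_pos by simp
  then obtain \<phi> where \<phi>: "\<bar>Arg z\<bar> < \<phi>" "\<phi> < pi / 2" using dense by blast
  show ?thesis
  proof (rule that[OF _ \<phi>(2)])
    show "0 < \<phi>" using \<phi>(1) by (rule le_less_trans[OF abs_ge_zero])
    fix t :: real assume "t > 0"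
    thus "of_real t * z \<in> sector \<phi>" using \<phi>(1) z by (simp add: sector_def Arg_times_of_real)
  qed
qed

lemma T_differentiable:
  assumes "Re z > 0" "f \<in> Lp_space m p"
  obtains g where "g \<in> Lp_space m p"
    "((\<lambda>h. Lp_mass m p (\<lambda>y. (T (z + h) f y - T z f y) / h - g y)) \<longlongrightarrow> 0) (at 0)"
    "\<forall>\<^sub>F h in at 0. (\<lambda>y. (T (z + h) f y - T z f y)) \<in> Lp_space m p"
proof -
  obtain g where g: "g \<in> Lp_space m p" "((\<lambda>h. Lp_norm m p (\<lambda>y. (T (z + h) f y - T z f y) / h - g y)) \<longlongrightarrow> 0) (at 0)"
    using bas assms sector_half_pi[of z] unfolding bounded_analytic_semigroup_def by blast
  have "((\<lambda>h. Re (z + h)) \<longlongrightarrow> Re (z + 0)) (at 0)" by (intro tendsto_intros)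
  hence "\<forall>\<^sub>F h in at 0. Re (z + h) > 0" using assms(1) by (intro order_tendstoD(1)) auto
  hence ev: "\<forall>\<^sub>F h in at 0. (\<lambda>y. (T (z + h) f y - T z f y)) \<in> Lp_space m p"
    by eventually_elim (intro Lp_space_diff(1) T_Lp assms p0)
  hence "\<forall>\<^sub>F h in at 0. (\<lambda>y. (T (z + h) f y - T z f y) / h - g y) \<in> borel_measurable half_line"
  proof eventually_elim
    case (elim h)
    show ?case
      using Lp_space_diff(1)[OF Lp_space_cmult(1)[OF elim, of "1 / h"] g(1) p0] by (simp add: Lp_space_iff)
  qed
  with g(2) have "((\<lambda>h. Lp_mass m p (\<lambda>y. (T (z + h) f y - T z f y) / h - g y)) \<longlongrightarrow> 0) (at 0)"
    by (subst (asm) Lp_norm_tendsto_0_iff[OF p0])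
  thus ?thesis using that[OF g(1) _ ev] by blast
qed

lemma T_continuous:
  assumes "Re z > 0" "f \<in> Lp_space m p"
  shows "((\<lambda>h. Lp_mass m p (\<lambda>y. T (z + h) f y - T z f y)) \<longlongrightarrow> 0) (at 0)"
proof -
  obtain g where g: "g \<in> Lp_space m p"
    "((\<lambda>h. Lp_mass m p (\<lambda>y. (T (z + h) f y - T z f y) / h - g y)) \<longlongrightarrow> 0) (at 0)"
    "\<forall>\<^sub>F h in at 0. (\<lambda>y. (T (z + h) f y - T z f y)) \<in> Lp_space m p"
    by (rule T_differentiable[OF assms])
  show ?thesis
    by (rule Lp_mass_divide_tendsto[OF p0 g(2,3,1)]) (rule tendsto_ident_at, rule eventually_neq_at_within)
qed

lemma T_strongly_continuous_0:
  assumes "0 < \<phi>" "\<phi> < pi / 2" "f \<in> Lp_space m p"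
  shows "((\<lambda>z. Lp_mass m p (\<lambda>y. T z f y - f y)) \<longlongrightarrow> 0) (at 0 within sector \<phi>)"
proof -
  have "((\<lambda>z. Lp_norm m p (\<lambda>y. T z f y - f y)) \<longlongrightarrow> 0) (at 0 within sector \<phi>)"
    using bas assms unfolding bounded_analytic_semigroup_def by blast
  moreover have "\<forall>\<^sub>F z in at 0 within sector \<phi>. (\<lambda>y. T z f y - f y) \<in> borel_measurable half_line"
    unfolding eventually_at_filter
  proof (rule always_eventually, intro allI impI)
    fix z assume "z \<in> sector \<phi>"
    hence "z \<in> sector (pi / 2)" using assms by (auto simp: sector_def)
    thus "(\<lambda>y. T z f y - f y) \<in> borel_measurable half_line"
      using assms(3) by (intro Lp_space_measurable[OF Lp_space_diff(1)[OF T_Lp _ p0]]) (auto simp: sector_half_pi)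
  qed
  ultimately show ?thesis by (subst (asm) Lp_norm_tendsto_0_iff[OF p0])
qed

text \<open>By the semigroup law the quotient of T at z with a real increment t > 0 is T z applied
  to the quotient at 0, which tends to T z g. Holomorphy provides a derivative g' for complex
  increments, and the limit along real t identifies g' with T z g.\<close>

lemma T_deriv_domain:
  assumes z: "Re z > 0" and fg: "f \<in> Lp_space m p" "g \<in> Lp_space m p"
    and gen: "((\<lambda>t::real. Lp_norm m p (\<lambda>y. (T (of_real t) f y - f y) / of_real t - g y)) \<longlongrightarrow> 0) (at_right 0)"
  shows "((\<lambda>h. Lp_mass m p (\<lambda>y. (T (z + h) f y - T z f y) / h - T z g y)) \<longlongrightarrow> 0) (at 0)"
proof -
  obtain g' where g': "g' \<in> Lp_space m p"
    "((\<lambda>h. Lp_mass m p (\<lambda>y. (T (z + h) f y - T z f y) / h - g' y)) \<longlongrightarrow> 0) (at 0)"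
    "\<forall>\<^sub>F h in at 0. (\<lambda>y. (T (z + h) f y - T z f y)) \<in> Lp_space m p"
    by (rule T_differentiable[OF z fg(1)])
  have Tg: "T z g \<in> Lp_space m p" by (rule T_Lp[OF z fg(2)])
  define q where "q = (\<lambda>(t::real) y. (T (of_real t) f y - f y) / of_real t - g y)"
  have qLp: "q t \<in> Lp_space m p" if "t > 0" for t
  proof -
    have "(\<lambda>y. T (of_real t) f y - f y) \<in> Lp_space m p" using that by (intro Lp_space_diff(1) T_Lp fg p0) auto
    from Lp_space_diff(1)[OF Lp_space_cmult(1)[OF this, of "1 / of_real t"] fg(2) p0]
    show ?thesis by (simp add: q_def)
  qed
  have evq: "\<forall>\<^sub>F t in at_right 0. q t \<in> Lp_space m p"
    using qLp by (auto simp: eventually_at_filter)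
  have q0: "((\<lambda>t. Lp_mass m p (q t)) \<longlongrightarrow> 0) (at_right 0)"
    using gen Lp_norm_tendsto_0_iff[OF p0, of q "at_right 0" m] evq
    by (auto simp: q_def[abs_def] Lp_space_iff eventually_mono)
  obtain \<phi> where \<phi>: "0 < \<phi>" "\<phi> < pi / 2" "\<And>t. t > 0 \<Longrightarrow> of_real t * z \<in> sector \<phi>"
    using T_bounded_at[OF z] by blast
  have zs: "z \<in> sector \<phi>" using \<phi>(3)[of 1] by simp
  have c0: "((\<lambda>t. Lp_mass m p (T z (q t))) \<longlongrightarrow> 0) (at_right 0)"
    by (rule T_tendsto_0[OF \<phi>(1,2) _ evq q0]) (simp add: zs)
  have lim: "filterlim (\<lambda>t::real. complex_of_real t) (at 0) (at_right 0)"
    by (auto simp: filterlim_at eventually_at_filter intro!: tendsto_eq_intros)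
  have d0: "((\<lambda>t. Lp_mass m p (\<lambda>y. (T (z + of_real t) f y - T z f y) / of_real t - g' y)) \<longlongrightarrow> 0) (at_right 0)"
    by (rule filterlim_compose[OF g'(2) lim])
  have eq: "AE y in half_line. T z (q t) y = (T (z + of_real t) f y - T z f y) / of_real t - T z g y" if t: "t > 0" for t
  proof -
    have Lt: "T (of_real t) f \<in> Lp_space m p" "(\<lambda>y. T (of_real t) f y - f y) \<in> Lp_space m p"
      using t by (auto intro!: Lp_space_diff(1) T_Lp fg p0)
    have 1: "AE y in half_line. T z (\<lambda>y. 1 / of_real t * (T (of_real t) f y - f y) + (-1) * g y) y =
        1 / of_real t * T z (\<lambda>y. T (of_real t) f y - f y) y + (-1) * T z g y"
      by (rule T_linear[OF z Lt(2) fg(2)])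
    have 2: "AE y in half_line. T z (\<lambda>y. T (of_real t) f y - f y) y = T z (T (of_real t) f) y - T z f y"
      by (rule T_diff[OF z Lt(1) fg(1)])
    have 3: "AE y in half_line. T (z + of_real t) f y = T z (T (of_real t) f) y"
      by (rule T_semigroup[OF z _ fg(1)]) (use t in auto)
    from 1 2 3 show ?thesis by eventually_elim (simp add: q_def)
  qed
  \<comment> \<open>The left side does not depend on t while the right side tends to 0, so g' and T
    z g coincide.\<close>
  have ident: "\<forall>\<^sub>F t in at_right 0. Lp_mass m p (\<lambda>y. g' y - T z g y) \<le>
      2 powr p * (Lp_mass m p (T z (q t)) + Lp_mass m p (\<lambda>y. (T (z + of_real t) f y - T z f y) / of_real t - g' y))"
    unfolding eventually_at_filter
  proof (rule always_eventually, intro allI impI)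
    fix t :: real assume "t \<in> {0<..}"
    hence t: "t > 0" by simp
    have L: "(\<lambda>y. (T (z + of_real t) f y - T z f y) / of_real t - g' y) \<in> Lp_space m p"
      using Lp_space_diff(1)[OF Lp_space_cmult(1)[OF Lp_space_diff(1)[OF T_Lp T_Lp p0], of "z + of_real t" f z f "1 / of_real t"] g'(1) p0]
        z t fg(1) by simp
    have TL: "T z (q t) \<in> Lp_space m p" by (rule T_Lp[OF z qLp[OF t]])
    have "Lp_mass m p (\<lambda>y. g' y - T z g y) = Lp_mass m p (\<lambda>y. T z (q t) y - ((T (z + of_real t) f y - T z f y) / of_real t - g' y))"
      by (rule Lp_mass_cong_AE)
         (use Lp_space_diff(1)[OF g'(1) Tg p0] Lp_space_diff(1)[OF TL L p0] eq[OF t] in \<open>auto simp: Lp_space_iff\<close>)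
    thus "Lp_mass m p (\<lambda>y. g' y - T z g y) \<le>
      2 powr p * (Lp_mass m p (T z (q t)) + Lp_mass m p (\<lambda>y. (T (z + of_real t) f y - T z f y) / of_real t - g' y))"
      using Lp_space_diff(2)[OF TL L p0] by simp
  qed
  have "((\<lambda>t. 2 powr p * (Lp_mass m p (T z (q t)) + Lp_mass m p (\<lambda>y. (T (z + of_real t) f y - T z f y) / of_real t - g' y)))
     \<longlongrightarrow> 2 powr p * (0 + 0)) (at_right 0)"
    by (intro tendsto_intros c0 d0)
  from tendsto_lowerbound[OF this ident] have "Lp_mass m p (\<lambda>y. g' y - T z g y) \<le> 0" by simp
  hence "Lp_mass m p (\<lambda>y. g' y - T z g y) = 0" using Lp_mass_nonneg[of m p "\<lambda>y. g' y - T z g y"] by linarith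
  from Lp_mass_eq_0_imp_AE[OF Lp_space_diff(1)[OF g'(1) Tg p0] this]
  have ae: "AE y in half_line. g' y = T z g y" by simp
  have "\<forall>\<^sub>F h in at 0. Lp_mass m p (\<lambda>y. (T (z + h) f y - T z f y) / h - g' y) = Lp_mass m p (\<lambda>y. (T (z + h) f y - T z f y) / h - T z g y)"
    using g'(3)
  proof eventually_elim
    case (elim h)
    have "(\<lambda>y. (T (z + h) f y - T z f y) / h - g y) \<in> Lp_space m p" if "g \<in> Lp_space m p" for g
      using Lp_space_diff(1)[OF Lp_space_cmult(1)[OF elim, of "1 / h"] that p0] by simp
    thus ?case using g'(1) Tg ae by (intro Lp_mass_cong_AE) (auto simp: Lp_space_iff)
  qed
  thus ?thesis using g'(2) tendsto_cong by fast
qed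

text \<open>Tested against indicators of intervals, \<open>s \<mapsto> T ((1 - s) z) (U s)\<close> has derivative zero
  and is therefore constant on \<open>[0, 1]\<close>.\<close>

lemma orbit_unique:
  fixes U V :: "real \<Rightarrow> real \<Rightarrow> complex"
  assumes z: "Re z > 0" and LU: "\<And>s. U s \<in> Lp_space m p" and LV: "\<And>s. 0 \<le> s \<Longrightarrow> s \<le> 1 \<Longrightarrow> V s \<in> Lp_space m p"
    and gen: "\<And>s. 0 < s \<Longrightarrow> s < 1 \<Longrightarrow>
       ((\<lambda>t::real. Lp_norm m p (\<lambda>y. (T (of_real t) (U s) y - U s y) / of_real t - V s y)) \<longlongrightarrow> 0) (at_right 0)"
    and der: "\<And>s. 0 \<le> s \<Longrightarrow> s \<le> 1 \<Longrightarrow>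
       ((\<lambda>h. Lp_mass m p (\<lambda>y. (U (s + h) y - U s y) / of_real h - z * V s y)) \<longlongrightarrow> 0) (at 0)"
  shows "AE y in half_line. T z (U 0) y = U 1 y"
proof -
  obtain \<phi> where \<phi>: "0 < \<phi>" "\<phi> < pi / 2" "\<And>t. t > 0 \<Longrightarrow> of_real t * z \<in> sector \<phi>"
    using T_bounded_at[OF z] by blast
  have zt: "Re (of_real t * z) > 0" if "t > 0" for t using z that by simp
  have z0: "z \<noteq> 0" using z by auto
  have contU: "((\<lambda>h. Lp_mass m p (\<lambda>y. U (s + h) y - U s y)) \<longlongrightarrow> 0) (at 0)" if "0 \<le> s" "s \<le> 1" for s
    by (rule Lp_mass_divide_tendsto[OF p0 der[OF that]])
       (use LU LV that Lp_space_diff(1)[OF LU LU p0] Lp_space_cmult(1)[OF LV[OF that]] in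
         \<open>auto simp: eventually_at_filter intro!: tendsto_eq_intros\<close>)
  \<comment> \<open>T is only defined for times in the open half-plane, so the value at s = 1, where
    the time would be 0, is set separately; continuity there is strong continuity of the
    semigroup.\<close>
  define W where "W = (\<lambda>s. if s < 1 then T (of_real (1 - s) * z) (U s) else U 1)"
  have LW: "W s \<in> Lp_space m p" for s
    using LU zt[of "1 - s"] by (auto simp: W_def intro!: T_Lp)
  have LT: "T (of_real (1 - s) * z) f \<in> Lp_space m p" if "s < 1" "f \<in> Lp_space m p" for s f
    using that zt[of "1 - s"] by (intro T_Lp) auto
  have ev1: "\<forall>\<^sub>F h in at 0. s + h < 1" if "s < 1" for s :: real
  proof -
    have "((\<lambda>h. s + h) \<longlongrightarrow> s + 0) (at 0)" by (intro tendsto_intros)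
    thus ?thesis using that by (intro order_tendstoD(2)) auto
  qed
  have sec: "of_real (1 - s) * z \<in> sector \<phi>" if "s < 1" for s using \<phi>(3)[of "1 - s"] that by simp
  have shift: "of_real (1 - (s + h)) * z = of_real (1 - s) * z + (- (of_real h * z))" for s h
    by (simp add: algebra_simps)
  have limk: "filterlim (\<lambda>h::real. - (of_real h * z)) (at 0) (at 0)"
    using z0 by (auto simp: filterlim_at eventually_at_filter intro!: tendsto_eq_intros)
  have contT: "((\<lambda>h. Lp_mass m p (\<lambda>y. T (of_real (1 - (s + h)) * z) f y - T (of_real (1 - s) * z) f y)) \<longlongrightarrow> 0) (at 0)"
    if "s < 1" "f \<in> Lp_space m p" for s f
    unfolding shift using that zt[of "1 - s"] by (intro filterlim_compose[OF T_continuous limk]) auto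
  have main: "interval_functional l r (T z (U 0)) = interval_functional l r (U 1)" if lr: "0 < l" "l < r" for l r
  proof -
    define J where "J = interval_functional l r"
    note Jadd = interval_functional_add[OF p _ _ lr, where m=m, folded J_def]
    note Jdiff = interval_functional_diff[OF p _ _ lr, where m=m, folded J_def]
    note Jc = interval_functional_cmult[of l r, folded J_def]
    have Jcong: "J f = J g" if "AE y in half_line. f y = g y" "f \<in> Lp_space m p" "g \<in> Lp_space m p" for f g
      using that unfolding J_def by (intro interval_functional_cong lr) (auto simp: Lp_space_iff)
    have J0: "((\<lambda>x. J (f x)) \<longlongrightarrow> 0) F"
      if "\<forall>\<^sub>F x in F. f x \<in> Lp_space m p" "((\<lambda>x. Lp_mass m p (f x)) \<longlongrightarrow> 0) F" for f and F :: "real filter"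
      unfolding J_def interval_functional_def by (rule Lp_interval_tendsto_0[OF p lr that])
    define \<Phi> where "\<Phi> = (\<lambda>s. J (W s))"
    have cont_lt1: "((\<lambda>h. \<Phi> (s + h)) \<longlongrightarrow> \<Phi> s) (at 0)" if s: "0 \<le> s" "s < 1" for s
    proof -
      have s1: "s \<le> 1" using s by simp
      have a: "((\<lambda>h. J (T (of_real (1 - (s + h)) * z) (\<lambda>y. U (s + h) y - U s y))) \<longlongrightarrow> 0) (at 0)"
      proof (rule J0)
        show "\<forall>\<^sub>F h in at 0. T (of_real (1 - (s + h)) * z) (\<lambda>y. U (s + h) y - U s y) \<in> Lp_space m p"
          using ev1[OF s(2)] by eventually_elim (intro LT Lp_space_diff(1) LU p0)
        show "((\<lambda>h. Lp_mass m p (T (of_real (1 - (s + h)) * z) (\<lambda>y. U (s + h) y - U s y))) \<longlongrightarrow> 0) (at 0)"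
        proof (rule T_tendsto_0[OF \<phi>(1,2) _ _ contU[OF s(1) s1]])
          show "\<forall>\<^sub>F h in at 0. of_real (1 - (s + h)) * z \<in> sector \<phi>"
            using ev1[OF s(2)] by eventually_elim (rule sec)
        qed (auto intro!: always_eventually Lp_space_diff(1) LU p0)
      qed
      have b: "((\<lambda>h. J (\<lambda>y. T (of_real (1 - (s + h)) * z) (U s) y - T (of_real (1 - s) * z) (U s) y)) \<longlongrightarrow> 0) (at 0)"
      proof (rule J0[OF _ contT[OF s(2) LU]])
        show "\<forall>\<^sub>F h in at 0. (\<lambda>y. T (of_real (1 - (s + h)) * z) (U s) y - T (of_real (1 - s) * z) (U s) y) \<in> Lp_space m p"
          using ev1[OF s(2)] by eventually_elim (intro LT Lp_space_diff(1) LU p0 s)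
      qed
      \<comment> \<open>T at the moving time acts on a small vector, then the time moves on the
        fixed vector U s. The first part is small by uniform boundedness, the second by strong
        continuity.\<close>
      have "\<forall>\<^sub>F h in at 0. \<Phi> (s + h) - \<Phi> s = J (T (of_real (1 - (s + h)) * z) (\<lambda>y. U (s + h) y - U s y)) +
          J (\<lambda>y. T (of_real (1 - (s + h)) * z) (U s) y - T (of_real (1 - s) * z) (U s) y)"
        using ev1[OF s(2)]
      proof eventually_elim
        case (elim h)
        have "J (T (of_real (1 - (s + h)) * z) (\<lambda>y. U (s + h) y - U s y)) =
          J (\<lambda>y. T (of_real (1 - (s + h)) * z) (U (s + h)) y - T (of_real (1 - (s + h)) * z) (U s) y)"
          using elim zt[of "1 - (s + h)"] by (intro Jcong T_diff LT Lp_space_diff(1) LU p0) auto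
        thus ?case using s elim by (simp add: \<Phi>_def W_def Jdiff LT LU del: of_real_diff of_real_add)
      qed
      moreover have "((\<lambda>h. J (T (of_real (1 - (s + h)) * z) (\<lambda>y. U (s + h) y - U s y)) +
          J (\<lambda>y. T (of_real (1 - (s + h)) * z) (U s) y - T (of_real (1 - s) * z) (U s) y)) \<longlongrightarrow> 0 + 0) (at 0)"
        by (intro tendsto_add a b)
      ultimately have "((\<lambda>h. \<Phi> (s + h) - \<Phi> s) \<longlongrightarrow> 0) (at 0)"
        by (simp add: tendsto_cong)
      thus ?thesis by (simp add: LIM_zero_iff)
    qed
    have cont_1: "(\<Phi> \<longlongrightarrow> \<Phi> 1) (at 1 within {0..1})"
    proof -
      have ev: "\<forall>\<^sub>F s in at 1 within {0..1::real}. 0 \<le> s \<and> s < 1"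
        unfolding eventually_at_filter by (rule always_eventually) auto
      have lim: "filterlim (\<lambda>s. s - 1) (at 0) (at 1 within {0..1::real})"
        by (auto simp: filterlim_at eventually_at_filter intro!: tendsto_eq_intros)
      have U1: "((\<lambda>s. Lp_mass m p (\<lambda>y. U s y - U 1 y)) \<longlongrightarrow> 0) (at 1 within {0..1})"
        using filterlim_compose[OF contU[of 1] lim] by simp
      have a: "((\<lambda>s. J (T (of_real (1 - s) * z) (\<lambda>y. U s y - U 1 y))) \<longlongrightarrow> 0) (at 1 within {0..1})"
      proof (rule J0)
        show "\<forall>\<^sub>F s in at 1 within {0..1}. T (of_real (1 - s) * z) (\<lambda>y. U s y - U 1 y) \<in> Lp_space m p"
          using ev by eventually_elim (auto intro!: LT Lp_space_diff(1) LU p0 simp del: of_real_diff)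
        show "((\<lambda>s. Lp_mass m p (T (of_real (1 - s) * z) (\<lambda>y. U s y - U 1 y))) \<longlongrightarrow> 0) (at 1 within {0..1})"
        proof (rule T_tendsto_0[OF \<phi>(1,2) _ _ U1])
          show "\<forall>\<^sub>F s in at 1 within {0..1}. of_real (1 - s) * z \<in> sector \<phi>"
            using ev by eventually_elim (auto intro!: sec simp del: of_real_diff)
        qed (auto intro!: always_eventually Lp_space_diff(1) LU p0)
      qed
      have lim2: "filterlim (\<lambda>s. of_real (1 - s) * z) (at 0 within sector \<phi>) (at 1 within {0..1})"
        unfolding filterlim_at
      proof
        show "\<forall>\<^sub>F s in at 1 within {0..1}. of_real (1 - s) * z \<in> sector \<phi> \<and> of_real (1 - s) * z \<noteq> 0"
          using ev by eventually_elim (use sec z0 in auto)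
        show "((\<lambda>s. of_real (1 - s) * z) \<longlongrightarrow> 0) (at 1 within {0..1})"
          by (auto intro!: tendsto_eq_intros)
      qed
      have b: "((\<lambda>s. J (\<lambda>y. T (of_real (1 - s) * z) (U 1) y - U 1 y)) \<longlongrightarrow> 0) (at 1 within {0..1})"
      proof (rule J0[OF _ filterlim_compose[OF T_strongly_continuous_0[OF \<phi>(1,2) LU] lim2]])
        show "\<forall>\<^sub>F s in at 1 within {0..1}. (\<lambda>y. T (of_real (1 - s) * z) (U 1) y - U 1 y) \<in> Lp_space m p"
          using ev by eventually_elim (auto intro!: LT Lp_space_diff(1) LU p0 simp del: of_real_diff)
      qed
      have "\<forall>\<^sub>F s in at 1 within {0..1}. \<Phi> s - \<Phi> 1 = J (T (of_real (1 - s) * z) (\<lambda>y. U s y - U 1 y)) +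
          J (\<lambda>y. T (of_real (1 - s) * z) (U 1) y - U 1 y)"
        using ev
      proof eventually_elim
        case (elim s)
        have "J (T (of_real (1 - s) * z) (\<lambda>y. U s y - U 1 y)) =
          J (\<lambda>y. T (of_real (1 - s) * z) (U s) y - T (of_real (1 - s) * z) (U 1) y)"
          using elim zt[of "1 - s"] by (intro Jcong T_diff LT Lp_space_diff(1) LU p0) auto
        thus ?case using elim by (simp add: \<Phi>_def W_def Jdiff LT LU del: of_real_diff of_real_add)
      qed
      moreover have "((\<lambda>s. J (T (of_real (1 - s) * z) (\<lambda>y. U s y - U 1 y)) +
          J (\<lambda>y. T (of_real (1 - s) * z) (U 1) y - U 1 y)) \<longlongrightarrow> 0 + 0) (at 1 within {0..1})"
        by (intro tendsto_add a b)
      ultimately have "((\<lambda>s. \<Phi> s - \<Phi> 1) \<longlongrightarrow> 0) (at 1 within {0..1})"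
        by (simp add: tendsto_cong)
      thus ?thesis by (simp add: LIM_zero_iff)
    qed
    have "continuous_on {0..1} \<Phi>"
      unfolding continuous_on_def
    proof
      fix s :: real assume "s \<in> {0..1}"
      then consider "s = 1" | "0 \<le> s" "s < 1" by fastforce
      thus "(\<Phi> \<longlongrightarrow> \<Phi> s) (at s within {0..1})"
      proof cases
        case 2
        have "(\<Phi> \<longlongrightarrow> \<Phi> s) (at s)" using cont_lt1[OF 2] by (simp add: LIM_offset_zero_iff)
        thus ?thesis by (rule tendsto_within_subset) auto
      qed (use cont_1 in simp)
    qed
    moreover have "(\<Phi> has_derivative (\<lambda>h. 0)) (at s within {0..1})" if "s \<in> {0..1} - {0, 1}" for s
    proof -
      have s: "0 < s" "s < 1" "0 \<le> s" "s \<le> 1" using that by auto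
      define \<sigma> where "\<sigma> = of_real (1 - s) * z"
      have \<sigma>: "Re \<sigma> > 0" using zt[of "1 - s"] s by (simp add: \<sigma>_def)
      define R where "R = (\<lambda>h y. (U (s + h) y - U s y) / of_real h - z * V s y)"
      have LR: "R h \<in> Lp_space m p" for h
        using Lp_space_diff(1)[OF Lp_space_cmult(1)[OF Lp_space_diff(1)[OF LU LU p0], of "1 / of_real h"] Lp_space_cmult(1)[OF LV[OF s(3,4)]] p0]
        by (simp add: R_def)
      have LVz: "(\<lambda>y. z * V s y) \<in> Lp_space m p" by (rule Lp_space_cmult(1)[OF LV[OF s(3,4)]])
      have a: "((\<lambda>h. J (T (of_real (1 - (s + h)) * z) (R h))) \<longlongrightarrow> 0) (at 0)"
      proof (rule J0)
        show "\<forall>\<^sub>F h in at 0. T (of_real (1 - (s + h)) * z) (R h) \<in> Lp_space m p"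
          using ev1[OF s(2)] by eventually_elim (intro LT LR)
        show "((\<lambda>h. Lp_mass m p (T (of_real (1 - (s + h)) * z) (R h))) \<longlongrightarrow> 0) (at 0)"
        proof (rule T_tendsto_0[OF \<phi>(1,2)])
          show "\<forall>\<^sub>F h in at 0. of_real (1 - (s + h)) * z \<in> sector \<phi>"
            using ev1[OF s(2)] by eventually_elim (rule sec)
          show "((\<lambda>h. Lp_mass m p (R h)) \<longlongrightarrow> 0) (at 0)" unfolding R_def by (rule der[OF s(3,4)])
        qed (auto intro!: always_eventually LR)
      qed
      have b: "((\<lambda>h. J (\<lambda>y. T (of_real (1 - (s + h)) * z) (\<lambda>y. z * V s y) y - T \<sigma> (\<lambda>y. z * V s y) y)) \<longlongrightarrow> 0) (at 0)"
      proof (rule J0[OF _ contT[OF s(2) LVz, folded \<sigma>_def]])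
        show "\<forall>\<^sub>F h in at 0. (\<lambda>y. T (of_real (1 - (s + h)) * z) (\<lambda>y. z * V s y) y - T \<sigma> (\<lambda>y. z * V s y) y) \<in> Lp_space m p"
          using ev1[OF s(2)] by eventually_elim (unfold \<sigma>_def, intro LT Lp_space_diff(1) LVz p0 s)
      qed
      define Q where "Q = (\<lambda>h y. (T (\<sigma> + (- (of_real h * z))) (U s) y - T \<sigma> (U s) y) / (- (of_real h * z)) - T \<sigma> (V s) y)"
      have LQ: "\<forall>\<^sub>F h in at 0. Q h \<in> Lp_space m p"
        using ev1[OF s(2)]
      proof eventually_elim
        case (elim h)
        have "(\<lambda>y. T (\<sigma> + (- (of_real h * z))) (U s) y - T \<sigma> (U s) y) \<in> Lp_space m p"
          unfolding \<sigma>_def shift[symmetric] by (intro Lp_space_diff(1) LT LU elim s p0)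
        from Lp_space_diff(1)[OF Lp_space_cmult(1)[OF this, of "1 / (- (of_real h * z))"] T_Lp[OF \<sigma> LV[OF s(3,4)]] p0]
        show ?case by (simp add: Q_def)
      qed
      have c: "((\<lambda>h. J (Q h)) \<longlongrightarrow> 0) (at 0)"
      proof (rule J0[OF LQ])
        show "((\<lambda>h. Lp_mass m p (Q h)) \<longlongrightarrow> 0) (at 0)"
          unfolding Q_def
          by (rule filterlim_compose[OF T_deriv_domain[OF \<sigma> LU LV[OF s(3,4)] gen[OF s(1,2)]] limk])
      qed
      \<comment> \<open>The product rule with remainders: R for the curve, Q for the semigroup with
        the increment - h z, and the change of T on the fixed vector z V. The two main terms, z T V
        from the curve and its negative from the semigroup, have cancelled.\<close>
      have "\<forall>\<^sub>F h in at 0. (\<Phi> (s + h) - \<Phi> s) / of_real h = J (T (of_real (1 - (s + h)) * z) (R h)) +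
          J (\<lambda>y. T (of_real (1 - (s + h)) * z) (\<lambda>y. z * V s y) y - T \<sigma> (\<lambda>y. z * V s y) y) + (- z) * J (Q h)"
        using ev1[OF s(2)] LQ eventually_neq_at_within[of 0 0 UNIV]
      proof eventually_elim
        case (elim h)
        let ?S = "of_real (1 - (s + h)) * z"
        have S: "Re ?S > 0" using zt[of "1 - (s + h)"] elim by simp
        have Sk: "?S = \<sigma> + (- (of_real h * z))" unfolding \<sigma>_def by (rule shift)
        have LD: "(\<lambda>y. U (s + h) y - U s y) \<in> Lp_space m p" by (rule Lp_space_diff(1)[OF LU LU p0])
        have ae1: "AE y in half_line. T ?S (R h) y = 1 / of_real h * T ?S (\<lambda>y. U (s + h) y - U s y) y + (-1) * T ?S (\<lambda>y. z * V s y) y"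
          using T_linear[OF S LD LVz, of "1 / of_real h" "-1"] by (simp add: R_def)
        have ae2: "AE y in half_line. T ?S (\<lambda>y. U (s + h) y - U s y) y = T ?S (U (s + h)) y - T ?S (U s) y"
          by (rule T_diff[OF S LU LU])
        have ae3: "AE y in half_line. T \<sigma> (\<lambda>y. z * V s y) y = z * T \<sigma> (V s) y"
          by (rule T_cmult[OF \<sigma> LV[OF s(3,4)]])
        have L1: "T ?S (R h) \<in> Lp_space m p" by (intro T_Lp S LR)
        have L2: "(\<lambda>y. T ?S (\<lambda>y. z * V s y) y - T \<sigma> (\<lambda>y. z * V s y) y) \<in> Lp_space m p"
          by (intro Lp_space_diff(1) T_Lp S \<sigma> LVz p0)
        have L3: "(\<lambda>y. (- z) * Q h y) \<in> Lp_space m p" by (rule Lp_space_cmult(1)[OF elim(2)])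
        have L0: "(\<lambda>y. W (s + h) y - W s y) \<in> Lp_space m p" by (intro Lp_space_diff(1) LW p0)
        have "(\<Phi> (s + h) - \<Phi> s) / of_real h = J (\<lambda>y. 1 / of_real h * (W (s + h) y - W s y))"
          unfolding Jc by (simp add: \<Phi>_def Jdiff LW)
        also have "\<dots> = J (\<lambda>y. (T ?S (R h) y + (T ?S (\<lambda>y. z * V s y) y - T \<sigma> (\<lambda>y. z * V s y) y)) + (- z) * Q h y)"
        proof (rule Jcong)
          have Ws: "W s = T \<sigma> (U s)" "W (s + h) = T ?S (U (s + h))" using s elim by (auto simp: W_def \<sigma>_def)
          show "AE y in half_line. 1 / of_real h * (W (s + h) y - W s y) =
             (T ?S (R h) y + (T ?S (\<lambda>y. z * V s y) y - T \<sigma> (\<lambda>y. z * V s y) y)) + (- z) * Q h y"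
            using ae1 ae2 ae3
          proof eventually_elim
            case (elim y)
            have "(- z) * Q h y = (T ?S (U s) y - T \<sigma> (U s) y) / of_real h + z * T \<sigma> (V s) y"
              unfolding Q_def Sk[symmetric] using z0 \<open>h \<noteq> 0\<close> by (simp add: field_simps)
            thus ?case unfolding Ws elim using \<open>h \<noteq> 0\<close> by (simp add: field_simps)
          qed
        qed (intro Lp_space_cmult(1) Lp_space_add(1) L0 L1 L2 L3 p0)+
        also have "\<dots> = J (T ?S (R h)) + J (\<lambda>y. T ?S (\<lambda>y. z * V s y) y - T \<sigma> (\<lambda>y. z * V s y) y) + (- z) * J (Q h)"
          by (subst Jadd[OF Lp_space_add(1)[OF L1 L2 p0] L3], subst Jadd[OF L1 L2], subst Jc) (rule refl)
        finally show ?case .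
      qed
      moreover have "((\<lambda>h. J (T (of_real (1 - (s + h)) * z) (R h)) +
          J (\<lambda>y. T (of_real (1 - (s + h)) * z) (\<lambda>y. z * V s y) y - T \<sigma> (\<lambda>y. z * V s y) y) + (- z) * J (Q h)) \<longlongrightarrow> 0 + 0 + (-z) * 0) (at 0)"
        by (intro tendsto_add tendsto_mult_left a b c)
      ultimately have D: "((\<lambda>h. (\<Phi> (s + h) - \<Phi> s) / of_real h) \<longlongrightarrow> 0) (at 0)"
        by (simp add: tendsto_cong)
      have "(\<Phi> has_vector_derivative 0) (at s)"
        unfolding has_vector_derivative_def has_derivative_at
      proof (intro conjI)
        have "((\<lambda>h. norm ((\<Phi> (s + h) - \<Phi> s) / of_real h)) \<longlongrightarrow> 0) (at 0)" using D by (rule tendsto_norm_zero)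
        thus "(\<lambda>h. norm (\<Phi> (s + h) - \<Phi> s - h *\<^sub>R 0) / norm h) \<midarrow>0\<rightarrow> 0"
          by (simp add: norm_divide)
      qed auto
      thus ?thesis unfolding has_vector_derivative_def by (simp add: has_derivative_at_withinI)
    qed
    \<comment> \<open>Continuity on the closed interval allows the derivative to be known only off
      the two end points.\<close>
    ultimately have "\<Phi> 1 = \<Phi> 0"
      by (intro has_derivative_zero_unique_strong_interval[of "{0, 1}" 0 1 \<Phi> "\<Phi> 0" 1]) auto
    thus ?thesis by (simp add: \<Phi>_def W_def J_def)
  qed
  have TU: "T z (U 0) \<in> Lp_space m p" by (rule T_Lp[OF z LU])
  have "AE y in half_line. T z (U 0) y - U 1 y = 0"
  proof (rule AE_zero_of_interval_integrals)
    fix l r :: real assume lr: "0 < l" "l < r"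
    show "integrable half_line (\<lambda>y. indicator {l<..<r} y * (T z (U 0) y - U 1 y))"
      by (rule Lp_interval_integrable[OF p Lp_space_diff(1)[OF TU LU p0] lr])
    show "(LINT y|half_line. indicator {l<..<r} y * (T z (U 0) y - U 1 y)) = 0"
      using interval_functional_diff[OF p TU LU[of 1] lr] main[OF lr] by (simp add: interval_functional_def)
  qed
  thus ?thesis by simp
qed

end

subsection \<open>Gaussian orbits\<close>

lemma gaussian_Lp:
  fixes \<gamma> \<delta> m p :: real
  assumes "p > 0" "\<delta> > 0" "\<gamma> * p + m > -1"
  shows "(\<lambda>y. of_real (K * (y powr \<gamma> * exp (- (\<delta> * y\<^sup>2)))) :: complex) \<in> Lp_space m p"
proof -
  define \<mu> where "\<mu> = (\<gamma> * p + m + 1) / 2"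
  have \<mu>: "\<mu> > 0" "2 * \<mu> - 1 = m + \<gamma> * p" using assms by (auto simp: \<mu>_def field_simps)
  have e: "y powr m * norm (complex_of_real (y powr \<gamma> * exp (- (\<delta> * y\<^sup>2)))) powr p =
     y powr (2 * \<mu> - 1) * exp (- (p * \<delta> * y\<^sup>2))" for y
    unfolding \<mu>(2) norm_of_real abs_mult using assms(1)
    by (simp add: powr_add powr_mult powr_powr exp_powr_real mult_ac)
  have "integrable half_line (\<lambda>y. y powr m * norm (complex_of_real (y powr \<gamma> * exp (- (\<delta> * y\<^sup>2)))) powr p)"
    unfolding e by (rule gaussian_moment_real(1)) (use assms \<mu> in auto)
  moreover have "(\<lambda>y. complex_of_real (y powr \<gamma> * exp (- (\<delta> * y\<^sup>2)))) \<in> borel_measurable half_line"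
    by (rule continuous_imp_measurable_on_sets_lebesgue) (auto intro!: continuous_intros)
  ultimately have "(\<lambda>y. complex_of_real (y powr \<gamma> * exp (- (\<delta> * y\<^sup>2)))) \<in> Lp_space m p"
    by (simp add: Lp_space_iff)
  from Lp_space_cmult(1)[OF this, of "of_real K"] show ?thesis by simp
qed

text \<open>Two arguments of modulus below pi / 2 have a sum of modulus below pi, so the principal
  logarithm is additive.\<close>

lemma powr_mult_Re_pos:
  assumes "Re u > 0" "Re w > 0"
  shows "(u * w) powr s = u powr s * (w powr s :: complex)"
proof -
  have "u \<noteq> 0" "w \<noteq> 0" using assms by auto
  moreover have "\<bar>Im (Ln u)\<bar> < pi / 2" "\<bar>Im (Ln w)\<bar> < pi / 2" using assms Re_Ln_pos_lt_imp by auto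
  ultimately have "Ln (u * w) = Ln u + Ln w" by (intro Ln_times_simple) auto
  thus ?thesis using \<open>u \<noteq> 0\<close> \<open>w \<noteq> 0\<close> by (simp add: powr_def exp_add[symmetric] algebra_simps)
qed

lemma powr_inverse_Re_pos:
  assumes "Re v > 0"
  shows "(1 / v) powr s = v powr (- s :: complex)"
proof -
  have "v \<noteq> 0" "v \<notin> \<real>\<^sub>\<le>\<^sub>0" using assms by (auto simp: complex_nonpos_Reals_iff)
  hence "Ln (1 / v) = - Ln v" using Ln_inverse[of v] by (simp add: inverse_eq_divide)
  thus ?thesis using \<open>v \<noteq> 0\<close> by (simp add: powr_def)
qed

lemma Re_quarter_inverse_pos: "Re v > 0 \<Longrightarrow> Re (1 / (4 * v)) > 0"
  by (simp add: Re_divide) (intro divide_pos_pos add_pos_nonneg; simp)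

text \<open>With \<open>a = - s1\<close> this solves \<open>\<partial>u / \<partial>v = L u\<close> in the complex time variable \<open>v\<close>.\<close>

definition gauss_orbit :: "real \<Rightarrow> real \<Rightarrow> complex \<Rightarrow> real \<Rightarrow> complex" where
  "gauss_orbit \<nu> a v y = v powr (- of_real (\<nu> + 1)) * of_real (y powr a) * exp (- (of_real (y\<^sup>2) / (4 * v)))"

definition gauss_orbit_deriv :: "real \<Rightarrow> real \<Rightarrow> complex \<Rightarrow> real \<Rightarrow> complex" where
  "gauss_orbit_deriv \<nu> a v y = gauss_orbit \<nu> a v y * (of_real (y\<^sup>2) / (4 * v\<^sup>2) - of_real (\<nu> + 1) / v)"

lemma gauss_orbit_has_field_derivative:
  assumes "Re v > 0"
  shows "((\<lambda>v. gauss_orbit \<nu> a v y) has_field_derivative gauss_orbit_deriv \<nu> a v y) (at v)"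
proof -
  have v: "v \<noteq> 0" "v \<notin> \<real>\<^sub>\<le>\<^sub>0" using assms by (auto simp: complex_nonpos_Reals_iff)
  define s where "s = - complex_of_real (\<nu> + 1)"
  have 1: "((\<lambda>v. v powr s) has_field_derivative s * v powr (s - 1)) (at v)"
    by (rule has_field_derivative_powr[OF v(2)])
  have 2: "((\<lambda>v. exp (- (of_real (y\<^sup>2) / (4 * v)))) has_field_derivative exp (- (of_real (y\<^sup>2) / (4 * v))) * (of_real (y\<^sup>2) / (4 * v\<^sup>2))) (at v)"
    using v by (auto intro!: derivative_eq_intros simp: field_simps power2_eq_square)
  have 3: "((\<lambda>v. v powr s * of_real (y powr a)) has_field_derivative (s * v powr (s - 1)) * of_real (y powr a)) (at v)"
    by (rule DERIV_cmult_right[OF 1])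
  have "((\<lambda>v. v powr s * of_real (y powr a) * exp (- (of_real (y\<^sup>2) / (4 * v)))) has_field_derivative
     (s * v powr (s - 1)) * of_real (y powr a) * exp (- (of_real (y\<^sup>2) / (4 * v)))
     + exp (- (of_real (y\<^sup>2) / (4 * v))) * (of_real (y\<^sup>2) / (4 * v\<^sup>2)) * (v powr s * of_real (y powr a))) (at v)"
    by (rule DERIV_mult[OF 3 2])
  moreover have "v powr (s - 1) = v powr s / v" using v by (simp add: powr_diff)
  ultimately show ?thesis
  proof -
    assume d: "((\<lambda>v. v powr s * of_real (y powr a) * exp (- (of_real (y\<^sup>2) / (4 * v)))) has_field_derivative
     (s * v powr (s - 1)) * of_real (y powr a) * exp (- (of_real (y\<^sup>2) / (4 * v)))
     + exp (- (of_real (y\<^sup>2) / (4 * v))) * (of_real (y\<^sup>2) / (4 * v\<^sup>2)) * (v powr s * of_real (y powr a))) (at v)"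
      and p: "v powr (s - 1) = v powr s / v"
    have e: "complex_of_real (\<nu> + 1) = - s" by (simp add: s_def)
    show ?thesis
      unfolding gauss_orbit_deriv_def gauss_orbit_def e minus_minus
      by (rule DERIV_cong[OF d]) (simp add: p algebra_simps)
  qed
qed

text \<open>The bounds are uniform for times in a disc, as a dominating function for difference
  quotients in v must be. On a closed disc inside the half-plane the prefactors are bounded and Re
  (1 / (4 v')) has a positive minimum \<delta>.\<close>

lemma gauss_orbit_bounds:
  assumes "Re v > 0"
  obtains r K \<delta> where "r > 0" "K > 0" "\<delta> > 0"
    "\<And>v' y. v' \<in> ball v r \<Longrightarrow> Re v' > 0"
    "\<And>v' y. v' \<in> ball v r \<Longrightarrow> norm (gauss_orbit \<nu> a v' y) \<le> K * (y powr a * exp (- (\<delta> * y\<^sup>2)))"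
    "\<And>v' y. v' \<in> ball v r \<Longrightarrow> norm (gauss_orbit_deriv \<nu> a v' y) \<le> K * ((1 + y\<^sup>2) * (y powr a * exp (- (\<delta> * y\<^sup>2))))"
proof -
  define r where "r = Re v / 2"
  define S where "S = cball v r"
  have r: "r > 0" using assms by (simp add: r_def)
  have Re: "Re v' > 0" if "v' \<in> S" for v'
  proof -
    have "Re (v - v') \<le> r" using that complex_Re_le_cmod[of "v - v'"] by (simp add: S_def dist_norm)
    thus ?thesis using assms by (simp add: r_def field_simps)
  qed
  have nz: "v' \<noteq> 0" "v' \<notin> \<real>\<^sub>\<le>\<^sub>0" if "v' \<in> S" for v' using Re[OF that] by (auto simp: complex_nonpos_Reals_iff)
  have S: "compact S" "v \<in> S" using r by (auto simp: S_def)
  \<comment> \<open>One continuous function that bounds the time-dependent prefactors of the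
    Gaussian and of its time derivative.\<close>
  define \<Psi> where "\<Psi> = (\<lambda>v'. norm (v' powr (- complex_of_real (\<nu> + 1))) + norm (v' powr (- complex_of_real (\<nu> + 1))) * (norm (1 / (4 * v'\<^sup>2)) + norm (of_real (\<nu> + 1) / v')))"
  have "continuous_on S \<Psi>" unfolding \<Psi>_def using nz Re
    by (intro continuous_intros) (auto dest: less_imp_le)
  then obtain v1 where v1: "v1 \<in> S" "\<And>v'. v' \<in> S \<Longrightarrow> \<Psi> v' \<le> \<Psi> v1"
    using continuous_attains_sup[OF S(1)] S(2) by blast
  have "continuous_on S (\<lambda>v'. Re (1 / (4 * v')))" using nz by (intro continuous_intros) auto
  then obtain v2 where v2: "v2 \<in> S" "\<And>v'. v' \<in> S \<Longrightarrow> Re (1 / (4 * v2)) \<le> Re (1 / (4 * v'))"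
    using continuous_attains_inf[OF S(1)] S(2) by blast
  define \<delta> where "\<delta> = Re (1 / (4 * v2))"
  have \<delta>: "\<delta> > 0" unfolding \<delta>_def by (rule Re_quarter_inverse_pos[OF Re[OF v2(1)]])
  define K where "K = \<Psi> v1 + 1"
  have \<Psi>0: "\<Psi> v' \<ge> 0" for v' unfolding \<Psi>_def by (intro add_nonneg_nonneg mult_nonneg_nonneg) auto
  have K: "K > 0" using \<Psi>0[of v1] by (simp add: K_def)
  have nE: "norm (exp (- (complex_of_real (y\<^sup>2) / (4 * v')))) \<le> exp (- (\<delta> * y\<^sup>2))" if "v' \<in> S" for v' y
  proof -
    have "Re (complex_of_real (y\<^sup>2) / (4 * v')) = y\<^sup>2 * Re (1 / (4 * v'))"
    proof -
      have "complex_of_real (y\<^sup>2) / (4 * v') = of_real (y\<^sup>2) * (1 / (4 * v'))" by simp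
      thus ?thesis by (simp only: times_complex.sel Re_complex_of_real Im_complex_of_real mult_zero_left diff_zero)
    qed
    moreover have "\<delta> * y\<^sup>2 \<le> y\<^sup>2 * Re (1 / (4 * v'))"       using mult_left_mono[OF v2(2)[OF that], of "y\<^sup>2"] by (simp add: \<delta>_def mult.commute)
    ultimately show ?thesis by simp
  qed
  have n1: "norm (v' powr (- complex_of_real (\<nu> + 1))) \<le> K" if "v' \<in> S" for v'
  proof -
    have "norm (v' powr (- complex_of_real (\<nu> + 1))) \<le> \<Psi> v'" by (simp add: \<Psi>_def)
    thus ?thesis using v1(2)[OF that] by (simp add: K_def)
  qed
  have n2: "norm (v' powr (- complex_of_real (\<nu> + 1))) * (norm (1 / (4 * v'\<^sup>2)) + norm (of_real (\<nu> + 1) / v')) \<le> K" if "v' \<in> S" for v'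
  proof -
    have "norm (v' powr (- complex_of_real (\<nu> + 1))) * (norm (1 / (4 * v'\<^sup>2)) + norm (of_real (\<nu> + 1) / v')) \<le> \<Psi> v'" by (simp add: \<Psi>_def)
    thus ?thesis using v1(2)[OF that] by (simp add: K_def)
  qed
  show ?thesis
  proof (rule that[OF r K \<delta>])
    fix v' and y :: real assume "v' \<in> ball v r"
    hence v': "v' \<in> S" by (auto simp: S_def)
    show "Re v' > 0" by (rule Re[OF v'])
    have "norm (gauss_orbit \<nu> a v' y) = norm (v' powr (- complex_of_real (\<nu> + 1))) * y powr a * norm (exp (- (complex_of_real (y\<^sup>2) / (4 * v'))))"
      unfolding gauss_orbit_def norm_mult norm_of_real by simp
    also have "\<dots> \<le> K * y powr a * exp (- (\<delta> * y\<^sup>2))"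
      by (intro mult_mono mult_right_mono n1 nE v') (use K in auto)
    finally show "norm (gauss_orbit \<nu> a v' y) \<le> K * (y powr a * exp (- (\<delta> * y\<^sup>2)))" by simp
    have "norm (of_real (y\<^sup>2) / (4 * v'\<^sup>2) - of_real (\<nu> + 1) / v') \<le> y\<^sup>2 * norm (1 / (4 * v'\<^sup>2)) + norm (of_real (\<nu> + 1) / v')"
      by (rule order.trans[OF norm_triangle_ineq4]) (simp add: norm_divide norm_mult norm_power)
    also have "\<dots> \<le> (1 + y\<^sup>2) * (norm (1 / (4 * v'\<^sup>2)) + norm (of_real (\<nu> + 1) / v'))"
      by (simp only: distrib_left distrib_right mult_1) simp
    finally have b: "norm (of_real (y\<^sup>2) / (4 * v'\<^sup>2) - of_real (\<nu> + 1) / v') \<le> (1 + y\<^sup>2) * (norm (1 / (4 * v'\<^sup>2)) + norm (of_real (\<nu> + 1) / v'))" .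
    have "norm (gauss_orbit_deriv \<nu> a v' y) = norm (v' powr (- complex_of_real (\<nu> + 1))) * y powr a * norm (exp (- (complex_of_real (y\<^sup>2) / (4 * v')))) * norm (of_real (y\<^sup>2) / (4 * v'\<^sup>2) - of_real (\<nu> + 1) / v')"
      unfolding gauss_orbit_deriv_def gauss_orbit_def norm_mult[of _ "_ - _"] norm_mult[of "_ * _"] norm_mult[of "_ powr _"] norm_of_real by simp
    also have "\<dots> \<le> norm (v' powr (- complex_of_real (\<nu> + 1))) * y powr a * exp (- (\<delta> * y\<^sup>2)) * ((1 + y\<^sup>2) * (norm (1 / (4 * v'\<^sup>2)) + norm (of_real (\<nu> + 1) / v')))"
      by (intro mult_mono mult_left_mono nE v' b) auto
    also have "\<dots> = (norm (v' powr (- complex_of_real (\<nu> + 1))) * (norm (1 / (4 * v'\<^sup>2)) + norm (of_real (\<nu> + 1) / v'))) * ((1 + y\<^sup>2) * (y powr a * exp (- (\<delta> * y\<^sup>2))))"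
      by (simp only: mult_ac)
    also have "\<dots> \<le> K * ((1 + y\<^sup>2) * (y powr a * exp (- (\<delta> * y\<^sup>2))))"
      by (intro mult_right_mono n2 v') auto
    finally show "norm (gauss_orbit_deriv \<nu> a v' y) \<le> K * ((1 + y\<^sup>2) * (y powr a * exp (- (\<delta> * y\<^sup>2))))" .
  qed
qed

lemma gauss_orbit_continuous:
  "continuous_on {0<..} (gauss_orbit \<nu> a v)" "continuous_on {0<..} (gauss_orbit_deriv \<nu> a v)"
  unfolding gauss_orbit_deriv_def[abs_def] gauss_orbit_def[abs_def] divide_inverse by (auto intro!: continuous_intros)

lemma gauss_orbit_measurable:
  "gauss_orbit \<nu> a v \<in> borel_measurable half_line" "gauss_orbit_deriv \<nu> a v \<in> borel_measurable half_line"
  using gauss_orbit_continuous by (auto intro!: continuous_imp_measurable_on_sets_lebesgue)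

text \<open>Expanding 1 + y^2 gives two Gaussians with the powers a and a + 2; the first decides
  integrability at 0.\<close>

lemma gauss_orbit_dominating_Lp:
  assumes "p > 0" "\<delta> > 0" "a * p + m > -1"
  shows "(\<lambda>y. of_real (K * ((1 + y\<^sup>2) * (y powr a * exp (- (\<delta> * y\<^sup>2))))) :: complex) \<in> Lp_space m p"
proof -
  have 2: "(a + 2) * p + m > -1" using assms(1,3) by (simp add: distrib_right)
  have "(\<lambda>y. of_real (K * (y powr a * exp (- (\<delta> * y\<^sup>2)))) + of_real (K * (y powr (a + 2) * exp (- (\<delta> * y\<^sup>2)))) :: complex) \<in> Lp_space m p"
    by (intro Lp_space_add(1) gaussian_Lp assms 2)
  moreover have "AE y in half_line. norm (complex_of_real (K * ((1 + y\<^sup>2) * (y powr a * exp (- (\<delta> * y\<^sup>2)))))) \<le>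
     norm (of_real (K * (y powr a * exp (- (\<delta> * y\<^sup>2)))) + of_real (K * (y powr (a + 2) * exp (- (\<delta> * y\<^sup>2)))) :: complex)"
  proof (rule AE_I2)
    fix y assume "y \<in> space half_line"
    hence y: "y > 0" by simp
    have "y powr (a + 2) = y powr a * y\<^sup>2" using y by (simp add: powr_add)
    hence h: "K * ((1 + y\<^sup>2) * (y powr a * exp (- (\<delta> * y\<^sup>2)))) = K * (y powr a * exp (- (\<delta> * y\<^sup>2))) + K * (y powr (a + 2) * exp (- (\<delta> * y\<^sup>2)))"
      by (simp add: algebra_simps)
    show "norm (complex_of_real (K * ((1 + y\<^sup>2) * (y powr a * exp (- (\<delta> * y\<^sup>2)))))) \<le>
     norm (of_real (K * (y powr a * exp (- (\<delta> * y\<^sup>2)))) + of_real (K * (y powr (a + 2) * exp (- (\<delta> * y\<^sup>2)))) :: complex)"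
      by (subst h, subst of_real_add[symmetric], rule order_refl)
  qed
  moreover have "continuous_on {0<..} (\<lambda>y. K * ((1 + y\<^sup>2) * (y powr a * exp (- (\<delta> * y\<^sup>2)))))"
    by (intro continuous_intros) auto
  hence "(\<lambda>y. complex_of_real (K * ((1 + y\<^sup>2) * (y powr a * exp (- (\<delta> * y\<^sup>2)))))) \<in> borel_measurable half_line"
    by (intro continuous_imp_measurable_on_sets_lebesgue continuous_on_of_real) auto
  ultimately show ?thesis
    by - (rule Lp_space_dominated(1)[OF _ assms(1)])
qed

lemma gauss_orbit_Lp:
  assumes "p > 0" "a * p + m > -1" "Re v > 0"
  shows "gauss_orbit \<nu> a v \<in> Lp_space m p" "gauss_orbit_deriv \<nu> a v \<in> Lp_space m p"
proof -
  obtain r K \<delta> where r: "r > 0" "K > 0" "\<delta> > 0"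
    "\<And>v' y. v' \<in> ball v r \<Longrightarrow> norm (gauss_orbit \<nu> a v' y) \<le> K * (y powr a * exp (- (\<delta> * y\<^sup>2)))"
    "\<And>v' y. v' \<in> ball v r \<Longrightarrow> norm (gauss_orbit_deriv \<nu> a v' y) \<le> K * ((1 + y\<^sup>2) * (y powr a * exp (- (\<delta> * y\<^sup>2))))"
    using gauss_orbit_bounds[OF assms(3), of \<nu> a] by metis
  have v: "v \<in> ball v r" using r by simp
  show "gauss_orbit \<nu> a v \<in> Lp_space m p"
    by (rule Lp_space_dominated(1)[OF gauss_orbit_measurable(1) assms(1) gaussian_Lp[OF assms(1) r(3) assms(2), of K]])
       (rule AE_I2, rule order.trans[OF r(4)[OF v]], simp only: norm_of_real abs_ge_self)
  show "gauss_orbit_deriv \<nu> a v \<in> Lp_space m p"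
    by (rule Lp_space_dominated(1)[OF gauss_orbit_measurable(2) assms(1) gauss_orbit_dominating_Lp[OF assms(1) r(3) assms(2), of K]])
       (rule AE_I2, rule order.trans[OF r(5)[OF v]], simp only: norm_of_real abs_ge_self)
qed

text \<open>The mean value inequality on a disc around v bounds the difference quotients by the
  locally uniform bound on the derivative. Dominated convergence then applies along sequences of
  increments.\<close>

lemma gauss_orbit_differentiable_Lp:
  assumes "p > 0" "a * p + m > -1" "Re v > 0"
  shows "((\<lambda>k. Lp_mass m p (\<lambda>y. (gauss_orbit \<nu> a (v + k) y - gauss_orbit \<nu> a v y) / k - gauss_orbit_deriv \<nu> a v y)) \<longlongrightarrow> 0) (at 0)"
proof -
  obtain r K \<delta> where r: "r > 0" "K > 0" "\<delta> > 0"
    "\<And>v'. v' \<in> ball v r \<Longrightarrow> Re v' > 0"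
    "\<And>v' y. v' \<in> ball v r \<Longrightarrow> norm (gauss_orbit_deriv \<nu> a v' y) \<le> K * ((1 + y\<^sup>2) * (y powr a * exp (- (\<delta> * y\<^sup>2))))"
    using gauss_orbit_bounds[OF assms(3), of \<nu> a] by metis
  have "((\<lambda>k. Lp_mass m p (\<lambda>y. (gauss_orbit \<nu> a (v + k) y - gauss_orbit \<nu> a v y) / k - gauss_orbit_deriv \<nu> a v y)) \<longlongrightarrow> 0) (at 0 within ball 0 r)"
    unfolding tendsto_at_iff_sequentially comp_def
  proof (intro allI impI)
    fix X :: "nat \<Rightarrow> complex" assume X: "\<forall>i. X i \<in> ball 0 r - {0}" "X \<longlonglongrightarrow> 0"
    show "(\<lambda>i. Lp_mass m p (\<lambda>y. (gauss_orbit \<nu> a (v + X i) y - gauss_orbit \<nu> a v y) / X i - gauss_orbit_deriv \<nu> a v y)) \<longlonglongrightarrow> 0"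
    proof (rule Lp_dominated_convergence(3)[OF assms(1) gauss_orbit_dominating_Lp[OF assms(1) r(3) assms(2), of K]])
      show "(\<lambda>y. (gauss_orbit \<nu> a (v + X i) y - gauss_orbit \<nu> a v y) / X i) \<in> borel_measurable half_line" for i
        using gauss_orbit_measurable(1)[of \<nu> a v] gauss_orbit_measurable(1)[of \<nu> a "v + X i"] by measurable
      show "gauss_orbit_deriv \<nu> a v \<in> borel_measurable half_line" by (rule gauss_orbit_measurable)
      show "AE y in half_line. norm ((gauss_orbit \<nu> a (v + X i) y - gauss_orbit \<nu> a v y) / X i) \<le>
          norm (complex_of_real (K * ((1 + y\<^sup>2) * (y powr a * exp (- (\<delta> * y\<^sup>2))))))" for i
      proof (rule AE_I2)
        fix y :: real
        let ?B = "K * ((1 + y\<^sup>2) * (y powr a * exp (- (\<delta> * y\<^sup>2))))"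
        have Xi: "X i \<noteq> 0" "norm (X i) < r" using X(1) by auto
        have "norm (gauss_orbit \<nu> a (v + X i) y - gauss_orbit \<nu> a v y) \<le> ?B * norm (v + X i - v)"
        proof (rule field_differentiable_bound[of "ball v r" "\<lambda>v. gauss_orbit \<nu> a v y" "\<lambda>v. gauss_orbit_deriv \<nu> a v y"])
          show "((\<lambda>v. gauss_orbit \<nu> a v y) has_field_derivative gauss_orbit_deriv \<nu> a v' y) (at v' within ball v r)" if "v' \<in> ball v r" for v'
            by (rule has_field_derivative_at_within[OF gauss_orbit_has_field_derivative[OF r(4)[OF that]]])
        qed (use r Xi in \<open>auto simp: dist_norm\<close>)
        hence "norm ((gauss_orbit \<nu> a (v + X i) y - gauss_orbit \<nu> a v y) / X i) \<le> ?B"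
          using Xi by (simp add: norm_divide divide_le_eq)
        thus "norm ((gauss_orbit \<nu> a (v + X i) y - gauss_orbit \<nu> a v y) / X i) \<le> norm (complex_of_real ?B)"
          unfolding norm_of_real by linarith
      qed
      show "AE y in half_line. (\<lambda>i. (gauss_orbit \<nu> a (v + X i) y - gauss_orbit \<nu> a v y) / X i) \<longlonglongrightarrow> gauss_orbit_deriv \<nu> a v y"
      proof (rule AE_I2)
        fix y :: real
        have "((\<lambda>k. (gauss_orbit \<nu> a (v + k) y - gauss_orbit \<nu> a v y) / k) \<longlongrightarrow> gauss_orbit_deriv \<nu> a v y) (at 0)"
          using gauss_orbit_has_field_derivative[OF assms(3), of \<nu> a y] by (simp add: DERIV_def)
        thus "(\<lambda>i. (gauss_orbit \<nu> a (v + X i) y - gauss_orbit \<nu> a v y) / X i) \<longlonglongrightarrow> gauss_orbit_deriv \<nu> a v y"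
          using X unfolding tendsto_at_iff_sequentially comp_def by auto
      qed
    qed
  qed
  thus ?thesis using r(1) by (simp add: at_within_open[of 0 "ball 0 r"])
qed

text \<open>The exponent a = - s1 solves a^2 + (c - 1) a - b = 0, which removes the term in y^{-2}
  from L applied to the Gaussian. The coefficient of 1 / v is - (2 a + 1 + c) / 2 = - (\<nu> + 1),
  as produced by the time derivative of v^{-\<nu>-1}.\<close>

lemma gauss_orbit_L_op:
  fixes b c :: real
  assumes D: "discr b c \<ge> 0" and v: "Re v > 0"
  defines "\<nu> \<equiv> sqrt (discr b c)" and "a \<equiv> - s1 b c"
  shows "AE y in half_line. L_op b c (gauss_orbit \<nu> a v) y = gauss_orbit_deriv \<nu> a v y"
    and "L_op b c (gauss_orbit \<nu> a v) \<in> borel_measurable half_line"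
    and "p > 0 \<Longrightarrow> gauss_orbit \<nu> a v \<in> W2p_loc p"
proof -
  have v0: "v \<noteq> 0" using v by auto
  have a: "a = (1 - c) / 2 + \<nu>" by (simp add: a_def s1_def \<nu>_def field_simps)
  have nu2: "\<nu>\<^sup>2 = b + ((c - 1) / 2)\<^sup>2" using D by (simp add: \<nu>_def discr_def)
  have quad: "a\<^sup>2 - a + c * a - b = 0"
    using nu2 unfolding a power2_eq_square by (simp add: field_simps)
  \<comment> \<open>The logarithmic derivative of the Gaussian, so that u' = u g and u'' = u (g^2 +
    g').\<close>
  define g where "g = (\<lambda>y. complex_of_real (a / y) - of_real y / (2 * v))"
  define u' where "u' = (\<lambda>y. gauss_orbit \<nu> a v y * g y)"
  define u'' where "u'' = (\<lambda>y. gauss_orbit \<nu> a v y * (g y * g y - of_real (a / y\<^sup>2) - 1 / (2 * v)))"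
  have du: "(gauss_orbit \<nu> a v has_vector_derivative u' y) (at y)" if y: "y > 0" for y
  proof -
    have 1: "((\<lambda>y. complex_of_real (y powr a)) has_vector_derivative of_real (a * y powr (a - 1))) (at y)"
      using y by (intro has_vector_derivative_of_real)
        (simp add: has_real_derivative_powr has_real_derivative_iff_has_vector_derivative[symmetric])
    have "((\<lambda>\<zeta>. exp (- (\<zeta>\<^sup>2 / (4 * v)))) has_field_derivative exp (- ((of_real y)\<^sup>2 / (4 * v))) * (- (of_real y / (2 * v)))) (at (of_real y))"
      using v0 by (auto intro!: derivative_eq_intros simp: field_simps)
    hence 2: "((\<lambda>x. exp (- ((complex_of_real x)\<^sup>2 / (4 * v)))) has_vector_derivative exp (- ((of_real y)\<^sup>2 / (4 * v))) * (- (of_real y / (2 * v)))) (at y)"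
      by (rule has_vector_derivative_real_field)
    have 3: "a * y powr (a - 1) = y powr a * (a / y)" using y by (simp add: powr_diff)
    have "((\<lambda>x. v powr (- of_real (\<nu> + 1)) * (of_real (x powr a) * exp (- ((complex_of_real x)\<^sup>2 / (4 * v))))) has_vector_derivative
       v powr (- of_real (\<nu> + 1)) * (of_real (y powr a) * (exp (- ((of_real y)\<^sup>2 / (4 * v))) * (- (of_real y / (2 * v)))) + of_real (a * y powr (a - 1)) * exp (- ((of_real y)\<^sup>2 / (4 * v))))) (at y)"
      by (intro has_vector_derivative_mult_right has_vector_derivative_mult 1 2)
    moreover have "(\<lambda>x. v powr (- of_real (\<nu> + 1)) * (of_real (x powr a) * exp (- ((complex_of_real x)\<^sup>2 / (4 * v))))) = gauss_orbit \<nu> a v"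
      by (rule ext) (simp add: gauss_orbit_def)
    moreover have "v powr (- of_real (\<nu> + 1)) * (of_real (y powr a) * (exp (- ((of_real y)\<^sup>2 / (4 * v))) * (- (of_real y / (2 * v)))) + of_real (a * y powr (a - 1)) * exp (- ((of_real y)\<^sup>2 / (4 * v)))) = u' y"
      unfolding 3 by (simp add: u'_def g_def gauss_orbit_def algebra_simps)
    ultimately show ?thesis by simp
  qed
  have du': "(u' has_vector_derivative u'' y) (at y)" if y: "y > 0" for y
  proof -
    have "((\<lambda>\<zeta>. of_real a / \<zeta> - \<zeta> / (2 * v)) has_field_derivative (- (of_real a / (of_real y)\<^sup>2) - 1 / (2 * v))) (at (of_real y))"
      using v0 y by (auto intro!: derivative_eq_intros simp: field_simps power2_eq_square)
    hence "((\<lambda>x. of_real a / of_real x - of_real x / (2 * v)) has_vector_derivative (- (of_real a / (of_real y)\<^sup>2) - 1 / (2 * v))) (at y)"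
      by (rule has_vector_derivative_real_field)
    hence "(g has_vector_derivative (- of_real (a / y\<^sup>2) - 1 / (2 * v))) (at y)"
      by (simp add: g_def)
    from has_vector_derivative_mult[OF du[OF y] this]
    have "(u' has_vector_derivative gauss_orbit \<nu> a v y * (- of_real (a / y\<^sup>2) - 1 / (2 * v)) + u' y * g y) (at y)"
      by (simp add: u'_def)
    moreover have "gauss_orbit \<nu> a v y * (- of_real (a / y\<^sup>2) - 1 / (2 * v)) + u' y * g y = u'' y"
      unfolding u''_def u'_def by (simp only: distrib_left right_diff_distrib mult_ac) simp
    ultimately show ?thesis by simp
  qed
  have cu'': "continuous_on {0<..} u''"
    unfolding u''_def g_def using gauss_orbit_continuous(1)[of \<nu> a v] v0 by (intro continuous_intros) auto
  show "L_op b c (gauss_orbit \<nu> a v) \<in> borel_measurable half_line"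
    by (rule L_op_classical(2)[OF cu'']) (erule du, erule du')
  show "gauss_orbit \<nu> a v \<in> W2p_loc p" if "p > 0"
    by (rule L_op_classical(3)[OF cu'' _ _ that]) (erule du, erule du')
  have L: "AE y in half_line. L_op b c (gauss_orbit \<nu> a v) y = u'' y + of_real (c / y) * u' y - of_real (b / y\<^sup>2) * gauss_orbit \<nu> a v y"
    by (rule L_op_classical(1)[OF cu'']) (erule du, erule du')
  have eq: "u'' y + of_real (c / y) * u' y - of_real (b / y\<^sup>2) * gauss_orbit \<nu> a v y = gauss_orbit_deriv \<nu> a v y" if y: "y > 0" for y
  proof -
    have q: "of_real a ^ 2 - of_real a + of_real c * of_real a - complex_of_real b = 0"
      using arg_cong[OF quad, of complex_of_real] by simp
    have n: "2 * complex_of_real a + 1 + of_real c = 2 * (of_real \<nu> + 1)"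
      by (simp add: a field_simps)
    have "g y * g y - of_real (a / y\<^sup>2) - 1 / (2 * v) + of_real (c / y) * g y - of_real (b / y\<^sup>2)
      = (of_real a ^ 2 - of_real a + of_real c * of_real a - complex_of_real b) / of_real y ^ 2
         - (2 * complex_of_real a + 1 + of_real c) / (2 * v) + of_real (y\<^sup>2) / (4 * v\<^sup>2)"
      using y v0 by (simp add: g_def field_simps power2_eq_square)
    also have "\<dots> = of_real (y\<^sup>2) / (4 * v\<^sup>2) - of_real (\<nu> + 1) / v"
      unfolding q n using v0 by (simp add: field_simps)
    finally have h: "g y * g y - of_real (a / y\<^sup>2) - 1 / (2 * v) + of_real (c / y) * g y - of_real (b / y\<^sup>2) = of_real (y\<^sup>2) / (4 * v\<^sup>2) - of_real (\<nu> + 1) / v" .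
    have "u'' y + of_real (c / y) * u' y - of_real (b / y\<^sup>2) * gauss_orbit \<nu> a v y =
      gauss_orbit \<nu> a v y * (g y * g y - of_real (a / y\<^sup>2) - 1 / (2 * v) + of_real (c / y) * g y - of_real (b / y\<^sup>2))"
      unfolding u''_def u'_def by (simp only: distrib_left right_diff_distrib mult_ac)
    thus ?thesis unfolding h gauss_orbit_deriv_def .
  qed
  have "AE y in half_line. y > 0" by (rule AE_I2) auto
  with L show "AE y in half_line. L_op b c (gauss_orbit \<nu> a v) y = gauss_orbit_deriv \<nu> a v y"
    by eventually_elim (simp only: eq)
qed

text \<open>Multiplication by y^{-2 \<theta>} lowers the power a to a - 2 \<theta>, and the
  restriction on \<theta> is exactly the integrability of that power at 0. If the discriminant is 0,
  y^{s1} cancels y^a and what remains is continuous at 0.\<close>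

lemma gauss_orbit_L_dom:
  fixes b c m p :: real
  assumes D: "discr b c \<ge> 0" and p: "1 < p" and s1: "s1 b c < (m + 1) / p" and v: "Re v > 0"
  defines "\<nu> \<equiv> sqrt (discr b c)" and "a \<equiv> - s1 b c"
  shows "gauss_orbit \<nu> a v \<in> L_dom b c m p"
proof -
  have p0: "p > 0" using p by simp
  have ap: "a * p + m > -1" using s1 p0 by (simp add: a_def field_simps)
  have max: "gauss_orbit \<nu> a v \<in> L_max_dom b c m p"
  proof -
    have "L_op b c (gauss_orbit \<nu> a v) \<in> Lp_space m p"
      by (rule Lp_space_dominated(1)[OF gauss_orbit_L_op(2)[OF D v, folded \<nu>_def a_def] p0 gauss_orbit_Lp(2)[OF p0 ap v, of \<nu>]])
         (use gauss_orbit_L_op(1)[OF D v, folded \<nu>_def a_def] in \<open>eventually_elim, simp\<close>)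
    thus ?thesis unfolding L_max_dom_def
      using gauss_orbit_Lp(1)[OF p0 ap v] gauss_orbit_L_op(3)[OF D v p0, folded \<nu>_def a_def] by simp
  qed
  show ?thesis
  proof (cases "discr b c > 0")
    case True
    have "(\<lambda>y. of_real (y powr (- 2 * \<theta>)) * gauss_orbit \<nu> a v y) \<in> Lp_space m p"
      if "0 < \<theta>" "\<theta> \<le> 1" "s1 b c + 2 * \<theta> < (m + 1) / p" for \<theta>
    proof -
      have "(\<lambda>y. of_real (y powr (- 2 * \<theta>)) * gauss_orbit \<nu> a v y) = gauss_orbit \<nu> (a - 2 * \<theta>) v"
        by (rule ext) (simp add: gauss_orbit_def powr_add[symmetric] mult_ac flip: of_real_mult)
      moreover have "(a - 2 * \<theta>) * p + m > -1" using that(3) p0 by (simp add: a_def field_simps)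
      ultimately show ?thesis using gauss_orbit_Lp(1)[OF p0 _ v] by simp
    qed
    thus ?thesis using True max by (auto simp: L_dom_def)
  next
    case False
    have "((\<lambda>y. of_real (y powr s1 b c) * gauss_orbit \<nu> a v y) \<longlongrightarrow> v powr (- of_real (\<nu> + 1)) * exp (- (of_real (0\<^sup>2) / (4 * v)))) (at_right 0)"
    proof (rule Lim_transform_eventually)
      show "((\<lambda>y. v powr (- of_real (\<nu> + 1)) * exp (- (complex_of_real (y\<^sup>2) / (4 * v)))) \<longlongrightarrow> v powr (- of_real (\<nu> + 1)) * exp (- (of_real (0\<^sup>2) / (4 * v)))) (at_right 0)"
        using v by (intro tendsto_intros) auto
      have "v powr (- of_real (\<nu> + 1)) * exp (- (complex_of_real (y\<^sup>2) / (4 * v))) = of_real (y powr s1 b c) * gauss_orbit \<nu> a v y" if "y > 0" for y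
      proof -
        have "y powr s1 b c * y powr a = 1" using that by (simp add: a_def powr_minus)
        hence h: "complex_of_real (y powr s1 b c) * of_real (y powr a) = 1" unfolding of_real_mult[symmetric] by simp
        have "of_real (y powr s1 b c) * gauss_orbit \<nu> a v y = (complex_of_real (y powr s1 b c) * of_real (y powr a)) *
            (v powr (- of_real (\<nu> + 1)) * exp (- (complex_of_real (y\<^sup>2) / (4 * v))))"
          unfolding gauss_orbit_def by (simp only: mult_ac)
        thus ?thesis unfolding h by simp
      qed
      thus "\<forall>\<^sub>F y in at_right 0. v powr (- of_real (\<nu> + 1)) * exp (- (complex_of_real (y\<^sup>2) / (4 * v))) = of_real (y powr s1 b c) * gauss_orbit \<nu> a v y"
        unfolding eventually_at_filter by (intro always_eventually) auto
    qed
    thus ?thesis using False max gauss_orbit_continuous(1) unfolding L_dom_def by auto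
  qed
qed

text \<open>Starting at \<tau> > 0 keeps the segment, including its end points, inside the open
  half-plane where the Gaussians are differentiable; in particular a two-sided derivative exists at
  s = 0.\<close>

lemma semigroup_orbit:
  fixes b c m p :: real
  assumes D: "discr b c \<ge> 0" and p: "1 < p" and s1: "s1 b c < (m + 1) / p"
    and gen: "generates_bounded_analytic_semigroup m p (pi / 2) (L_dom b c m p) (L_op b c) T"
    and z: "Re z > 0" and \<tau>: "\<tau> > 0"
  defines "\<nu> \<equiv> sqrt (discr b c)" and "a \<equiv> - s1 b c"
  shows "AE y in half_line. T z (gauss_orbit \<nu> a (of_real \<tau>)) y = gauss_orbit \<nu> a (of_real \<tau> + z) y"
proof -
  interpret analytic_semigroup m p T
    using p gen by unfold_locales (auto simp: generates_bounded_analytic_semigroup_def)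
  have ap: "a * p + m > -1" using s1 p0 by (simp add: a_def field_simps)
  have z0: "z \<noteq> 0" using z by auto
  \<comment> \<open>\<open>orbit_unique\<close> wants a vector of the space for every real s, hence
    the value 0 where the Gaussian would not decay.\<close>
  define U where "U = (\<lambda>s::real. if Re (of_real \<tau> + of_real s * z) > 0 then gauss_orbit \<nu> a (of_real \<tau> + of_real s * z) else (\<lambda>y. 0))"
  define V where "V = (\<lambda>s::real. gauss_orbit_deriv \<nu> a (of_real \<tau> + of_real s * z))"
  have pos: "Re (of_real \<tau> + of_real s * z) > 0" if "0 \<le> s" for s :: real
    using \<tau> z that by (simp add: add_pos_nonneg)
  have "AE y in half_line. T z (U 0) y = U 1 y"
  proof (rule orbit_unique[OF z])
    show "U s \<in> Lp_space m p" for s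
      unfolding U_def using gauss_orbit_Lp(1)[OF p0 ap] Lp_space_0 by auto
    show "V s \<in> Lp_space m p" if "0 \<le> s" "s \<le> 1" for s
      unfolding V_def by (rule gauss_orbit_Lp(2)[OF p0 ap pos[OF that(1)]])
    show "((\<lambda>t::real. Lp_norm m p (\<lambda>y. (T (of_real t) (U s) y - U s y) / of_real t - V s y)) \<longlongrightarrow> 0) (at_right 0)"
      if s: "0 < s" "s < 1" for s
    proof -
      have Us: "U s = gauss_orbit \<nu> a (of_real \<tau> + of_real s * z)" using pos[of s] s by (simp add: U_def)
      have pos: "Re (of_real \<tau> + of_real s * z) > 0" using pos[of s] s by simp
      have "U s \<in> L_dom b c m p" unfolding Us \<nu>_def a_def by (rule gauss_orbit_L_dom[OF D p s1 pos])
      moreover have "AE y in half_line. L_op b c (U s) y = V s y"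
        unfolding Us V_def \<nu>_def a_def by (rule gauss_orbit_L_op(1)[OF D pos])
      moreover have "U s \<in> Lp_space m p" "V s \<in> Lp_space m p"
        unfolding Us V_def by (rule gauss_orbit_Lp[OF p0 ap pos])+
      ultimately show ?thesis
        using gen unfolding generates_bounded_analytic_semigroup_def by blast
    qed
    show "((\<lambda>h. Lp_mass m p (\<lambda>y. (U (s + h) y - U s y) / of_real h - z * V s y)) \<longlongrightarrow> 0) (at 0)"
      if s: "0 \<le> s" "s \<le> 1" for s
    proof -
      define v where "v = of_real \<tau> + of_real s * z"
      have v: "Re v > 0" using pos[OF s(1)] by (simp add: v_def)
      have lim: "filterlim (\<lambda>h::real. of_real h * z) (at 0) (at 0)"
        using z0 by (auto simp: filterlim_at eventually_at_filter intro!: tendsto_eq_intros)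
      \<comment> \<open>Chain rule: an increment h of s is the increment h z of v, whence the factor
        z.\<close>
      have "((\<lambda>h. norm z powr p * Lp_mass m p (\<lambda>y. (gauss_orbit \<nu> a (v + of_real h * z) y - gauss_orbit \<nu> a v y) / (of_real h * z) - gauss_orbit_deriv \<nu> a v y)) \<longlongrightarrow> norm z powr p * 0) (at 0)"
        by (intro tendsto_mult_left filterlim_compose[OF gauss_orbit_differentiable_Lp[OF p0 ap v] lim])
      moreover have "((\<lambda>h::real. Re (v + of_real h * z)) \<longlongrightarrow> Re (v + of_real 0 * z)) (at 0)"
        by (intro tendsto_intros)
      hence "\<forall>\<^sub>F h::real in at 0. Re (v + of_real h * z) > 0" using v by (intro order_tendstoD(1)) auto
      hence "\<forall>\<^sub>F h::real in at 0. norm z powr p * Lp_mass m p (\<lambda>y. (gauss_orbit \<nu> a (v + of_real h * z) y - gauss_orbit \<nu> a v y) / (of_real h * z) - gauss_orbit_deriv \<nu> a v y)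
         = Lp_mass m p (\<lambda>y. (U (s + h) y - U s y) / of_real h - z * V s y)"
      proof eventually_elim
        case (elim h)
        have e: "of_real \<tau> + of_real (s + h) * z = v + of_real h * z" by (simp add: v_def algebra_simps)
        have U: "U (s + h) = gauss_orbit \<nu> a (v + of_real h * z)" "U s = gauss_orbit \<nu> a v"
          unfolding U_def e using elim v by (auto simp: v_def)
        have L: "(\<lambda>y. (gauss_orbit \<nu> a (v + of_real h * z) y - gauss_orbit \<nu> a v y) / (of_real h * z) - gauss_orbit_deriv \<nu> a v y) \<in> Lp_space m p"
          using Lp_space_diff(1)[OF Lp_space_cmult(1)[OF Lp_space_diff(1)[OF gauss_orbit_Lp(1)[OF p0 ap elim] gauss_orbit_Lp(1)[OF p0 ap v] p0], of "1 / (of_real h * z)"] gauss_orbit_Lp(2)[OF p0 ap v] p0]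
          by simp
        have "(\<lambda>y. (U (s + h) y - U s y) / of_real h - z * V s y) =
          (\<lambda>y. z * ((gauss_orbit \<nu> a (v + of_real h * z) y - gauss_orbit \<nu> a v y) / (of_real h * z) - gauss_orbit_deriv \<nu> a v y))"
          unfolding U V_def v_def[symmetric] using z0 by (simp add: right_diff_distrib[of z "_ / _"])
        thus ?case using Lp_space_cmult(2)[OF L, of z] by simp
      qed
      ultimately show ?thesis by (simp add: tendsto_cong)
    qed
  qed
  thus ?thesis using \<tau> z by (simp add: U_def)
qed

subsection \<open>The kernel on Gaussians\<close>

lemma powr_odd_split:
  assumes "\<rho> > 0"
  shows "\<rho> powr (2 * (\<nu> + real k + 1) - 1) = \<rho> powr (2 * \<nu> + 1) * (\<rho>\<^sup>2) ^ k"
proof -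
  have "2 * (\<nu> + real k + 1) - 1 = (2 * \<nu> + 1) + real (2 * k)" by simp
  hence "\<rho> powr (2 * (\<nu> + real k + 1) - 1) = \<rho> powr (2 * \<nu> + 1) * \<rho> powr real (2 * k)"
    by (simp only: powr_add)
  also have "\<rho> powr real (2 * k) = (\<rho>\<^sup>2) ^ k"
    unfolding powr_realpow[OF assms] by (simp only: power_mult)
  finally show ?thesis .
qed

text \<open>Weber's exponential integral.\<close>

lemma bessel_e_gaussian_integral:
  fixes q x :: complex
  assumes \<nu>: "\<nu> \<ge> 0" and q: "Re q > 0"
  shows "integral\<^sup>L half_line (\<lambda>\<rho>. of_real (\<rho> powr (2 * \<nu> + 1)) * exp (- (q * of_real (\<rho>\<^sup>2))) * bessel_e \<nu> (x * of_real (\<rho>\<^sup>2)))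
     = 1 / 2 * q powr (- of_real (\<nu> + 1)) * exp (x / q)"
proof -
  define c where "c = (\<lambda>k. rGamma (\<nu> + real k + 1) / fact k)"
  have q0: "q \<noteq> 0" using q by auto
  have mu: "\<nu> + real k + 1 > 0" for k using \<nu> by (simp add: add_nonneg_pos)
  have c0: "c k \<ge> 0" for k unfolding c_def using rGamma_pos[OF mu] by (simp add: less_imp_le)
  \<comment> \<open>The Gamma function of the moment cancels the reciprocal Gamma of the Bessel
    coefficient, so the integrated series is the exponential series.\<close>
  have cG: "c k * (Gamma (\<nu> + real k + 1) / 2) = 1 / (2 * fact k)" for k
    using Gamma_real_pos[OF mu, of k] by (simp add: c_def rGamma_inverse_Gamma)
  define g where "g = (\<lambda>k \<rho>. of_real (\<rho> powr (2 * (\<nu> + real k + 1) - 1)) * exp (- (q * of_real (\<rho>\<^sup>2))))"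
  define F where "F = (\<lambda>k \<rho>. (of_real (c k) * x ^ k) * g k \<rho>)"
  have Fint: "integrable half_line (F k)" for k
    unfolding F_def g_def by (intro integrable_mult_right gaussian_moment_complex_integrable q mu)
  have Fval: "integral\<^sup>L half_line (F k) = 1 / 2 * q powr (- of_real (\<nu> + 1)) * ((x / q) ^ k /\<^sub>R fact k)" for k
  proof -
    have "integral\<^sup>L half_line (F k) = (of_real (c k) * x ^ k) * (of_real (Gamma (\<nu> + real k + 1) / 2) * q powr (- of_real (\<nu> + real k + 1)))"
      unfolding F_def integral_mult_right_zero g_def gaussian_moment_complex[OF q mu] ..
    also have "\<dots> = of_real (c k * (Gamma (\<nu> + real k + 1) / 2)) * x ^ k * q powr (- of_real (\<nu> + real k + 1))"
      by (simp only: of_real_mult mult_ac)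
    also have "- complex_of_real (\<nu> + real k + 1) = - of_real (\<nu> + 1) - of_nat k" by simp
    also have "q powr (- of_real (\<nu> + 1) - of_nat k) = q powr (- of_real (\<nu> + 1)) / q ^ k"
      unfolding powr_diff using powr_nat'[of q k] q0 by simp
    finally have "integral\<^sup>L half_line (F k) = of_real (1 / (2 * fact k)) * x ^ k * (q powr (- of_real (\<nu> + 1)) / q ^ k)"
      unfolding cG .
    thus ?thesis by (simp add: power_divide scaleR_conv_of_real field_simps)
  qed
  have Fnorm: "norm (F k \<rho>) = (c k * norm x ^ k) * (\<rho> powr (2 * (\<nu> + real k + 1) - 1) * exp (- (Re q * \<rho>\<^sup>2)))" for k \<rho>
    unfolding F_def g_def norm_mult norm_exp_minus_mult_real norm_of_real norm_power using c0[of k] by simp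
  have Fnormval: "(LINT \<rho>|half_line. norm (F k \<rho>)) = 1 / 2 * Re q powr (- (\<nu> + 1)) * ((norm x / Re q) ^ k /\<^sub>R fact k)" for k
  proof -
    have "(LINT \<rho>|half_line. norm (F k \<rho>)) = (c k * norm x ^ k) * (Gamma (\<nu> + real k + 1) / 2 * Re q powr (- (\<nu> + real k + 1)))"
      unfolding Fnorm integral_mult_right_zero gaussian_moment_real(2)[OF q mu] ..
    also have "\<dots> = (c k * (Gamma (\<nu> + real k + 1) / 2)) * norm x ^ k * Re q powr (- (\<nu> + real k + 1))"
      by (simp only: mult_ac)
    also have "- (\<nu> + real k + 1) = - (\<nu> + 1) - real k" by simp
    also have "Re q powr (- (\<nu> + 1) - real k) = Re q powr (- (\<nu> + 1)) / Re q ^ k"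
      unfolding powr_diff powr_realpow[OF q] ..
    finally have "(LINT \<rho>|half_line. norm (F k \<rho>)) = 1 / (2 * fact k) * norm x ^ k * (Re q powr (- (\<nu> + 1)) / Re q ^ k)"
      unfolding cG .
    thus ?thesis by (simp add: power_divide field_simps)
  qed
  have FS: "(\<lambda>k. F k \<rho>) sums (of_real (\<rho> powr (2 * \<nu> + 1)) * exp (- (q * of_real (\<rho>\<^sup>2))) * bessel_e \<nu> (x * of_real (\<rho>\<^sup>2)))"
    "summable (\<lambda>k. norm (F k \<rho>))" if \<rho>: "\<rho> > 0" for \<rho>
  proof -
    have eq: "F k \<rho> = of_real (\<rho> powr (2 * \<nu> + 1)) * exp (- (q * of_real (\<rho>\<^sup>2))) * (of_real (c k) * (x * of_real (\<rho>\<^sup>2)) ^ k)" for k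
      unfolding F_def g_def powr_odd_split[OF \<rho>] by (simp add: power_mult_distrib mult_ac)
    show "(\<lambda>k. F k \<rho>) sums (of_real (\<rho> powr (2 * \<nu> + 1)) * exp (- (q * of_real (\<rho>\<^sup>2))) * bessel_e \<nu> (x * of_real (\<rho>\<^sup>2)))"
      unfolding eq c_def by (intro sums_mult bessel_e_sums[OF \<nu>])
    have "norm (F k \<rho>) = norm (of_real (\<rho> powr (2 * \<nu> + 1)) * exp (- (q * of_real (\<rho>\<^sup>2)))) * (c k * norm (x * of_real (\<rho>\<^sup>2)) ^ k)" for k
      unfolding eq norm_mult[of "_ * exp _"] norm_mult[of "of_real (c k)"] norm_power norm_of_real using c0[of k] by simp
    thus "summable (\<lambda>k. norm (F k \<rho>))"
      unfolding c_def using summable_mult[OF bessel_e_summable_norm[OF \<nu>]] by simp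
  qed
  have "(\<lambda>k. integral\<^sup>L half_line (F k)) sums (LINT \<rho>|half_line. (\<Sum>k. F k \<rho>))"
  proof (rule sums_integral[OF Fint])
    show "summable (\<lambda>k. LINT \<rho>|half_line. norm (F k \<rho>))"
      unfolding Fnormval by (intro summable_mult summable_exp_generic)
  qed (use FS(2) in \<open>auto intro!: AE_I2\<close>)
  moreover have "(\<lambda>k. integral\<^sup>L half_line (F k)) sums (1 / 2 * q powr (- of_real (\<nu> + 1)) * exp (x / q))"
    unfolding Fval by (intro sums_mult exp_converges)
  ultimately have "(LINT \<rho>|half_line. (\<Sum>k. F k \<rho>)) = 1 / 2 * q powr (- of_real (\<nu> + 1)) * exp (x / q)"
    by (rule sums_unique2)
  moreover have "(LINT \<rho>|half_line. (\<Sum>k. F k \<rho>)) = integral\<^sup>L half_line (\<lambda>\<rho>. of_real (\<rho> powr (2 * \<nu> + 1)) * exp (- (q * of_real (\<rho>\<^sup>2))) * bessel_e \<nu> (x * of_real (\<rho>\<^sup>2)))"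
    by (intro Bochner_Integration.integral_cong) (use FS(1) in \<open>auto simp: sums_iff\<close>)
  ultimately show ?thesis by simp
qed

text \<open>Weber's integral with q = 1 / (4 z) + 1 / (4 \<tau>) = (\<tau> + z) / (4 z \<tau>). The
  exponents - y^2 / (4 z) and x / q add up to - y^2 / (4 (\<tau> + z)), and the powers combine
  through 1 / (4 z q) = \<tau> / (\<tau> + z).\<close>

lemma bessel_kernel_gauss_orbit:
  assumes \<nu>: "\<nu> \<ge> 0" and ab: "a + \<beta> = 2 * \<nu> + 1" and z: "Re z > 0" and \<tau>: "\<tau> > 0"
  shows "(LINT \<rho>|half_line. bessel_kernel \<nu> a \<beta> z y \<rho> * gauss_orbit \<nu> a (of_real \<tau>) \<rho>) = gauss_orbit \<nu> a (of_real \<tau> + z) y"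
proof -
  define t where "t = complex_of_real \<tau>"
  define P where "P = complex_of_real (\<nu> + 1)"
  have nz: "z \<noteq> 0" "t \<noteq> 0" "t + z \<noteq> 0" using z \<tau> by (auto simp: t_def complex_eq_iff)
  define q where "q = 1 / (4 * z) + 1 / (4 * t)"
  define x where "x = (of_real y / (4 * z))\<^sup>2"
  have Ret: "Re t > 0" "Re (t + z) > 0" using z \<tau> by (auto simp: t_def)
  have q: "Re q > 0" unfolding q_def using Re_quarter_inverse_pos[OF z] Re_quarter_inverse_pos[OF Ret(1)] by simp
  have q0: "q \<noteq> 0" using q by auto
  have qe: "q = (t + z) / (4 * z * t)" using nz by (simp add: q_def field_simps)
  define Kc where "Kc = kernel_const \<nu> z * of_real (y powr a) * exp (- (of_real (y\<^sup>2) / (4 * z))) * t powr (- P)"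
  have "(LINT \<rho>|half_line. bessel_kernel \<nu> a \<beta> z y \<rho> * gauss_orbit \<nu> a t \<rho>) =
    (LINT \<rho>|half_line. Kc * (of_real (\<rho> powr (2 * \<nu> + 1)) * exp (- (q * of_real (\<rho>\<^sup>2))) * bessel_e \<nu> (x * of_real (\<rho>\<^sup>2))))"
  proof (rule Bochner_Integration.integral_cong[OF refl])
    fix \<rho> :: real
    have "exp (- (complex_of_real (y\<^sup>2 + \<rho>\<^sup>2) / (4 * z))) * exp (- (of_real (\<rho>\<^sup>2) / (4 * t))) =
       exp (- (of_real (y\<^sup>2) / (4 * z))) * exp (- (q * of_real (\<rho>\<^sup>2)))"
      unfolding exp_add[symmetric] q_def by (simp add: add_divide_distrib algebra_simps)
    moreover have "complex_of_real (\<rho> powr \<beta>) * of_real (\<rho> powr a) = of_real (\<rho> powr (2 * \<nu> + 1))"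
      unfolding ab[symmetric] powr_add by simp
    moreover have "(complex_of_real (y * \<rho>) / (4 * z))\<^sup>2 = x * of_real (\<rho>\<^sup>2)"
      by (simp add: x_def power_divide power_mult_distrib)
    moreover have "bessel_kernel \<nu> a \<beta> z y \<rho> * gauss_orbit \<nu> a t \<rho> = kernel_const \<nu> z * of_real (y powr a) * t powr (- P) *
       (complex_of_real (\<rho> powr \<beta>) * of_real (\<rho> powr a)) *
       (exp (- (complex_of_real (y\<^sup>2 + \<rho>\<^sup>2) / (4 * z))) * exp (- (of_real (\<rho>\<^sup>2) / (4 * t)))) * bessel_e \<nu> ((complex_of_real (y * \<rho>) / (4 * z))\<^sup>2)"
      unfolding bessel_kernel_def gauss_orbit_def P_def of_real_mult[of "_ powr _"] by (simp only: mult_ac)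
    ultimately show "bessel_kernel \<nu> a \<beta> z y \<rho> * gauss_orbit \<nu> a t \<rho> =
       Kc * (of_real (\<rho> powr (2 * \<nu> + 1)) * exp (- (q * of_real (\<rho>\<^sup>2))) * bessel_e \<nu> (x * of_real (\<rho>\<^sup>2)))"
      unfolding Kc_def by (simp only: mult_ac)
  qed
  also have "\<dots> = Kc * (1 / 2 * q powr (- P) * exp (x / q))"
    unfolding integral_mult_right_zero bessel_e_gaussian_integral[OF \<nu> q] P_def ..
  also have "\<dots> = (kernel_const \<nu> z / 2 * t powr (- P) * q powr (- P)) * of_real (y powr a) * (exp (- (of_real (y\<^sup>2) / (4 * z))) * exp (x / q))"
    unfolding Kc_def by simp
  also have "exp (- (of_real (y\<^sup>2) / (4 * z))) * exp (x / q) = exp (- (of_real (y\<^sup>2) / (4 * (t + z))))"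
  proof -
    have "- (complex_of_real (y\<^sup>2) / (4 * z)) + x / q = - (of_real (y\<^sup>2) / (4 * (t + z)))"
    proof -
      define d where "d = t + z"
      have d: "d \<noteq> 0" "t = d - z" using nz by (auto simp: d_def)
      show ?thesis
        unfolding x_def qe d_def[symmetric] d(2) using d(1) nz(1) nz(2)[unfolded d(2)]
        by (simp add: field_simps power2_eq_square)
    qed
    thus ?thesis unfolding exp_add[symmetric] by simp
  qed
  also have "kernel_const \<nu> z / 2 * t powr (- P) * q powr (- P) = (t + z) powr (- P)"
  proof -
    have "kernel_const \<nu> z / 2 = (1 / (4 * z)) powr of_real \<nu> * (1 / (4 * z)) powr 1"
      using nz by (simp add: kernel_const_def)
    also have "\<dots> = (1 / (4 * z)) powr P" unfolding powr_add[symmetric] P_def by simp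
    finally have k: "kernel_const \<nu> z / 2 = (1 / (4 * z)) powr P" .
    have Req: "Re (1 / q) > 0" using q by (simp add: Re_divide) (intro divide_pos_pos add_pos_nonneg; simp)
    have "kernel_const \<nu> z / 2 * t powr (- P) * q powr (- P) = ((1 / (4 * z)) powr P * (1 / q) powr P) * t powr (- P)"
      unfolding k powr_inverse_Re_pos[OF q] by (simp only: mult_ac)
    \<comment> \<open>Both bases have positive real part, so no branch is crossed when the powers
      are merged.\<close>
    also have "(1 / (4 * z)) powr P * (1 / q) powr P = (1 / (4 * z) * (1 / q)) powr P"
      by (rule powr_mult_Re_pos[OF Re_quarter_inverse_pos[OF z] Req, symmetric])
    also have "1 / (4 * z) * (1 / q) = t * (1 / (t + z))" unfolding qe using nz by (simp add: field_simps)
    also have "(t * (1 / (t + z))) powr P = t powr P * (1 / (t + z)) powr P"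
      unfolding t_def using \<tau> by (subst powr_times_real_left) auto
    also have "t powr P * (1 / (t + z)) powr P * t powr (- P) = (t powr P * t powr (- P)) * (1 / (t + z)) powr P" by (simp only: mult_ac)
    also have "t powr P * t powr (- P) = 1" using nz by (simp add: powr_minus)
    finally show ?thesis unfolding powr_inverse_Re_pos[OF Ret(2)] by simp
  qed
  finally show ?thesis unfolding gauss_orbit_def P_def t_def by simp
qed

lemma bessel_kernel_continuous:
  assumes "\<nu> \<ge> 0"
  shows "continuous_on {0<..} (bessel_kernel \<nu> a \<beta> z y)"
proof -
  have "continuous_on UNIV (bessel_e \<nu>)"
    using bessel_e_deriv[OF assms] by (auto intro!: continuous_at_imp_continuous_on DERIV_isCont)
  moreover have "continuous_on {0<..} (\<lambda>\<rho>. (complex_of_real (y * \<rho>) / (4 * z))\<^sup>2)"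
    unfolding divide_inverse by (intro continuous_intros)
  ultimately have B: "continuous_on {0<..} (\<lambda>\<rho>. bessel_e \<nu> ((complex_of_real (y * \<rho>) / (4 * z))\<^sup>2))"
    by (rule continuous_on_compose2) simp
  have E: "continuous_on {0<..} (\<lambda>\<rho>. exp (- (complex_of_real (y\<^sup>2 + \<rho>\<^sup>2) / (4 * z))))"
    unfolding divide_inverse by (intro continuous_intros)
  have P: "continuous_on {0<..} (\<lambda>\<rho>. complex_of_real (y powr a * \<rho> powr \<beta>))"
    by (intro continuous_intros) auto
  show ?thesis unfolding bessel_kernel_def[abs_def]
    by (rule continuous_on_mult[OF continuous_on_mult[OF continuous_on_mult[OF continuous_on_const P] E] B])
qed

text \<open>For fixed y the Bessel factor grows only like the exponential of a multiple of \<rho>,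
  so the kernel is bounded by \<rho>^\<beta> times a Gaussian. The condition on m and p is then
  integrability at 0 for the conjugate exponent p / (p - 1).\<close>

lemma bessel_kernel_dual:
  assumes \<nu>: "\<nu> \<ge> 0" and z: "Re z > 0" and y: "y > 0" and p: "1 < p" and m: "(m + 1) / p < \<beta> + 1"
  shows "bessel_kernel \<nu> a \<beta> z y \<in> borel_measurable half_line"
    and "integrable half_line (\<lambda>\<rho>. (norm (bessel_kernel \<nu> a \<beta> z y \<rho>) * \<rho> powr (- m / p)) powr (p / (p - 1)))"
proof -
  show meas: "bessel_kernel \<nu> a \<beta> z y \<in> borel_measurable half_line"
    by (intro continuous_imp_measurable_on_sets_lebesgue bessel_kernel_continuous \<nu>) auto
  obtain C0 where C0: "C0 > 0"
    "\<And>w. Re w \<ge> 0 \<Longrightarrow> norm (bessel_e \<nu> ((w / 2)\<^sup>2)) \<le> C0 * exp (Re w) * (1 + Re w) powr (- (\<nu> + 1/2))"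
    using bessel_e_bounds[OF \<nu>] by metis
  define \<delta> where "\<delta> = Re (1 / (4 * z))"
  have \<delta>: "\<delta> > 0" unfolding \<delta>_def by (rule Re_quarter_inverse_pos[OF z])
  have Rmul: "Re (of_real r / (4 * z)) = r * \<delta>" for r
  proof -
    have "complex_of_real r / (4 * z) = of_real r * (1 / (4 * z))" by simp
    thus ?thesis unfolding \<delta>_def by (simp only: times_complex.sel Re_complex_of_real Im_complex_of_real mult_zero_left diff_zero)
  qed
  define K where "K = norm (kernel_const \<nu> z) * y powr a * C0 * exp (\<delta> * y\<^sup>2)"
  have K: "K \<ge> 0" using C0 by (simp add: K_def)
  have bound: "norm (bessel_kernel \<nu> a \<beta> z y \<rho>) \<le> K * (\<rho> powr \<beta> * exp (- (\<delta> / 2 * \<rho>\<^sup>2)))" if \<rho>: "\<rho> > 0" for \<rho>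
  proof -
    define w where "w = complex_of_real (2 * (y * \<rho>)) / (4 * z)"
    have wh: "complex_of_real (y * \<rho>) / (4 * z) = w / 2" by (simp add: w_def)
    have Rw: "Re w = 2 * (y * \<rho>) * \<delta>" unfolding w_def by (rule Rmul)
    hence Rw0: "Re w \<ge> 0" using \<rho> y \<delta> by simp
    have "norm (bessel_e \<nu> ((w / 2)\<^sup>2)) \<le> C0 * exp (Re w) * (1 + Re w) powr (- (\<nu> + 1/2))" by (rule C0(2)[OF Rw0])
    also have "(1 + Re w) powr (- (\<nu> + 1/2)) \<le> 1" using Rw0 \<nu> powr_mono[of "- (\<nu> + 1/2)" 0 "1 + Re w"] by simp
    hence "C0 * exp (Re w) * (1 + Re w) powr (- (\<nu> + 1/2)) \<le> C0 * exp (Re w) * 1"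
      using C0 by (intro mult_left_mono) auto
    finally have b: "norm (bessel_e \<nu> ((w / 2)\<^sup>2)) \<le> C0 * exp (Re w)" by simp
    have "norm (bessel_kernel \<nu> a \<beta> z y \<rho>) = norm (kernel_const \<nu> z) * y powr a * \<rho> powr \<beta> * exp (- ((y\<^sup>2 + \<rho>\<^sup>2) * \<delta>)) * norm (bessel_e \<nu> ((w / 2)\<^sup>2))"
      unfolding bessel_kernel_def wh norm_mult norm_exp_eq_Re uminus_complex.sel Rmul norm_of_real by (simp add: abs_mult)
    also have "\<dots> \<le> norm (kernel_const \<nu> z) * y powr a * \<rho> powr \<beta> * exp (- ((y\<^sup>2 + \<rho>\<^sup>2) * \<delta>)) * (C0 * exp (Re w))"
      by (intro mult_left_mono b) auto
    also have "\<dots> = norm (kernel_const \<nu> z) * y powr a * C0 * \<rho> powr \<beta> * exp (- ((y\<^sup>2 + \<rho>\<^sup>2) * \<delta>) + Re w)"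
      unfolding exp_add by (simp only: mult_ac)
    also have "\<dots> \<le> norm (kernel_const \<nu> z) * y powr a * C0 * \<rho> powr \<beta> * exp (\<delta> * y\<^sup>2 + - (\<delta> / 2 * \<rho>\<^sup>2))"
    proof (intro mult_left_mono)
      \<comment> \<open>Young's inequality 2 y \<rho> \<le> 2 y^2 + \<rho>^2 / 2, which leaves half
        of the Gaussian in \<rho>.\<close>
      have "0 \<le> \<delta> / 2 * (2 * y - \<rho>)\<^sup>2" using \<delta> by simp
      hence "- ((y\<^sup>2 + \<rho>\<^sup>2) * \<delta>) + Re w \<le> \<delta> * y\<^sup>2 + - (\<delta> / 2 * \<rho>\<^sup>2)"
        unfolding Rw by (simp add: power2_eq_square algebra_simps)
      thus "exp (- ((y\<^sup>2 + \<rho>\<^sup>2) * \<delta>) + Re w) \<le> exp (\<delta> * y\<^sup>2 + - (\<delta> / 2 * \<rho>\<^sup>2))" by simp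
    qed (use C0 in auto)
    also have "\<dots> = K * (\<rho> powr \<beta> * exp (- (\<delta> / 2 * \<rho>\<^sup>2)))"
      unfolding exp_add K_def by (simp only: mult_ac)
    finally show ?thesis .
  qed
  define q where "q = p / (p - 1)"
  have q: "q > 0" "q * (p - 1) = p" using p by (auto simp: q_def)
  define \<mu> where "\<mu> = ((\<beta> - m / p) * q + 1) / 2"
  have \<mu>: "\<mu> > 0" "2 * \<mu> - 1 = (\<beta> - m / p) * q"
  proof -
    have "(\<beta> - m / p) > (1 - p) / p" using m p by (simp add: diff_divide_distrib add_divide_distrib)
    hence "(\<beta> - m / p) * q > (1 - p) / p * q" using q by (intro mult_strict_right_mono) auto
    also have "(1 - p) / p * q = -1" using p unfolding q_def by (simp add: field_simps)
    finally show "\<mu> > 0" by (simp add: \<mu>_def)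
  qed (simp add: \<mu>_def field_simps)
  have G: "integrable half_line (\<lambda>\<rho>. K powr q * (\<rho> powr (2 * \<mu> - 1) * exp (- (q * \<delta> / 2 * \<rho>\<^sup>2))))"
    by (rule integrable_mult_right, rule gaussian_moment_real(1)) (use q \<delta> \<mu> in auto)
  show "integrable half_line (\<lambda>\<rho>. (norm (bessel_kernel \<nu> a \<beta> z y \<rho>) * \<rho> powr (- m / p)) powr (p / (p - 1)))"
    unfolding q_def[symmetric]
  proof (rule measurable_bounded_by_integrable_imp_lebesgue_integrable[OF _ G])
    show "(\<lambda>\<rho>. (norm (bessel_kernel \<nu> a \<beta> z y \<rho>) * \<rho> powr (- m / p)) powr q) \<in> borel_measurable half_line"
      using meas by measurable
    fix \<rho> :: real assume "\<rho> \<in> {0<..}"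
    hence \<rho>: "\<rho> > 0" by simp
    have "(norm (bessel_kernel \<nu> a \<beta> z y \<rho>) * \<rho> powr (- m / p)) powr q \<le> (K * (\<rho> powr \<beta> * exp (- (\<delta> / 2 * \<rho>\<^sup>2))) * \<rho> powr (- m / p)) powr q"
      using q by (intro powr_mono2 mult_right_mono bound \<rho>) auto
    also have "K * (\<rho> powr \<beta> * exp (- (\<delta> / 2 * \<rho>\<^sup>2))) * \<rho> powr (- m / p) = K * ((\<rho> powr \<beta> * \<rho> powr (- m / p)) * exp (- (\<delta> / 2 * \<rho>\<^sup>2)))"
      by (simp only: mult_ac)
    also have "\<rho> powr \<beta> * \<rho> powr (- m / p) = \<rho> powr (\<beta> - m / p)" unfolding powr_add[symmetric] by simp
    also have "(K * (\<rho> powr (\<beta> - m / p) * exp (- (\<delta> / 2 * \<rho>\<^sup>2)))) powr q = K powr q * (\<rho> powr (2 * \<mu> - 1) * exp (- (q * \<delta> / 2 * \<rho>\<^sup>2)))"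
      unfolding \<mu>(2) powr_mult powr_powr exp_powr_real by (simp add: mult_ac)
    finally show "norm ((norm (bessel_kernel \<nu> a \<beta> z y \<rho>) * \<rho> powr (- m / p)) powr q) \<le> K powr q * (\<rho> powr (2 * \<mu> - 1) * exp (- (q * \<delta> / 2 * \<rho>\<^sup>2)))"
      by simp
  qed auto
qed

subsection \<open>The kernel representation\<close>

text \<open>The density argument sees the kernel only through its membership in the dual space for
  each y, so the kernel is kept abstract.\<close>

locale kernel_representation = analytic_semigroup +
  fixes z :: complex and k :: "real \<Rightarrow> real \<Rightarrow> complex"
  assumes z: "Re z > 0"
    and k_measurable: "\<And>y. y > 0 \<Longrightarrow> k y \<in> borel_measurable half_line"
    and k_dual: "\<And>y. y > 0 \<Longrightarrow> integrable half_line (\<lambda>\<rho>. (norm (k y \<rho>) * \<rho> powr (- m / p)) powr (p / (p - 1)))"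
begin

definition represented :: "(real \<Rightarrow> complex) set" where
  "represented = {f \<in> Lp_space m p. AE y in half_line. T z f y = (LINT \<rho>|half_line. k y \<rho> * f \<rho>)}"

lemma AE_half_line_pos: "AE y in half_line. y > 0"
  by (rule AE_I2) auto

lemma kernel_integrable:
  assumes "y > 0" "f \<in> Lp_space m p"
  shows "integrable half_line (\<lambda>\<rho>. k y \<rho> * f \<rho>)"
  by (rule dual_weight_integrable(1)[of p "p / (p - 1)", OF p _ _ k_measurable k_dual])
     (use assms p in \<open>auto simp: field_simps\<close>)

lemma kernel_tendsto_0:
  assumes "y > 0" "\<forall>\<^sub>F x in F. f x \<in> Lp_space m p" "((\<lambda>x. Lp_mass m p (f x)) \<longlongrightarrow> 0) F"
  shows "((\<lambda>x. LINT \<rho>|half_line. k y \<rho> * f x \<rho>) \<longlongrightarrow> 0) F"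
  by (rule dual_weight_tendsto_0[of p "p / (p - 1)", OF p _ _ k_measurable k_dual assms(2,3)])
     (use assms p in \<open>auto simp: field_simps\<close>)

lemma represented_linear:
  assumes "f \<in> represented" "g \<in> represented"
  shows "(\<lambda>y. \<alpha> * f y + \<beta> * g y) \<in> represented"
proof -
  have L: "f \<in> Lp_space m p" "g \<in> Lp_space m p" using assms by (auto simp: represented_def)
  have "AE y in half_line. T z f y = (LINT \<rho>|half_line. k y \<rho> * f \<rho>)"
    "AE y in half_line. T z g y = (LINT \<rho>|half_line. k y \<rho> * g \<rho>)"
    using assms by (auto simp: represented_def)
  with T_linear[OF z L, of \<alpha> \<beta>] AE_half_line_pos
  have "AE y in half_line. T z (\<lambda>y. \<alpha> * f y + \<beta> * g y) y = (LINT \<rho>|half_line. k y \<rho> * (\<alpha> * f \<rho> + \<beta> * g \<rho>))"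
  proof eventually_elim
    case (elim y)
    have "(LINT \<rho>|half_line. k y \<rho> * (\<alpha> * f \<rho> + \<beta> * g \<rho>)) = (LINT \<rho>|half_line. \<alpha> * (k y \<rho> * f \<rho>) + \<beta> * (k y \<rho> * g \<rho>))"
      by (simp add: algebra_simps)
    also have "\<dots> = \<alpha> * (LINT \<rho>|half_line. k y \<rho> * f \<rho>) + \<beta> * (LINT \<rho>|half_line. k y \<rho> * g \<rho>)"
      using kernel_integrable[OF elim(2) L(1)] kernel_integrable[OF elim(2) L(2)] by simp
    finally show ?case using elim by simp
  qed
  thus ?thesis using L Lp_space_add(1)[OF Lp_space_cmult(1) Lp_space_cmult(1) p0] by (simp add: represented_def)
qed

text \<open>The images under T z converge in the space, hence almost everywhere along a subsequence,
  while the kernel integrals converge at every y > 0. The two limits must agree.\<close>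

lemma represented_closed:
  assumes "\<And>n. f n \<in> represented" "g \<in> Lp_space m p" "(\<lambda>n. Lp_mass m p (\<lambda>y. f n y - g y)) \<longlonglongrightarrow> 0"
  shows "g \<in> represented"
proof -
  have L: "f n \<in> Lp_space m p" and R: "AE y in half_line. T z (f n) y = (LINT \<rho>|half_line. k y \<rho> * f n \<rho>)" for n
    using assms(1) by (auto simp: represented_def)
  have Ld: "(\<lambda>y. f n y - g y) \<in> Lp_space m p" for n by (rule Lp_space_diff(1)[OF L assms(2) p0])
  obtain \<phi> where \<phi>: "0 < \<phi>" "\<phi> < pi / 2" "\<And>t. t > 0 \<Longrightarrow> of_real t * z \<in> sector \<phi>"
    using T_bounded_at[OF z] by blast
  have zs: "z \<in> sector \<phi>" using \<phi>(3)[of 1] by simp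
  define D where "D = (\<lambda>n. T z (\<lambda>y. f n y - g y))"
  have LD: "D n \<in> Lp_space m p" for n unfolding D_def by (rule T_Lp[OF z Ld])
  have D0: "(\<lambda>n. Lp_mass m p (D n)) \<longlonglongrightarrow> 0"
    unfolding D_def by (rule T_tendsto_0[OF \<phi>(1,2) _ _ assms(3)]) (simp_all add: zs Ld)
  have "\<exists>r. strict_mono r \<and> (AE y in half_line. (\<lambda>n. y powr m * norm (D (r n) y) powr p) \<longlonglongrightarrow> 0)"
  proof (rule tendsto_L1_AE_subseq)
    show "integrable half_line (\<lambda>y. y powr m * norm (D n y) powr p)" for n
      using LD by (simp add: Lp_space_iff)
    show "(\<lambda>n. LINT y|half_line. norm (y powr m * norm (D n y) powr p)) \<longlonglongrightarrow> 0"
      using D0 by (simp add: Lp_mass_def abs_mult)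
  qed
  then obtain r where r: "strict_mono r" "AE y in half_line. (\<lambda>n. y powr m * norm (D (r n) y) powr p) \<longlonglongrightarrow> 0" by blast
  have AED: "AE y in half_line. \<forall>n. D n y = T z (f n) y - T z g y"
    unfolding AE_all_countable D_def by (intro allI T_diff z L assms(2))
  have "AE y in half_line. \<forall>n. T z (f n) y = (LINT \<rho>|half_line. k y \<rho> * f n \<rho>)"
    unfolding AE_all_countable using R by blast
  with r(2) AED AE_half_line_pos have "AE y in half_line. T z g y = (LINT \<rho>|half_line. k y \<rho> * g \<rho>)"
  proof eventually_elim
    case (elim y)
    \<comment> \<open>At the given y the weight and the p-th power are undone, to recover
      convergence of D itself.\<close>
    have "(\<lambda>n. (y powr (- m) * (y powr m * norm (D (r n) y) powr p)) powr (1 / p)) \<longlonglongrightarrow> 0"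
    proof (rule tendsto_zero_powrI[where g="\<lambda>_. 1/p" and b="1/p"])
      show "(\<lambda>n. y powr (- m) * (y powr m * norm (D (r n) y) powr p)) \<longlonglongrightarrow> 0"
        using tendsto_mult_left[OF elim(1), of "y powr (- m)"] by simp
    qed (use p0 in auto)
    also have "(\<lambda>n. (y powr (- m) * (y powr m * norm (D (r n) y) powr p)) powr (1 / p)) = (\<lambda>n. norm (D (r n) y))"
    proof
      fix n
      have h: "y powr (- m) * (y powr m * norm (D (r n) y) powr p) = norm (D (r n) y) powr p"
        using elim(3) by (simp add: powr_minus)
      show "(y powr (- m) * (y powr m * norm (D (r n) y) powr p)) powr (1 / p) = norm (D (r n) y)"
        unfolding h using p0 by (simp add: powr_powr)
    qed
    finally have D: "(\<lambda>n. D (r n) y) \<longlonglongrightarrow> 0" by (rule tendsto_norm_zero_cancel)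
    have int: "(LINT \<rho>|half_line. k y \<rho> * (f n \<rho> - g \<rho>)) = (LINT \<rho>|half_line. k y \<rho> * f n \<rho>) - (LINT \<rho>|half_line. k y \<rho> * g \<rho>)" for n
      using kernel_integrable[OF elim(3) L[of n]] kernel_integrable[OF elim(3) assms(2)] by (simp add: right_diff_distrib)
    have "(\<lambda>n. LINT \<rho>|half_line. k y \<rho> * (f n \<rho> - g \<rho>)) \<longlonglongrightarrow> 0"
      by (rule kernel_tendsto_0[OF elim(3) _ assms(3)]) (simp add: Ld)
    hence "(\<lambda>n. LINT \<rho>|half_line. k y \<rho> * (f (r n) \<rho> - g \<rho>)) \<longlonglongrightarrow> 0"
      using LIMSEQ_subseq_LIMSEQ[OF _ r(1)] by (auto simp: comp_def)
    moreover have "(LINT \<rho>|half_line. k y \<rho> * (f (r n) \<rho> - g \<rho>)) = D (r n) y + (T z g y - (LINT \<rho>|half_line. k y \<rho> * g \<rho>))" for n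
      unfolding int using elim(2,4) by simp
    ultimately have "(\<lambda>n. D (r n) y + (T z g y - (LINT \<rho>|half_line. k y \<rho> * g \<rho>))) \<longlonglongrightarrow> 0" by simp
    moreover have "(\<lambda>n. D (r n) y + (T z g y - (LINT \<rho>|half_line. k y \<rho> * g \<rho>))) \<longlonglongrightarrow> 0 + (T z g y - (LINT \<rho>|half_line. k y \<rho> * g \<rho>))"
      by (intro tendsto_intros D)
    ultimately have "0 = 0 + (T z g y - (LINT \<rho>|half_line. k y \<rho> * g \<rho>))" by (rule LIMSEQ_unique)
    thus ?case by simp
  qed
  thus ?thesis using assms(2) by (simp add: represented_def)
qed

text \<open>A constant sequence converges to every function that equals it almost everywhere, so the
  change of representative under T z is a case of closedness.\<close>

lemma represented_cong_AE:
  assumes "f \<in> represented" "g \<in> borel_measurable half_line" "AE y in half_line. f y = g y"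
  shows "g \<in> represented"
proof (rule represented_closed[of "\<lambda>_. f"])
  have L: "f \<in> Lp_space m p" using assms(1) by (simp add: represented_def)
  show g: "g \<in> Lp_space m p"
    by (rule Lp_space_dominated(1)[OF assms(2) p0 L]) (use assms(3) in \<open>eventually_elim, simp\<close>)
  have "Lp_mass m p (\<lambda>y. f y - g y) = Lp_mass m p (\<lambda>y. 0)"
    by (rule Lp_mass_cong_AE) (use Lp_space_diff(1)[OF L g p0] assms(3) in \<open>auto simp: Lp_space_iff\<close>)
  thus "(\<lambda>n. Lp_mass m p (\<lambda>y. f y - g y)) \<longlonglongrightarrow> 0" using p0 by (simp add: Lp_mass_def)
qed (rule assms(1))

lemma represented_dominated:
  assumes "\<And>n. f n \<in> represented" "g \<in> borel_measurable half_line" "h \<in> Lp_space m p"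
    "\<And>n y. y > 0 \<Longrightarrow> norm (f n y) \<le> norm (h y)" "\<And>y. y > 0 \<Longrightarrow> (\<lambda>n. f n y) \<longlonglongrightarrow> g y"
  shows "g \<in> represented"
proof -
  have m: "f n \<in> borel_measurable half_line" for n using assms(1) by (simp add: represented_def Lp_space_iff)
  note dom = Lp_dominated_convergence[OF p0 assms(3) m assms(2)]
  have le: "AE y in half_line. norm (f n y) \<le> norm (h y)" for n by (rule AE_I2) (auto intro: assms(4))
  have lim: "AE y in half_line. (\<lambda>n. f n y) \<longlonglongrightarrow> g y" by (rule AE_I2) (auto intro: assms(5))
  show ?thesis
    by (rule represented_closed[OF assms(1) dom(2)[OF le lim] dom(3)[OF le lim]])
qed

lemma represented_sum:
  assumes "\<And>i. i \<in> I \<Longrightarrow> f i \<in> represented" "(\<lambda>y. 0) \<in> represented"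
  shows "(\<lambda>y. \<Sum>i\<in>I. c i * f i y) \<in> represented"
  using assms(1)
\<comment> \<open>For an empty or infinite index set the sum is 0, which the second assumption
  covers.\<close>
proof (induction I rule: infinite_finite_induct)
  case (insert i I)
  have "(\<lambda>y. c i * f i y + 1 * (\<Sum>i\<in>I. c i * f i y)) \<in> represented"
    by (intro represented_linear insert) auto
  thus ?case using insert by simp
qed (use assms(2) in auto)

text \<open>Density of the Gaussians: in the variable \<open>e\<^sup>-\<^sup>y\<^sup>2\<close> their span consists of all polynomials,
  so that Weierstrass' theorem applies.\<close>

lemma represented_eq_Lp:
  fixes a :: real
  assumes ap: "a * p + m > -1"
    and base: "\<And>n::nat. n \<ge> 1 \<Longrightarrow> (\<lambda>y. of_real (y powr a * exp (- (real n * y\<^sup>2)))) \<in> represented"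
  shows "represented = Lp_space m p"
proof -
  define w where "w = (\<lambda>y. y powr a * exp (- (1 * y\<^sup>2)))"
  have w1: "(\<lambda>y. of_real (w y)) \<in> represented" using base[of 1] by (simp add: w_def)
  have wc: "continuous_on {0<..} (\<lambda>y. of_real (w y) :: complex)" unfolding w_def by (auto intro!: continuous_intros)
  hence wm: "(\<lambda>y. of_real (w y) :: complex) \<in> borel_measurable half_line"
    by (intro continuous_imp_measurable_on_sets_lebesgue) auto
  have wpos: "w y > 0" if "y > 0" for y using that by (simp add: w_def)
  have wL: "(\<lambda>y. of_real (K * w y) :: complex) \<in> Lp_space m p" for K
    unfolding w_def by (rule gaussian_Lp[OF p0 _ ap]) simp
  have zero: "(\<lambda>y. 0) \<in> represented" using represented_linear[OF w1 w1, of 0 0] by simp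
  define q where "q = (\<lambda>y::real. exp (- (1 * y\<^sup>2)))"
  have q01: "q y \<in> {0..1}" for y by (simp add: q_def)
  have qm: "continuous_on {0<..} q" unfolding q_def by (intro continuous_intros)
  \<comment> \<open>w q^i is the Gaussian with n = i + 1, so the factor w is the reason why
    polynomials with a constant term are reached.\<close>
  have poly: "(\<lambda>y. of_real (w y * P (q y))) \<in> represented" if P: "real_polynomial_function P" for P
  proof -
    obtain c n where c: "P = (\<lambda>x. \<Sum>i\<le>n. c i * x ^ i)" using P real_polynomial_function_iff_sum by blast
    have "(\<lambda>y. \<Sum>i\<in>{..n}. of_real (c i) * of_real (y powr a * exp (- (real (Suc i) * y\<^sup>2)))) \<in> represented"
      by (intro represented_sum base zero) auto
    moreover have "of_real (w y * P (q y)) = (\<Sum>i\<in>{..n}. complex_of_real (c i) * of_real (y powr a * exp (- (real (Suc i) * y\<^sup>2))))" for y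
    proof -
      have e: "exp (- (1 * y\<^sup>2)) * q y ^ i = exp (- (real (Suc i) * y\<^sup>2))" for i
        unfolding q_def exp_of_nat_mult[symmetric] exp_add[symmetric] by (simp add: algebra_simps)
      have "w y * P (q y) = (\<Sum>i\<le>n. c i * (y powr a * (exp (- (1 * y\<^sup>2)) * q y ^ i)))"
        unfolding c w_def sum_distrib_left by (simp only: mult_ac)
      thus ?thesis unfolding e by simp
    qed
    ultimately show ?thesis by simp
  qed
  have cont: "(\<lambda>y. of_real (w y * g (q y))) \<in> represented" if g: "continuous_on {0..1} g" for g :: "real \<Rightarrow> real"
  proof -
    have "\<forall>n::nat. \<exists>P. real_polynomial_function P \<and> (\<forall>x\<in>{0..1}. \<bar>g x - P x\<bar> < 1 / real (Suc n))"
      using Stone_Weierstrass_real_polynomial_function[of "{0..1}" g] g by (metis compact_Icc zero_less_divide_1_iff of_nat_0_less_iff zero_less_Suc)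
    then obtain P where P: "\<And>n. real_polynomial_function (P n)" "\<And>n x. x \<in> {0..1} \<Longrightarrow> \<bar>g x - P n x\<bar> < 1 / real (Suc n)"
      by metis
    have "bounded (g ` {0..1})" by (intro compact_imp_bounded compact_continuous_image g) auto
    then obtain B where "\<forall>x\<in>{0..1}. \<bar>g x\<bar> \<le> B" by (auto simp: bounded_iff)
    hence B: "\<And>x. x \<in> {0..1} \<Longrightarrow> \<bar>g x\<bar> \<le> B" by blast
    show ?thesis
    proof (rule represented_dominated[OF poly[OF P(1)] _ wL[of "B + 1"]])
      have "continuous_on {0<..} (\<lambda>y. g (q y))"
        by (rule continuous_on_compose2[OF g qm]) (use q01 in auto)
      hence "continuous_on {0<..} (\<lambda>y. complex_of_real (w y * g (q y)))"
        unfolding of_real_mult by (intro continuous_on_mult wc continuous_on_of_real)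
      thus "(\<lambda>y. complex_of_real (w y * g (q y))) \<in> borel_measurable half_line"
        by (intro continuous_imp_measurable_on_sets_lebesgue) auto
      fix y :: real assume y: "y > 0"
      show "norm (complex_of_real (w y * P n (q y))) \<le> norm (complex_of_real ((B + 1) * w y))" for n
      proof -
        have "1 / real (Suc n) \<le> 1" by simp
        hence "\<bar>P n (q y)\<bar> \<le> B + 1" using P(2)[OF q01, of y n] B[OF q01, of y] by linarith
        hence "w y * \<bar>P n (q y)\<bar> \<le> w y * (B + 1)" using wpos[OF y] by (intro mult_left_mono) auto
        also have "\<dots> \<le> \<bar>(B + 1) * w y\<bar>" by (metis abs_ge_self mult.commute)
        finally show ?thesis unfolding norm_of_real abs_mult using wpos[OF y] by simp
      qed
      have "(\<lambda>n. g (q y) - P n (q y)) \<longlonglongrightarrow> 0"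
      proof (rule Lim_null_comparison)
        show "\<forall>\<^sub>F n in sequentially. norm (g (q y) - P n (q y)) \<le> 1 / real (Suc n)"
          using P(2)[OF q01, of y] by (auto intro!: always_eventually less_imp_le)
        show "(\<lambda>n. 1 / real (Suc n)) \<longlonglongrightarrow> 0" by (rule LIMSEQ_Suc[OF lim_1_over_n])
      qed
      hence "(\<lambda>n. P n (q y)) \<longlonglongrightarrow> g (q y)" using tendsto_diff[OF tendsto_const[of "g (q y)"]] by fastforce
      thus "(\<lambda>n. complex_of_real (w y * P n (q y))) \<longlonglongrightarrow> complex_of_real (w y * g (q y))"
        by (intro tendsto_intros)
    qed
  qed
  have meas_ind: "(\<lambda>y. indicator A y * complex_of_real (w y)) \<in> borel_measurable half_line" if "A \<in> sets borel" for A
  proof -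
    have "A \<inter> {0<..} \<in> sets half_line" using that by (auto simp: sets_restrict_space)
    hence "(indicator (A \<inter> {0<..}) :: real \<Rightarrow> complex) \<in> borel_measurable half_line" by (rule borel_measurable_indicator)
    hence "(\<lambda>y. indicator (A \<inter> {0<..}) y * complex_of_real (w y)) \<in> borel_measurable half_line"
      by (intro borel_measurable_times wm)
    thus ?thesis
      by (rule measurable_cong[THEN iffD1, rotated]) (auto simp: indicator_def)
  qed
  have open_int: "(\<lambda>y. indicator {l<..<u} y * complex_of_real (w y)) \<in> represented" for l u :: real
  proof (cases "u > 0")
    case False
    have "AE y in half_line. 0 = indicator {l<..<u} y * complex_of_real (w y)"
      by (rule AE_I2) (use False in \<open>auto simp: indicator_def\<close>)
    from represented_cong_AE[OF zero meas_ind this] show ?thesis by simp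
  next
    case True
    \<comment> \<open>q is decreasing, so the end points change places. The left end is clipped at 0
      because q is injective only on the nonnegative half-line.\<close>
    define \<alpha> where "\<alpha> = q u"
    define \<beta> where "\<beta> = q (max l 0)"
    have iff: "\<alpha> < q y \<and> q y < \<beta> \<longleftrightarrow> y \<in> {l<..<u}" if "y > 0" for y
    proof -
      have sq: "r\<^sup>2 < t\<^sup>2 \<longleftrightarrow> r < t" if "r \<ge> 0" "t \<ge> 0" for r t :: real
        using that power2_less_imp_less[of r t] power_strict_mono[of r t 2] by auto
      have "\<alpha> < q y \<longleftrightarrow> y < u" unfolding \<alpha>_def q_def using True that by (simp add: sq)
      moreover have "q y < \<beta> \<longleftrightarrow> l < y" unfolding \<beta>_def q_def using that by (simp add: sq)
      ultimately show ?thesis by auto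
    qed
    \<comment> \<open>Continuous trapezoids that tend to the indicator of the open interval from
      \<alpha> to \<beta>.\<close>
    define g where "g = (\<lambda>n x. min 1 (real n * max 0 (min (x - \<alpha>) (\<beta> - x))))"
    have gc: "continuous_on {0..1} (g n)" for n unfolding g_def by (intro continuous_intros)
    have g01: "0 \<le> g n x" "g n x \<le> 1" for n x by (auto simp: g_def)
    have glim: "(\<lambda>n. g n x) \<longlonglongrightarrow> (if \<alpha> < x \<and> x < \<beta> then 1 else 0)" for x
    proof (cases "\<alpha> < x \<and> x < \<beta>")
      case True
      define d where "d = min (x - \<alpha>) (\<beta> - x)"
      have d: "d > 0" using True by (simp add: d_def)
      obtain N :: nat where N: "1 / d < real N" using reals_Archimedean2 by blast
      have "\<forall>\<^sub>F n in sequentially. g n x = 1"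
        using eventually_ge_at_top[of N]
      proof eventually_elim
        case (elim n)
        have "1 \<le> real N * d" using N d by (simp add: field_simps)
        also have "\<dots> \<le> real n * d" using elim d by simp
        finally show ?case using d by (simp add: g_def d_def[symmetric])
      qed
      thus ?thesis using True by (simp add: tendsto_eventually)
    next
      case False
      hence "max 0 (min (x - \<alpha>) (\<beta> - x)) = 0" by auto
      hence "g n x = 0" for n by (simp add: g_def)
      thus ?thesis unfolding if_not_P[OF False] by simp
    qed
    show ?thesis
    proof (rule represented_dominated[OF cont[OF gc] meas_ind wL[of 1]])
      fix y :: real assume y: "y > 0"
      show "norm (complex_of_real (w y * g n (q y))) \<le> norm (complex_of_real (1 * w y))" for n
        unfolding norm_of_real abs_mult using g01[of n "q y"] by (simp add: mult_left_le)
      have "(\<lambda>n. complex_of_real (w y * g n (q y))) \<longlonglongrightarrow> complex_of_real (w y * (if \<alpha> < q y \<and> q y < \<beta> then 1 else 0))"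
        by (intro tendsto_intros glim)
      thus "(\<lambda>n. complex_of_real (w y * g n (q y))) \<longlonglongrightarrow> indicator {l<..<u} y * complex_of_real (w y)"
        unfolding iff[OF y] by (auto simp: indicator_def)
    qed simp
  qed
  have ind: "(\<lambda>y. indicator A y * complex_of_real (w y)) \<in> represented" if A: "A \<in> sets borel" for A :: "real set"
  proof -
    show ?thesis
      using A
    proof (induction rule: borel_open_interval_induct)
      case (interval a b)
      show ?case by (rule open_int)
    next
      case empty
      show ?case using zero by simp
    next
      case (compl A)
      have "(\<lambda>y. 1 * complex_of_real (w y) + (-1) * (indicator A y * complex_of_real (w y))) \<in> represented"
        by (rule represented_linear[OF w1 compl(2)])
      also have "(\<lambda>y. 1 * complex_of_real (w y) + (-1) * (indicator A y * complex_of_real (w y))) = (\<lambda>y. indicator (UNIV - A) y * complex_of_real (w y))"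
        by (auto simp: indicator_def)
      finally show ?case .
    next
      case (union A)
      have "(\<lambda>y. \<Sum>i\<in>{..<n}. 1 * (indicator (A i) y * complex_of_real (w y))) \<in> represented" for n
        by (intro represented_sum union(3) zero)
      moreover have "(\<Sum>i\<in>{..<n}. 1 * (indicator (A i) y * complex_of_real (w y))) = indicator (\<Union>i<n. A i) y * complex_of_real (w y)" for n y
      proof -
        have "disjoint_family_on A {..<n}" using union(1) by (auto simp: disjoint_family_on_def)
        hence "indicator (\<Union>i<n. A i) y = (\<Sum>i<n. indicator (A i) y :: complex)"
          by (intro indicator_UN_disjoint) auto
        thus ?thesis by (simp add: sum_distrib_right)
      qed
      ultimately have U: "(\<lambda>y. indicator (\<Union>i<n. A i) y * complex_of_real (w y)) \<in> represented" for n by (simp only:)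
      show ?case
      proof (rule represented_dominated[OF U _ wL[of 1]])
        show "(\<lambda>y. indicator (\<Union>i. A i) y * complex_of_real (w y)) \<in> borel_measurable half_line"
          by (rule meas_ind) (use union(2) in auto)
        show "norm (indicator (\<Union>i<n. A i) y * complex_of_real (w y)) \<le> norm (complex_of_real (1 * w y))" for n y
          by (auto simp: indicator_def)
        fix y :: real
        have "(\<lambda>n. indicator (\<Union>i<n. A i) y :: complex) \<longlonglongrightarrow> indicator (\<Union>i. A i) y" by (rule LIMSEQ_indicator_UN)
        thus "(\<lambda>n. indicator (\<Union>i<n. A i) y * complex_of_real (w y)) \<longlonglongrightarrow> indicator (\<Union>i. A i) y * complex_of_real (w y)"
          by (intro tendsto_intros)
      qed
    qed
  qed
  show ?thesis
  proof
    show "represented \<subseteq> Lp_space m p" by (auto simp: represented_def)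
    show "Lp_space m p \<subseteq> represented"
    proof
      fix f assume f: "f \<in> Lp_space m p"
      \<comment> \<open>Indicators have been reached for Borel sets only, so f is extended by 0 and
        replaced by a Borel function.\<close>
      have "(\<lambda>y. if y \<in> {0<..} then f y else 0) \<in> borel_measurable lebesgue"
        using f by (subst borel_measurable_if) (auto simp: Lp_space_iff)
      then obtain g where g: "g \<in> borel_measurable lborel" "AE y in lborel. (if y \<in> {0<..} then f y else 0) = g y"
        by (rule completion_ex_borel_measurable_complex)
      have "AE y in lebesgue. (if y \<in> {0<..} then f y else 0) = g y" using g(2) by (rule AE_completion)
      hence "AE y in lebesgue. y \<in> {0<..} \<longrightarrow> g y = f y" by eventually_elim auto
      hence fg: "AE y in half_line. g y = f y" by (simp add: AE_restrict_space_iff)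
      have fm: "f \<in> borel_measurable half_line" using f by (simp add: Lp_space_iff)
      have gm: "g \<in> borel_measurable half_line"
        using g(1) by (intro measurable_restrict_space1 measurable_completion)
      have gL: "g \<in> Lp_space m p"
        by (rule Lp_space_dominated(1)[OF gm p0 f]) (use fg in \<open>eventually_elim, simp\<close>)
      \<comment> \<open>The indicators reached carry the factor w, so simple functions approximate g
        / w. Multiplied by w they are dominated by 2 |g|.\<close>
      have "(\<lambda>y. of_real (w y) :: complex) \<in> borel_measurable borel"
        unfolding w_def by measurable
      hence "(\<lambda>y. g y / of_real (w y)) \<in> borel_measurable borel"
        using g(1) by (intro borel_measurable_divide) auto
      from borel_measurable_implies_sequence_metric[OF this, of 0]
      obtain s where s: "\<And>i. simple_function borel (s i)" "\<And>y. (\<lambda>i. s i y) \<longlonglongrightarrow> g y / of_real (w y)"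
        "\<And>i y. norm (s i y) \<le> 2 * norm (g y / of_real (w y))"
        by (auto simp: dist_norm)
      have sr: "(\<lambda>y. s i y * of_real (w y)) \<in> represented" for i
      proof -
        have "(\<lambda>y. \<Sum>c\<in>s i ` UNIV. c * (indicator (s i -` {c}) y * complex_of_real (w y))) \<in> represented"
        proof (intro represented_sum zero ind)
          show "s i -` {c} \<in> sets borel" if "c \<in> range (s i)" for c
            using s(1)[of i] that by (auto simp: simple_function_def)
        qed
        moreover have "(\<Sum>c\<in>s i ` UNIV. c * (indicator (s i -` {c}) y * complex_of_real (w y))) = s i y * of_real (w y)" for y
        proof -
          have "(\<Sum>c\<in>s i ` UNIV. c * (indicator (s i -` {c}) y * complex_of_real (w y))) = (\<Sum>c\<in>s i ` UNIV. if s i y = c then c * of_real (w y) else 0)"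
            by (rule sum.cong) (auto simp: indicator_def)
          also have "\<dots> = s i y * of_real (w y)"
            using s(1)[of i] by (subst sum.delta') (auto simp: simple_function_def)
          finally show ?thesis .
        qed
        ultimately show ?thesis by simp
      qed
      have "g \<in> represented"
      proof (rule represented_dominated[OF sr gm Lp_space_cmult(1)[OF gL, of 2]])
        fix y :: real assume y: "y > 0"
        have w0: "complex_of_real (w y) \<noteq> 0" using wpos[OF y] by simp
        show "norm (s n y * of_real (w y)) \<le> norm (2 * g y)" for n
          using mult_right_mono[OF s(3)[of n y], of "w y"] wpos[OF y] by (simp add: norm_mult norm_divide)
        have "(\<lambda>n. s n y * of_real (w y)) \<longlonglongrightarrow> g y / of_real (w y) * of_real (w y)"
          by (intro tendsto_intros s(2))
        thus "(\<lambda>n. s n y * of_real (w y)) \<longlonglongrightarrow> g y" using w0 by simp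
      qed
      thus "f \<in> represented" by (rule represented_cong_AE[OF _ fm fg])
    qed
  qed
qed

end

section \<open>Specialization to the kernel of L\<close>

lemma sector_Re_ge:
  assumes "0 < \<epsilon>" "\<epsilon> < pi / 2" "z \<in> sector (pi / 2 - \<epsilon>)"
  shows "z \<noteq> 0" "sin \<epsilon> * norm z \<le> Re z"
proof -
  show z: "z \<noteq> 0" using assms by (simp add: sector_def)
  have "cos (pi / 2 - \<epsilon>) \<le> cos \<bar>Arg z\<bar>"
    using assms by (intro cos_monotone_0_pi_le) (auto simp: sector_def)
  hence "sin \<epsilon> \<le> Re z / norm z" using cos_Arg[OF z] by (simp add: cos_diff)
  thus "sin \<epsilon> * norm z \<le> Re z" using z by (simp add: pos_le_divide_eq)
qed

lemma semigroup_kernel_representation: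
  fixes b c m p :: real
  assumes D: "discr b c \<ge> 0" and p: "1 < p" and s1: "s1 b c < (m + 1) / p" and s2: "(m + 1) / p < s2 b c + 2"
    and gen: "generates_bounded_analytic_semigroup m p (pi / 2) (L_dom b c m p) (L_op b c) T"
    and z: "Re z > 0" and f: "f \<in> Lp_space m p"
  shows "AE y in half_line. integrable half_line (\<lambda>\<rho>. p_L b c z y \<rho> * f \<rho>) \<and>
     T z f y = integral\<^sup>L half_line (\<lambda>\<rho>. p_L b c z y \<rho> * f \<rho>)"
proof -
  define \<nu> where "\<nu> = sqrt (discr b c)"
  define a where "a = - s1 b c"
  define \<beta> where "\<beta> = - s1 b c + c"
  define k where "k = bessel_kernel \<nu> a \<beta> z"
  have \<nu>: "\<nu> \<ge> 0" using D by (simp add: \<nu>_def)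
  have ab: "a + \<beta> = 2 * \<nu> + 1" by (simp add: a_def \<beta>_def s1_def \<nu>_def field_simps)
  \<comment> \<open>Since s1 + s2 = c - 1, the bound \<beta> + 1 of the dual condition is s2 +
    2.\<close>
  have m: "(m + 1) / p < \<beta> + 1" using s2 by (simp add: \<beta>_def s1_def s2_def field_simps)
  have bas: "bounded_analytic_semigroup m p (pi / 2) T" using gen by (simp add: generates_bounded_analytic_semigroup_def)
  interpret kernel_representation m p T z k
    using p bas z bessel_kernel_dual[OF \<nu> z _ p m] by unfold_locales (auto simp: k_def)
  have ap: "a * p + m > -1" using s1 p0 by (simp add: a_def field_simps)
  have "represented = Lp_space m p"
  proof (rule represented_eq_Lp[OF ap])
    fix n :: nat assume n: "n \<ge> 1"
    define \<tau> where "\<tau> = 1 / (4 * real n)"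
    have \<tau>: "\<tau> > 0" using n by (simp add: \<tau>_def)
    have "gauss_orbit \<nu> a (of_real \<tau>) \<in> represented"
    proof -
      have "AE y in half_line. T z (gauss_orbit \<nu> a (of_real \<tau>)) y = gauss_orbit \<nu> a (of_real \<tau> + z) y"
        unfolding \<nu>_def a_def by (rule semigroup_orbit[OF D p s1 gen z \<tau>])
      hence "AE y in half_line. T z (gauss_orbit \<nu> a (of_real \<tau>)) y = (LINT \<rho>|half_line. k y \<rho> * gauss_orbit \<nu> a (of_real \<tau>) \<rho>)"
        unfolding k_def bessel_kernel_gauss_orbit[OF \<nu> ab z \<tau>] .
      thus ?thesis using gauss_orbit_Lp(1)[OF p0 ap, of "of_real \<tau>" \<nu>] \<tau> by (simp add: represented_def)
    qed
    \<comment> \<open>Linearity with a zero second summand removes the constant \<tau>^{-\<nu>-1}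
      from the Gaussian.\<close>
    from represented_linear[OF this this, of "of_real \<tau> powr (of_real (\<nu> + 1))" 0]
    have "(\<lambda>y. of_real \<tau> powr (of_real (\<nu> + 1)) * gauss_orbit \<nu> a (of_real \<tau>) y) \<in> represented" by simp
    also have "(\<lambda>y. of_real \<tau> powr (of_real (\<nu> + 1)) * gauss_orbit \<nu> a (of_real \<tau>) y) = (\<lambda>y. of_real (y powr a * exp (- (real n * y\<^sup>2))))"
    proof
      fix y
      have "complex_of_real \<tau> \<noteq> 0" using \<tau> by simp
      hence 1: "complex_of_real \<tau> powr (of_real (\<nu> + 1)) * of_real \<tau> powr (- of_real (\<nu> + 1)) = 1"
        unfolding powr_minus by simp
      have "complex_of_real (y\<^sup>2) / (4 * of_real \<tau>) = of_real (real n * y\<^sup>2)" using n by (simp add: \<tau>_def)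
      hence 2: "exp (- (complex_of_real (y\<^sup>2) / (4 * of_real \<tau>))) = of_real (exp (- (real n * y\<^sup>2)))"
        unfolding exp_of_real[symmetric] of_real_minus by simp
      have "of_real \<tau> powr (of_real (\<nu> + 1)) * gauss_orbit \<nu> a (of_real \<tau>) y = (complex_of_real \<tau> powr (of_real (\<nu> + 1)) * of_real \<tau> powr (- of_real (\<nu> + 1))) *
         of_real (y powr a) * exp (- (complex_of_real (y\<^sup>2) / (4 * of_real \<tau>)))"
        unfolding gauss_orbit_def by (simp only: mult_ac)
      thus "of_real \<tau> powr (of_real (\<nu> + 1)) * gauss_orbit \<nu> a (of_real \<tau>) y = of_real (y powr a * exp (- (real n * y\<^sup>2)))"
        unfolding 1 2 by simp
    qed
    finally show "(\<lambda>y. of_real (y powr a * exp (- (real n * y\<^sup>2)))) \<in> represented" .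
  qed
  hence "AE y in half_line. T z f y = (LINT \<rho>|half_line. k y \<rho> * f \<rho>)"
    using f by (auto simp: represented_def)
  with AE_half_line_pos show ?thesis
  proof eventually_elim
    case (elim y)
    have e: "p_L b c z y \<rho> * f \<rho> = k y \<rho> * f \<rho>" if "\<rho> \<in> space half_line" for \<rho>
      using p_L_eq_bessel_kernel[of y \<rho> b c z] elim(1) that by (simp add: k_def \<nu>_def a_def \<beta>_def)
    have "integrable half_line (\<lambda>\<rho>. p_L b c z y \<rho> * f \<rho>) \<longleftrightarrow> integrable half_line (\<lambda>\<rho>. k y \<rho> * f \<rho>)"
      by (rule Bochner_Integration.integrable_cong[OF refl e])
    moreover have "integral\<^sup>L half_line (\<lambda>\<rho>. p_L b c z y \<rho> * f \<rho>) = integral\<^sup>L half_line (\<lambda>\<rho>. k y \<rho> * f \<rho>)"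
      by (rule Bochner_Integration.integral_cong[OF refl e])
    ultimately show ?case using elim kernel_integrable[OF elim(1) f] by simp
  qed
qed

lemma p_L_estimates:
  fixes b c \<epsilon> :: real
  assumes D: "discr b c \<ge> 0" and \<epsilon>: "0 < \<epsilon>" "\<epsilon> < pi / 2"
  obtains C where "C > 0"
    "\<And>z y \<rho>. z \<in> sector (pi / 2 - \<epsilon>) \<Longrightarrow> y > 0 \<Longrightarrow> \<rho> > 0 \<Longrightarrow>
       norm (p_L b c z y \<rho>) \<le> kernel_bound C (8 / sin \<epsilon>) (- 1 / 2) (- s1 b c) (- s1 b c + c) z y \<rho>"
    "\<And>z y \<rho>. z \<in> sector (pi / 2 - \<epsilon>) \<Longrightarrow> y > 0 \<Longrightarrow> \<rho> > 0 \<Longrightarrow>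
       norm (p_L b c z y \<rho>) / y + norm (vector_derivative (\<lambda>x. p_L b c z x \<rho>) (at y))
         \<le> kernel_bound C (8 / sin \<epsilon>) (- 1) (- s1 b c - 1) (- s1 b c + c) z y \<rho>"
proof -
  define \<nu> where "\<nu> = sqrt (discr b c)"
  define k where "k = bessel_kernel \<nu> (- s1 b c) (- s1 b c + c)"
  have \<nu>: "\<nu> \<ge> 0" using D by (simp add: \<nu>_def)
  have ab: "- s1 b c + (- s1 b c + c) = 2 * \<nu> + 1" by (simp add: s1_def \<nu>_def field_simps)
  have \<sigma>: "0 < sin \<epsilon>" "sin \<epsilon> \<le> 1" using \<epsilon> by (auto intro!: sin_gt_zero)
  have eq: "p_L b c z x \<rho> = k z x \<rho>" if "x > 0" "\<rho> > 0" for z x \<rho>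
    unfolding k_def \<nu>_def by (rule p_L_eq_bessel_kernel[OF that])
  \<comment> \<open>The two kernels agree only for positive x, but that is a neighbourhood of
    y.\<close>
  have deq: "vector_derivative (\<lambda>x. p_L b c z x \<rho>) (at y) = vector_derivative (\<lambda>x. k z x \<rho>) (at y)"
    if "y > 0" "\<rho> > 0" for z y \<rho>
  proof (rule vector_derivative_cong_eq)
    show "\<forall>\<^sub>F x in nhds y. x \<in> UNIV \<longrightarrow> p_L b c z x \<rho> = k z x \<rho>"
      using eventually_nhds_in_open[of "{0<..}" y] that by (auto elim!: eventually_mono simp: eq)
  qed auto
  obtain C where C: "C > 0"
    "\<And>z y \<rho>. z \<noteq> 0 \<Longrightarrow> sin \<epsilon> * norm z \<le> Re z \<Longrightarrow> y > 0 \<Longrightarrow> \<rho> > 0 \<Longrightarrow>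
       norm (k z y \<rho>) \<le> kernel_bound C (8 / sin \<epsilon>) (- 1 / 2) (- s1 b c) (- s1 b c + c) z y \<rho>"
    "\<And>z y \<rho>. z \<noteq> 0 \<Longrightarrow> sin \<epsilon> * norm z \<le> Re z \<Longrightarrow> y > 0 \<Longrightarrow> \<rho> > 0 \<Longrightarrow>
       norm (k z y \<rho>) / y + norm (vector_derivative (\<lambda>x. k z x \<rho>) (at y))
         \<le> kernel_bound C (8 / sin \<epsilon>) (- 1) (- s1 b c - 1) (- s1 b c + c) z y \<rho>"
    using bessel_kernel_estimate[OF \<nu> ab \<sigma>, folded k_def] by blast
  show ?thesis
  proof (rule that[OF C(1)])
    fix z :: complex and y \<rho> :: real
    assume z: "z \<in> sector (pi / 2 - \<epsilon>)" and pos: "y > 0" "\<rho> > 0"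
    note z' = sector_Re_ge[OF \<epsilon> z]
    show "norm (p_L b c z y \<rho>) \<le> kernel_bound C (8 / sin \<epsilon>) (- 1 / 2) (- s1 b c) (- s1 b c + c) z y \<rho>"
      unfolding eq[OF pos] by (rule C(2)[OF z' pos])
    show "norm (p_L b c z y \<rho>) / y + norm (vector_derivative (\<lambda>x. p_L b c z x \<rho>) (at y))
         \<le> kernel_bound C (8 / sin \<epsilon>) (- 1) (- s1 b c - 1) (- s1 b c + c) z y \<rho>"
      unfolding eq[OF pos] deq[OF pos] by (rule C(3)[OF z' pos])
  qed
qed

theorem proposition4p5:
  fixes b c m p :: real
  assumes "discr b c \<ge> 0"
    and "1 < p"
    and "s1 b c \<noteq> 0"
    and "s1 b c < (m + 1) / p"
    and "(m + 1) / p < s2 b c + 2"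
  shows "(\<forall>T. generates_bounded_analytic_semigroup m p (pi / 2) (L_dom b c m p) (L_op b c) T \<longrightarrow>
            (\<forall>z f. Re z > 0 \<and> f \<in> Lp_space m p \<longrightarrow>
               (AE y in half_line. integrable half_line (\<lambda>\<rho>. p_L b c z y \<rho> * f \<rho>) \<and>
                  T z f y = integral\<^sup>L half_line (\<lambda>\<rho>. p_L b c z y \<rho> * f \<rho>)))) \<and>
         (\<forall>\<epsilon>. 0 < \<epsilon> \<and> \<epsilon> < pi / 2 \<longrightarrow>
            (\<exists>C>0. \<exists>\<kappa>>0. \<forall>z\<in>sector (pi / 2 - \<epsilon>). \<forall>y>0. \<forall>\<rho>>0.
               norm (p_L b c z y \<rho>)
                 \<le> C * norm z powr (- 1 / 2)
                     * (min (y / norm z powr (1 / 2)) 1) powr (- s1 b c)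
                     * (min (\<rho> / norm z powr (1 / 2)) 1) powr (- s1 b c + c)
                     * exp (- (\<bar>y - \<rho>\<bar>\<^sup>2 / (\<kappa> * norm z)))
               \<and> norm (p_L b c z y \<rho>) / y
                   + norm (vector_derivative (\<lambda>x. p_L b c z x \<rho>) (at y))
                 \<le> C * norm z powr (- 1)
                     * (min (y / norm z powr (1 / 2)) 1) powr (- s1 b c - 1)
                     * (min (\<rho> / norm z powr (1 / 2)) 1) powr (- s1 b c + c)
                     * exp (- (\<bar>y - \<rho>\<bar>\<^sup>2 / (\<kappa> * norm z)))))"
proof (intro conjI allI impI, goal_cases)
  case (1 T z f)
  then show ?case using semigroup_kernel_representation[OF assms(1,2,4,5)] by blast
next
  case (2 \<epsilon>)
  hence \<epsilon>: "0 < \<epsilon>" "\<epsilon> < pi / 2" by auto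
  hence "8 / sin \<epsilon> > 0" using sin_gt_zero[of \<epsilon>] by simp
  with p_L_estimates[OF assms(1) \<epsilon>, unfolded kernel_bound_def] show ?case by metis
qed

end
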